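(* Let $(g,\zeta,L)$ be an admissible triplet with $L$ of zero type for an elliptic root system with marking of codimension $1$ (i.e. $d_{n-1}<d_n$). Let $z^0,\dots,z^n$ be a basis of $(L\oplus\mathbb R\delta)\otimes_{\mathbb R}\mathbb C$ with $z^0=\delta/(-2\pi\sqrt{-1})$, $z^1,\dots,z^{n-1}\in(L\cap F)\otimes\mathbb C$, $z^n\in(L\cap F)^\perp\otimes\mathbb C$, $\widetilde I(z^\alpha,z^\beta)=\delta_{\alpha+\beta,n}$ and $g\cdot z^\alpha=\zeta^{d_\alpha}z^\alpha$ $(0\le\alpha,\beta\le n)$. Put $x^0=\delta/(-2\pi\sqrt{-1})$ and let $x^1,\dots,x^n$ be a set of good basic invariants (with respect to $(g,\zeta,L)$) compatible with the $g$-homogeneous basis $z^1,\dots,z^n$ of $L\otimes_{\mathbb R}\mathbb C$. (i) $$x^n|_{L^\perp}=\frac{(-2\pi\sqrt{-1})(I_R:I)}{m_{max}}.$$ (ii) For $\beta=0,\dots,n$, $$\widetilde I_W(dx^0,dx^\beta)=\frac{m_{max}\,d_\beta}{(-2\pi\sqrt{-1})(I_R:I)\,d_n}\,x^\beta,$$ that is, $\frac{m_{\beta-1}}{(-2\pi\sqrt{-1})(I_R:I)}x^\beta$ for $1\le\beta\le n$ and $0$ for $\beta=0$. (iii) Every $\widetilde I_W(dx^\alpha,dx^\beta)$ $(\alpha,\beta=1,\dots,n)$ is written by the Taylor coefficients $$\left.\frac{\partial^ax^\alpha}{\partial z^a}\right|_{L^\perp},\quad\left.\left(\frac{\partial}{\partial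 z^0}\frac{\partial^ax^\alpha}{\partial z^a}\right)\right|_{L^\perp}\qquad(1\le\alpha\le n,\ a\in\mathbb Z^n_{\ge0},\ d\cdot a=d_\alpha+d_n)$$ as follows: $$\widetilde I_W(dx^\alpha,dx^\beta)=\delta_{\alpha+\beta,n}\left(\frac1{x^n|_{L^\perp}}\right)x^n+\sum_{\substack{b=(b_1,\dots,b_n)\in\mathbb Z_{\ge0}^n\\ b_n=0,\ d\cdot b=d_\alpha+d_\beta}}\frac1{b!}\left.\left[\frac{\partial^b}{\partial z^b}\left(\frac{\partial x^\alpha}{\partial z^{\beta*}}+\frac{\partial x^\beta}{\partial z^{\alpha*}}\right)\right]\right|_{L^\perp}x^b,$$ where $\alpha*=n-\alpha$ $(0\le\alpha\le n)$.
   Context: Root system. $l\ge 1$ is an integer, $n=l+1$. $F$ is a real vector space of dimension $l+2$ with a positive semi-definite symmetric bilinear form $I$ whose radical $\mathrm{rad}\,I$ has dimension $2$. For $\alpha\in F$ with $I(\alpha,\alpha)\ne0$ put $\alpha^\vee=2\alpha/I(\alpha,\alpha)$, $w_\alpha(u)=u-I(u,\alpha^\vee)\alpha$. $R\subset F$ is an elliptic root system belonging to $(F,I)$: a set of vectors with $I(\alpha,\alpha)\neq 0$ such that (1) the additive group $Q(R)$ generated by $R$ is a full lattice in $F$; (2) $I(\alpha,\beta^\vee)\in\mathbb Z$ for $\alpha,\beta\in R$; (3) $w_\alpha(R)=R$ for $\alpha\in R$; (4) if $R=R_1\cup R_2$ with $R_1\perp R_2$ then $R_1$ or $R_2$ is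 empty. A marking is fixed: a line $G\subset\mathrm{rad}\,I$ with $G\cap Q(R)\simeq\mathbb Z$; $a,\delta$ are chosen with $G\cap Q(R)=\mathbb Za$, $Q(R)\cap\mathrm{rad}\,I=\mathbb Za\oplus\mathbb Z\delta$. $(I_R:I)>0$ is the smallest number such that $(I_R:I)I$ makes $Q(R)$ an even lattice. Hyperbolic extension. $\widetilde F\supset F$ is a real vector space of dimension $l+3$ with symmetric bilinear form $\widetilde I$ (extended $\mathbb C$-bilinearly to $\widetilde F\otimes\mathbb C$), $\widetilde I|_F=I$, $\mathrm{rad}\,\widetilde I=\mathbb Ra$; $\Lambda_0\in\widetilde F$ satisfies $\widetilde I(\Lambda_0,\delta)=1$, $\widetilde I(\Lambda_0,\Lambda_0)=0$. $O(\widetilde F,F,\mathrm{rad}\,I)$ is the group of $g\in GL(\widetilde F)$ preserving $\widetilde I$ with $g(F)\subset F$ and $g|_{\mathrm{rad}\,I}=id$. The elliptic Weyl group $W\subset O(\widetilde F,F,\mathrm{rad}\,I)$ is generated by $\widetilde w_\alpha(u)=u-\widetilde I(u,\alpha^\vee)\alpha$ ($\alpha\in R$). Exponents. Following Saito, the image of $R$ in $F/G$ is a reduced affine root system. Let $\alpha_0,\dots,\alpha_l\in R$ be lifts of its simple roots, $n_i$ the coprime positive integers with $\sum n_i\alpha_i\equiv\pm\delta$ mod $G$, $k(\alpha)=\min\{k\in\mathbb Z_{>0}\mid\alpha+ka\in R\}$. The exponents $m_0\le\dots\le m_l=:m_{max}$ are the numbers $(I_R:I)I(\alpha_i,\alpha_i)n_i/(2k(\alpha_i))$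 in increasing order. $d_n$ is the smallest common denominator of the $m_i/m_{max}$, $d_\alpha:=m_{\alpha-1}d_n/m_{max}$ ($1\le\alpha\le n$), $d_0:=0$; $d=(d_1,\dots,d_n)$, $d\cdot b=\sum d_ib_i$. In codimension $1$ ($d_{n-1}<d_n$) it is known that $d_\alpha+d_{n-\alpha}=d_n$ ($0\le\alpha\le n$). Invariants. $Y=\{x\in\mathrm{Hom}_{\mathbb R}(\widetilde F,\mathbb C)\mid\langle a,x\rangle=-2\pi\sqrt{-1},\ \mathrm{Re}\langle\delta,x\rangle>0\}$, $H=\{x\in\mathrm{Hom}_{\mathbb R}(\mathrm{rad}\,I,\mathbb C)\mid \langle a,x\rangle=-2\pi\sqrt{-1},\ \mathrm{Re}\langle\delta,x\rangle>0\}$, $\pi:Y\to H$ restriction; $F(Y),F(H)$ are the rings of holomorphic functions, $F(H)\subset F(Y)$ via $\pi^*$. $g\in O(\widetilde F,F,\mathrm{rad}\,I)$ acts on $Y$ by $\langle\gamma,g\cdot x\rangle=\langle g^{-1}\gamma,x\rangle$ and on functions by $(g\cdot f)(x)=f(g^{-1}x)$. The Euler field $E$ is the vector field on $Y$ with $E(f)=0$ for $f\in F$ and $E(\Lambda_0)=(I_R:I)d_n/m_{max}$. $S^W_m$ is the set of $W$-invariant $f\in F(Y)$ with $Ef=mf$; $S^W=\bigoplus_{m\ge0}S^W_m$. It is known that $S^W$ is a polynomial $F(H)$-algebra on algebraically independent homogeneous generators $x^1,\dots,x^n$ of degrees $0<d_1\le\dots\le d_n$, called a set of basic invariants. $x^b=(x^1)^{b_1}\cdots(x^n)^{b_n}$.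 Admissible triplet. $(g,\zeta,L)$ ($g\in O(\widetilde F,F,\mathrm{rad}\,I)$, $\zeta\in\mathbb C^*$, $L\subset\widetilde F$ a subspace) is admissible if: (i) $g$ is semi-simple, $(g-id)(\widetilde F)\subset F$; (ii) $\zeta$ is a primitive $d_n$-th root of unity and $g\cdot x^\alpha=\zeta^{d_\alpha}x^\alpha$ ($1\le\alpha\le n$) for a set of basic invariants; (iii) $\widetilde F=L\oplus\mathrm{rad}\,I$, $g(L)=L$, $L\cap R=\emptyset$. $L$ is of zero type if $\widetilde I|_L$ has $n-1$ positive, one zero and no negative eigenvalues. $L^\perp=\{x\in Y\mid\langle v,x\rangle=0\ \forall v\in L\}$; $\pi$ gives $L^\perp\simeq H$, so $f|_{L^\perp}$ is regarded as an element of $F(H)$. $(L\cap F)^\perp:=\{x\in L\mid\widetilde I(x,y)=0\ \forall y\in L\cap F\}$. A basis $z^0,\dots,z^n$ as in the claim exists and gives coordinates on $Y$; $\partial^b/\partial z^b=\prod_{i=1}^n(\partial/\partial z^i)^{b_i}$, $b!=\prod b_i!$. Good and compatible. $F(H)[L]=F(H)[z^1,\dots,z^n]$ graded by $\deg z^\alpha=d_\alpha$. The $F(H)$-linear map $$\psi[g,\zeta,L]:S^W\to F(H)[L],\quad x^a\mapsto\sum_{b\in\mathbb Z_{\ge0}^n,\ d\cdot b=d\cdot a}\frac1{b!}\left.\frac{\partial^b\big(\prod_\gamma(x^\gamma-x^\gamma|_{L^\perp})^{a_\gamma}\big)}{\partial z^b}\right|_{L^\perp}z^b$$ is independent of choices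 and an isomorphism of graded $F(H)$-algebras. A set of basic invariants is good if it is a $\mathbb C$-basis of $\psi[g,\zeta,L]^{-1}(L\otimes_{\mathbb R}\mathbb C)$. It is compatible with $z^1,\dots,z^n$ if $\frac{\partial x^\alpha}{\partial z^\beta}|_{L^\perp}=\delta^\alpha_\beta$ (Kronecker delta) for $1\le\alpha,\beta\le n$. Bilinear form on invariants. $\widetilde I_W(dx^\alpha,dx^\beta):=\sum_{\gamma_1,\gamma_2=0}^n\frac{\partial x^\alpha}{\partial z^{\gamma_1}}\frac{\partial x^\beta}{\partial z^{\gamma_2}}\widetilde I(z^{\gamma_1},z^{\gamma_2})\in S^W$ for $0\le\alpha,\beta\le n$. *)

theory Defs
  imports "HOL-Analysis.Analysis"
begin

text \<open>The extended space is the whole type \<^typ>\<open>'v\<close>. Only its vector space structure, and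
  the topology of a finite dimensional space, matter; its inner product is auxiliary. The form
  on the subspace \<open>Fsp\<close> is the restriction of \<open>form\<close>, and the marking is the line spanned by
  \<open>va\<close>. The fields \<open>simp_lift\<close> and \<open>lab\<close> hold lifts of the simple roots of the affine quotient
  root system and its labels; they enter through the exponents only.\<close>

record 'v elliptic =
  rk :: nat
  Fsp :: "'v set"
  form :: "'v \<Rightarrow> 'v \<Rightarrow> real"
  roots :: "'v set"
  va :: 'v
  vdelta :: 'v
  Lam :: 'v
  simp_lift :: "nat \<Rightarrow> 'v"
  lab :: "nat \<Rightarrow> nat"

abbreviation nn :: "('v, 'm) elliptic_scheme \<Rightarrow> nat" where
  "nn S \<equiv> rk S + 1"

definition radF :: "('v::euclidean_space, 'm) elliptic_scheme \<Rightarrow> 'v set" where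
  "radF S = {v \<in> Fsp S. \<forall>u\<in>Fsp S. form S v u = 0}"

definition coroot :: "('v::euclidean_space, 'm) elliptic_scheme \<Rightarrow> 'v \<Rightarrow> 'v" where
  "coroot S \<alpha> = (2 / form S \<alpha> \<alpha>) *\<^sub>R \<alpha>"

definition refl :: "('v::euclidean_space, 'm) elliptic_scheme \<Rightarrow> 'v \<Rightarrow> 'v \<Rightarrow> 'v" where
  "refl S \<alpha> u = u - form S u (coroot S \<alpha>) *\<^sub>R \<alpha>"

definition int_span :: "'v::euclidean_space set \<Rightarrow> 'v set" where
  "int_span B = {\<Sum>\<alpha>\<in>A. of_int (k \<alpha>) *\<^sub>R \<alpha> | A (k :: 'v \<Rightarrow> int). finite A \<and> A \<subseteq> B}"

definition full_lattice :: "'v::euclidean_space set \<Rightarrow> 'v set \<Rightarrow> bool" where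
  "full_lattice Q V \<longleftrightarrow> (\<exists>B. independent B \<and> span B = V \<and> int_span B = Q)"

abbreviation QR :: "('v::euclidean_space, 'm) elliptic_scheme \<Rightarrow> 'v set" where
  "QR S \<equiv> int_span (roots S)"

definition elliptic_root_system :: "('v::euclidean_space, 'm) elliptic_scheme \<Rightarrow> bool" where
  "elliptic_root_system S \<longleftrightarrow>
     rk S \<ge> 1 \<and> subspace (Fsp S) \<and> dim (Fsp S) = rk S + 2 \<and>
     (\<forall>u\<in>Fsp S. form S u u \<ge> 0) \<and> dim (radF S) = 2 \<and>
     roots S \<subseteq> Fsp S \<and> (\<forall>\<alpha>\<in>roots S. form S \<alpha> \<alpha> \<noteq> 0) \<and>
     full_lattice (QR S) (Fsp S) \<and>
     (\<forall>\<alpha>\<in>roots S. \<forall>\<beta>\<in>roots S. form S \<alpha> (coroot S \<beta>) \<in> \<int>) \<and>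
     (\<forall>\<alpha>\<in>roots S. refl S \<alpha> ` roots S = roots S) \<and>
     (\<forall>R1 R2. roots S = R1 \<union> R2 \<and> (\<forall>\<alpha>\<in>R1. \<forall>\<beta>\<in>R2. form S \<alpha> \<beta> = 0)
        \<longrightarrow> R1 = {} \<or> R2 = {})"

definition marking :: "('v::euclidean_space, 'm) elliptic_scheme \<Rightarrow> bool" where
  "marking S \<longleftrightarrow>
     va S \<in> radF S \<and> va S \<noteq> 0 \<and>
     span {va S} \<inter> QR S = range (\<lambda>k::int. of_int k *\<^sub>R va S) \<and>
     QR S \<inter> radF S = {of_int j *\<^sub>R va S + of_int k *\<^sub>R vdelta S | (j::int) (k::int). True} \<and>
     independent {va S, vdelta S} \<and> va S \<noteq> vdelta S"

definition hyperbolic_extension :: "('v::euclidean_space, 'm) elliptic_scheme \<Rightarrow> bool" where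
  "hyperbolic_extension S \<longleftrightarrow>
     DIM('v) = rk S + 3 \<and> bilinear (form S) \<and> (\<forall>u v. form S u v = form S v u) \<and>
     {v. \<forall>u. form S v u = 0} = span {va S} \<and>
     form S (Lam S) (vdelta S) = 1 \<and> form S (Lam S) (Lam S) = 0"

text \<open>The image of the roots modulo the marking is reduced. The linear independence below is in
  the quotient by the marking, which has dimension \<open>rk S + 1\<close>.\<close>

definition reduced_mod_marking :: "('v::euclidean_space, 'm) elliptic_scheme \<Rightarrow> bool" where
  "reduced_mod_marking S \<longleftrightarrow>
     (\<forall>\<alpha>\<in>roots S. \<forall>\<beta>\<in>roots S. \<forall>c::real. \<beta> - c *\<^sub>R \<alpha> \<in> span {va S} \<longrightarrow> c = 1 \<or> c = -1)"

definition simple_lifts :: "('v::euclidean_space, 'm) elliptic_scheme \<Rightarrow> bool" where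
  "simple_lifts S \<longleftrightarrow>
     (\<forall>i\<le>rk S. simp_lift S i \<in> roots S) \<and>
     (\<forall>c::nat \<Rightarrow> real. (\<Sum>i\<le>rk S. c i *\<^sub>R simp_lift S i) \<in> span {va S} \<longrightarrow> (\<forall>i\<le>rk S. c i = 0)) \<and>
     (\<forall>\<beta>\<in>roots S. \<exists>k::nat \<Rightarrow> int. ((\<forall>i\<le>rk S. k i \<ge> 0) \<or> (\<forall>i\<le>rk S. k i \<le> 0)) \<and>
        \<beta> - (\<Sum>i\<le>rk S. of_int (k i) *\<^sub>R simp_lift S i) \<in> span {va S})"

definition labels :: "('v::euclidean_space, 'm) elliptic_scheme \<Rightarrow> bool" where
  "labels S \<longleftrightarrow>
     (\<forall>i\<le>rk S. lab S i > 0) \<and> Gcd (lab S ` {..rk S}) = 1 \<and>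
     (\<exists>e\<in>{1, -1::real}.
        (\<Sum>i\<le>rk S. of_nat (lab S i) *\<^sub>R simp_lift S i) - e *\<^sub>R vdelta S \<in> span {va S})"

definition elliptic_setting :: "('v::euclidean_space, 'm) elliptic_scheme \<Rightarrow> bool" where
  "elliptic_setting S \<longleftrightarrow> elliptic_root_system S \<and> marking S \<and> hyperbolic_extension S \<and>
     reduced_mod_marking S \<and> simple_lifts S \<and> labels S"

text \<open>\<open>IRI S\<close> is the number written $(I_R : I)$.\<close>

definition IRI :: "('v::euclidean_space, 'm) elliptic_scheme \<Rightarrow> real" where
  "IRI S = (LEAST c. c > 0 \<and> (\<forall>v\<in>QR S. c * form S v v / 2 \<in> \<int>))"

definition kk :: "('v::euclidean_space, 'm) elliptic_scheme \<Rightarrow> 'v \<Rightarrow> nat" where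
  "kk S \<alpha> = (LEAST k. k > 0 \<and> \<alpha> + of_nat k *\<^sub>R va S \<in> roots S)"

definition expo :: "('v::euclidean_space, 'm) elliptic_scheme \<Rightarrow> nat \<Rightarrow> real" where
  "expo S i = sort (map (\<lambda>j. IRI S * form S (simp_lift S j) (simp_lift S j) * of_nat (lab S j)
                      / (2 * of_nat (kk S (simp_lift S j)))) [0..<rk S + 1]) ! i"

definition mmax :: "('v::euclidean_space, 'm) elliptic_scheme \<Rightarrow> real" where
  "mmax S = expo S (rk S)"

definition dtop :: "('v::euclidean_space, 'm) elliptic_scheme \<Rightarrow> nat" where
  "dtop S = (LEAST D. D > 0 \<and> (\<forall>i\<le>rk S. of_nat D * (expo S i / mmax S) \<in> \<int>))"

text \<open>The floor is taken of an integer, by the choice of \<^const>\<open>dtop\<close>.\<close>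

definition dg :: "('v::euclidean_space, 'm) elliptic_scheme \<Rightarrow> nat \<Rightarrow> nat" where
  "dg S \<alpha> = (if \<alpha> = 0 then 0 else nat \<lfloor>expo S (\<alpha> - 1) * of_nat (dtop S) / mmax S\<rfloor>)"

definition codim_one :: "('v::euclidean_space, 'm) elliptic_scheme \<Rightarrow> bool" where
  "codim_one S \<longleftrightarrow> dg S (nn S - 1) < dg S (nn S)"

text \<open>The pair \<open>(u, v)\<close> stands for $u + \sqrt{-1}\, v$.\<close>

type_synonym 'v cplxfn = "'v \<times> 'v"

definition csc :: "complex \<Rightarrow> 'v::euclidean_space cplxfn \<Rightarrow> 'v cplxfn" where
  "csc c w = (Re c *\<^sub>R fst w - Im c *\<^sub>R snd w, Re c *\<^sub>R snd w + Im c *\<^sub>R fst w)"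

definition cform :: "('v::euclidean_space, 'm) elliptic_scheme \<Rightarrow> 'v cplxfn \<Rightarrow> 'v cplxfn \<Rightarrow> complex" where
  "cform S w w' = Complex (form S (fst w) (fst w') - form S (snd w) (snd w'))
                          (form S (fst w) (snd w') + form S (snd w) (fst w'))"

definition cspace :: "'v::euclidean_space set \<Rightarrow> 'v cplxfn set" where
  "cspace V = V \<times> V"

definition cmap :: "('v \<Rightarrow> 'v) \<Rightarrow> 'v::euclidean_space cplxfn \<Rightarrow> 'v cplxfn" where
  "cmap g w = (g (fst w), g (snd w))"

definition cpair :: "'v::euclidean_space cplxfn \<Rightarrow> ('v \<Rightarrow>\<^sub>L complex) \<Rightarrow> complex" where
  "cpair w x = blinfun_apply x (fst w) + \<i> * blinfun_apply x (snd w)"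

definition cbasis :: "nat set \<Rightarrow> (nat \<Rightarrow> 'v::euclidean_space cplxfn) \<Rightarrow> 'v cplxfn set \<Rightarrow> bool" where
  "cbasis J z V \<longleftrightarrow> (\<forall>i\<in>J. z i \<in> V) \<and>
     (\<forall>c. (\<Sum>i\<in>J. csc (c i) (z i)) = 0 \<longrightarrow> (\<forall>i\<in>J. c i = 0)) \<and>
     (\<forall>v\<in>V. \<exists>c. v = (\<Sum>i\<in>J. csc (c i) (z i)))"

definition z0 :: "('v::euclidean_space, 'm) elliptic_scheme \<Rightarrow> 'v cplxfn" where
  "z0 S = csc (1 / (- 2 * of_real pi * \<i>)) (vdelta S, 0)"

text \<open>Functions on the domain \<open>Y\<close> are total functions whose values outside \<open>Y\<close> are irrelevant;
  equality of functions always means equality on \<open>Y\<close>.\<close>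

type_synonym 'v yfun = "('v \<Rightarrow>\<^sub>L complex) \<Rightarrow> complex"

definition Y :: "('v::euclidean_space, 'm) elliptic_scheme \<Rightarrow> ('v \<Rightarrow>\<^sub>L complex) set" where
  "Y S = {x. blinfun_apply x (va S) = - 2 * of_real pi * \<i> \<and> Re (blinfun_apply x (vdelta S)) > 0}"

definition hsc :: "complex \<Rightarrow> ('v::euclidean_space \<Rightarrow>\<^sub>L complex) \<Rightarrow> ('v \<Rightarrow>\<^sub>L complex)" where
  "hsc c h = Blinfun (\<lambda>v. c * blinfun_apply h v)"

text \<open>\<open>Y\<close> is open in a complex affine hyperplane with direction space $\{h \mid h(a) = 0\}$;
  holomorphic means differentiable with complex linear derivative on that space.\<close>

definition FY :: "('v::euclidean_space, 'm) elliptic_scheme \<Rightarrow> 'v yfun set" where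
  "FY S = {f. \<forall>p\<in>Y S. \<exists>D. (f has_derivative D) (at p within Y S) \<and>
               (\<forall>c h. blinfun_apply h (va S) = 0 \<longrightarrow> D (hsc c h) = c * D h)}"

text \<open>A point of the base \<open>H\<close> is a linear map on the radical $\mathbb{R}a \oplus \mathbb{R}\delta$
  with prescribed value at $a$, so its value at $\delta$ identifies \<open>H\<close> with the right half plane.
  \<open>FH\<close> is the pullback to \<open>Y\<close> of the ring of holomorphic functions on \<open>H\<close>.\<close>

definition FH :: "('v::euclidean_space, 'm) elliptic_scheme \<Rightarrow> 'v yfun set" where
  "FH S = {f. \<exists>h. h holomorphic_on {s. Re s > 0} \<and> (\<forall>p\<in>Y S. f p = h (blinfun_apply p (vdelta S)))}"

definition ortho_group :: "('v::euclidean_space, 'm) elliptic_scheme \<Rightarrow> ('v \<Rightarrow> 'v) set" where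
  "ortho_group S = {g. linear g \<and> bij g \<and> (\<forall>u v. form S (g u) (g v) = form S u v) \<and>
                       g ` Fsp S \<subseteq> Fsp S \<and> (\<forall>v\<in>radF S. g v = v)}"

definition act_pt :: "('v \<Rightarrow> 'v) \<Rightarrow> ('v::euclidean_space \<Rightarrow>\<^sub>L complex) \<Rightarrow> ('v \<Rightarrow>\<^sub>L complex)" where
  "act_pt g x = Blinfun (\<lambda>\<gamma>. blinfun_apply x (inv g \<gamma>))"

definition act_fun :: "('v \<Rightarrow> 'v) \<Rightarrow> 'v::euclidean_space yfun \<Rightarrow> 'v yfun" where
  "act_fun g f = (\<lambda>x. f (act_pt (inv g) x))"

text \<open>The reflections are involutions, so the monoid they generate is the group they generate.\<close>

inductive_set Weyl :: "('v::euclidean_space, 'm) elliptic_scheme \<Rightarrow> ('v \<Rightarrow> 'v) set" for S where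
  one: "id \<in> Weyl S"
| step: "\<alpha> \<in> roots S \<Longrightarrow> w \<in> Weyl S \<Longrightarrow> refl S \<alpha> \<circ> w \<in> Weyl S"

definition dir_deriv :: "('v::euclidean_space \<Rightarrow>\<^sub>L complex) \<Rightarrow> 'v yfun \<Rightarrow> 'v yfun" where
  "dir_deriv h f = (\<lambda>p. deriv (\<lambda>t. f (p + hsc t h)) 0)"

definition euler :: "('v::euclidean_space, 'm) elliptic_scheme \<Rightarrow> 'v yfun \<Rightarrow> 'v yfun" where
  "euler S = dir_deriv (THE h. (\<forall>v\<in>Fsp S. blinfun_apply h v = 0) \<and>
      blinfun_apply h (Lam S) = of_real (IRI S * of_nat (dg S (nn S)) / mmax S))"

definition SWm :: "('v::euclidean_space, 'm) elliptic_scheme \<Rightarrow> nat \<Rightarrow> 'v yfun set" where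
  "SWm S m = {f \<in> FY S. (\<forall>w\<in>Weyl S. \<forall>p\<in>Y S. act_fun w f p = f p) \<and>
                         (\<forall>p\<in>Y S. euler S f p = of_nat m * f p)}"

definition SW :: "('v::euclidean_space, 'm) elliptic_scheme \<Rightarrow> 'v yfun set" where
  "SW S = {f. \<exists>N F. (\<forall>m\<le>N. F m \<in> SWm S m) \<and> (\<forall>p\<in>Y S. f p = (\<Sum>m\<le>(N::nat). F m p))}"

definition midx :: "nat \<Rightarrow> (nat \<Rightarrow> nat) set" where
  "midx n = {b. \<forall>i. i \<notin> {1..n} \<longrightarrow> b i = 0}"

definition ddot :: "('v::euclidean_space, 'm) elliptic_scheme \<Rightarrow> (nat \<Rightarrow> nat) \<Rightarrow> nat" where
  "ddot S b = (\<Sum>i=1..nn S. dg S i * b i)"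

definition mfact :: "nat \<Rightarrow> (nat \<Rightarrow> nat) \<Rightarrow> nat" where
  "mfact n b = (\<Prod>i=1..n. fact (b i))"

definition mono_fun :: "nat \<Rightarrow> (nat \<Rightarrow> 'v::euclidean_space yfun) \<Rightarrow> (nat \<Rightarrow> nat) \<Rightarrow> 'v yfun" where
  "mono_fun n x b = (\<lambda>p. \<Prod>i=1..n. x i p ^ b i)"

definition FH_coeffs ::
  "('v::euclidean_space, 'm) elliptic_scheme \<Rightarrow> (nat \<Rightarrow> nat) set \<Rightarrow> ((nat \<Rightarrow> nat) \<Rightarrow> 'v yfun) \<Rightarrow> bool" where
  "FH_coeffs S A c \<longleftrightarrow> finite A \<and> A \<subseteq> midx (nn S) \<and> (\<forall>a\<in>A. c a \<in> FH S)"

definition FH_polys :: "('v::euclidean_space, 'm) elliptic_scheme \<Rightarrow> (nat \<Rightarrow> 'v yfun) \<Rightarrow> 'v yfun set" where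
  "FH_polys S x = {f. \<exists>A c. FH_coeffs S A c \<and>
                       (\<forall>p\<in>Y S. f p = (\<Sum>a\<in>A. c a p * mono_fun (nn S) x a p))}"

definition basic_invariants :: "('v::euclidean_space, 'm) elliptic_scheme \<Rightarrow> (nat \<Rightarrow> 'v yfun) \<Rightarrow> bool" where
  "basic_invariants S x \<longleftrightarrow>
     (\<forall>\<alpha>\<in>{1..nn S}. x \<alpha> \<in> SWm S (dg S \<alpha>)) \<and>
     (\<forall>A c. FH_coeffs S A c \<and> (\<forall>p\<in>Y S. (\<Sum>a\<in>A. c a p * mono_fun (nn S) x a p) = 0)
        \<longrightarrow> (\<forall>a\<in>A. \<forall>p\<in>Y S. c a p = 0)) \<and>
     SW S \<subseteq> FH_polys S x"

definition semisimple :: "('v::euclidean_space \<Rightarrow> 'v) \<Rightarrow> bool" where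
  "semisimple g \<longleftrightarrow> (\<forall>U. subspace U \<and> g ` U \<subseteq> U \<longrightarrow>
     (\<exists>V. subspace V \<and> g ` V \<subseteq> V \<and> U \<inter> V = {0} \<and> {u + v | u v. u \<in> U \<and> v \<in> V} = UNIV))"

definition primitive_root :: "nat \<Rightarrow> complex \<Rightarrow> bool" where
  "primitive_root N \<zeta> \<longleftrightarrow> N > 0 \<and> \<zeta> ^ N = 1 \<and> (\<forall>k. 0 < k \<and> k < N \<longrightarrow> \<zeta> ^ k \<noteq> 1)"

definition admissible ::
  "('v::euclidean_space, 'm) elliptic_scheme \<Rightarrow> ('v \<Rightarrow> 'v) \<Rightarrow> complex \<Rightarrow> 'v set \<Rightarrow> bool" where
  "admissible S g \<zeta> L \<longleftrightarrow>
     g \<in> ortho_group S \<and> semisimple g \<and> (\<forall>u. g u - u \<in> Fsp S) \<and>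
     primitive_root (dg S (nn S)) \<zeta> \<and>
     (\<exists>x. basic_invariants S x \<and>
        (\<forall>\<alpha>\<in>{1..nn S}. \<forall>p\<in>Y S. act_fun g (x \<alpha>) p = \<zeta> ^ dg S \<alpha> * x \<alpha> p)) \<and>
     subspace L \<and> L \<inter> radF S = {0} \<and> {u + v | u v. u \<in> L \<and> v \<in> radF S} = UNIV \<and>
     g ` L = L \<and> L \<inter> roots S = {}"

text \<open>Eigenspaces of the form on \<open>L\<close> with respect to the auxiliary inner product; the numbers of
  positive, zero and negative eigenvalues (with multiplicity) do not depend on it.\<close>

definition eigsp :: "('v::euclidean_space, 'm) elliptic_scheme \<Rightarrow> 'v set \<Rightarrow> real \<Rightarrow> 'v set" where
  "eigsp S L c = {v \<in> L. \<forall>u\<in>L. form S v u = c * (v \<bullet> u)}"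

definition zero_type :: "('v::euclidean_space, 'm) elliptic_scheme \<Rightarrow> 'v set \<Rightarrow> bool" where
  "zero_type S L \<longleftrightarrow>
     (\<Sum>c\<in>{c. c > 0 \<and> eigsp S L c \<noteq> {0}}. dim (eigsp S L c)) = nn S - 1 \<and>
     dim (eigsp S L 0) = 1 \<and>
     (\<forall>c<0. eigsp S L c = {0})"

definition Lperp :: "('v::euclidean_space, 'm) elliptic_scheme \<Rightarrow> 'v set \<Rightarrow> ('v \<Rightarrow>\<^sub>L complex) set" where
  "Lperp S L = {x \<in> Y S. \<forall>v\<in>L. blinfun_apply x v = 0}"

text \<open>The restriction of \<open>f\<close> to \<open>Lperp S L\<close>, regarded as a function on \<open>H\<close> and pulled back to \<open>Y\<close>.\<close>

definition res :: "('v::euclidean_space, 'm) elliptic_scheme \<Rightarrow> 'v set \<Rightarrow> 'v yfun \<Rightarrow> 'v yfun" where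
  "res S L f = (\<lambda>p. f (THE y. y \<in> Lperp S L \<and> (\<forall>v\<in>radF S. blinfun_apply y v = blinfun_apply p v)))"

definition LFperp :: "('v::euclidean_space, 'm) elliptic_scheme \<Rightarrow> 'v set \<Rightarrow> 'v set" where
  "LFperp S L = {x \<in> L. \<forall>y\<in>L \<inter> Fsp S. form S x y = 0}"

definition homogeneous_basis ::
  "('v::euclidean_space, 'm) elliptic_scheme \<Rightarrow> ('v \<Rightarrow> 'v) \<Rightarrow> complex \<Rightarrow> 'v set \<Rightarrow> (nat \<Rightarrow> 'v cplxfn) \<Rightarrow> bool" where
  "homogeneous_basis S g \<zeta> L z \<longleftrightarrow> z 0 = z0 S \<and> cbasis {1..nn S} z (cspace L) \<and>
     (\<forall>\<alpha>\<in>{1..nn S}. cmap g (z \<alpha>) = csc (\<zeta> ^ dg S \<alpha>) (z \<alpha>))"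

definition flat_basis ::
  "('v::euclidean_space, 'm) elliptic_scheme \<Rightarrow> ('v \<Rightarrow> 'v) \<Rightarrow> complex \<Rightarrow> 'v set \<Rightarrow> (nat \<Rightarrow> 'v cplxfn) \<Rightarrow> bool" where
  "flat_basis S g \<zeta> L z \<longleftrightarrow>
     cbasis {0..nn S} z (cspace {u + t *\<^sub>R vdelta S | u t. u \<in> L}) \<and>
     z 0 = z0 S \<and>
     (\<forall>\<alpha>\<in>{1..nn S - 1}. z \<alpha> \<in> cspace (L \<inter> Fsp S)) \<and>
     z (nn S) \<in> cspace (LFperp S L) \<and>
     (\<forall>\<alpha>\<le>nn S. \<forall>\<beta>\<le>nn S. cform S (z \<alpha>) (z \<beta>) = (if \<alpha> + \<beta> = nn S then 1 else 0)) \<and>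
     (\<forall>\<alpha>\<le>nn S. cmap g (z \<alpha>) = csc (\<zeta> ^ dg S \<alpha>) (z \<alpha>))"

text \<open>The coordinate vector field $\partial/\partial z^\gamma$ on \<open>Y\<close> for coordinates
  $z^0, \dots, z^n$ is constant.\<close>

definition pd :: "('v::euclidean_space, 'm) elliptic_scheme \<Rightarrow> (nat \<Rightarrow> 'v cplxfn) \<Rightarrow> nat \<Rightarrow> 'v yfun \<Rightarrow> 'v yfun" where
  "pd S z \<gamma> = dir_deriv (THE h. blinfun_apply h (va S) = 0 \<and>
                 (\<forall>\<beta>\<le>nn S. cpair (z \<beta>) h = (if \<beta> = \<gamma> then 1 else 0)))"

definition mpd :: "('v::euclidean_space, 'm) elliptic_scheme \<Rightarrow> (nat \<Rightarrow> 'v cplxfn) \<Rightarrow> (nat \<Rightarrow> nat) \<Rightarrow> 'v yfun \<Rightarrow> 'v yfun" where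
  "mpd S z b = foldr (\<lambda>i F. (pd S z i ^^ b i) \<circ> F) [1..<nn S + 1] id"

definition psi_mono ::
  "('v::euclidean_space, 'm) elliptic_scheme \<Rightarrow> 'v set \<Rightarrow> (nat \<Rightarrow> 'v yfun) \<Rightarrow> (nat \<Rightarrow> 'v cplxfn) \<Rightarrow> (nat \<Rightarrow> nat) \<Rightarrow> 'v yfun" where
  "psi_mono S L x z a = (\<lambda>p. \<Sum>b | b \<in> midx (nn S) \<and> ddot S b = ddot S a.
      1 / of_nat (mfact (nn S) b) *
      res S L (mpd S z b (mono_fun (nn S) (\<lambda>\<gamma> q. x \<gamma> q - res S L (x \<gamma>) q) a)) p *
      mono_fun (nn S) (\<lambda>i. cpair (z i)) b p)"

text \<open>The polynomial ring over \<^const>\<open>FH\<close> in $z^1, \dots, z^n$ is realised inside the functions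
  on \<open>Y\<close>; this is faithful since $z^0, \dots, z^n$ are coordinates on \<open>Y\<close>.\<close>

definition is_psi ::
  "('v::euclidean_space, 'm) elliptic_scheme \<Rightarrow> 'v set \<Rightarrow> (nat \<Rightarrow> 'v yfun) \<Rightarrow> (nat \<Rightarrow> 'v cplxfn) \<Rightarrow> ('v yfun \<Rightarrow> 'v yfun) \<Rightarrow> bool" where
  "is_psi S L x z \<psi> \<longleftrightarrow>
     (\<forall>f\<in>SW S. \<psi> f \<in> FH_polys S (\<lambda>i. cpair (z i))) \<and>
     (\<forall>f\<in>SW S. \<forall>f'\<in>SW S. \<forall>p\<in>Y S. \<psi> (\<lambda>q. f q + f' q) p = \<psi> f p + \<psi> f' p) \<and>
     (\<forall>c\<in>FH S. \<forall>f\<in>SW S. \<forall>p\<in>Y S. \<psi> (\<lambda>q. c q * f q) p = c p * \<psi> f p) \<and>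
     (\<forall>a\<in>midx (nn S). \<forall>p\<in>Y S. \<psi> (mono_fun (nn S) x a) p = psi_mono S L x z a p)"

definition psi_preimage :: "('v::euclidean_space, 'm) elliptic_scheme \<Rightarrow> 'v set \<Rightarrow> ('v yfun \<Rightarrow> 'v yfun) \<Rightarrow> 'v yfun set" where
  "psi_preimage S L \<psi> = {f \<in> SW S. \<exists>v\<in>cspace L. \<forall>p\<in>Y S. \<psi> f p = cpair v p}"

text \<open>The map $\psi$ does not depend on the basic invariants \<open>y\<close> and the basis \<open>w\<close> used to
  write it down, so any choice may be taken.\<close>

definition good_invariants ::
  "('v::euclidean_space, 'm) elliptic_scheme \<Rightarrow> ('v \<Rightarrow> 'v) \<Rightarrow> complex \<Rightarrow> 'v set \<Rightarrow> (nat \<Rightarrow> 'v yfun) \<Rightarrow> bool" where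
  "good_invariants S g \<zeta> L x \<longleftrightarrow> basic_invariants S x \<and>
     (\<exists>y w \<psi>. basic_invariants S y \<and> homogeneous_basis S g \<zeta> L w \<and> is_psi S L y w \<psi> \<and>
        (\<forall>\<alpha>\<in>{1..nn S}. x \<alpha> \<in> psi_preimage S L \<psi>) \<and>
        (\<forall>c. (\<forall>p\<in>Y S. (\<Sum>\<alpha>=1..nn S. c \<alpha> * x \<alpha> p) = 0) \<longrightarrow> (\<forall>\<alpha>\<in>{1..nn S}. c \<alpha> = 0)) \<and>
        (\<forall>f\<in>psi_preimage S L \<psi>. \<exists>c. \<forall>p\<in>Y S. f p = (\<Sum>\<alpha>=1..nn S. c \<alpha> * x \<alpha> p)))"

definition compatible ::
  "('v::euclidean_space, 'm) elliptic_scheme \<Rightarrow> 'v set \<Rightarrow> (nat \<Rightarrow> 'v cplxfn) \<Rightarrow> (nat \<Rightarrow> 'v yfun) \<Rightarrow> bool" where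
  "compatible S L z x \<longleftrightarrow>
     (\<forall>\<alpha>\<in>{1..nn S}. \<forall>\<beta>\<in>{1..nn S}. \<forall>p\<in>Lperp S L. pd S z \<beta> (x \<alpha>) p = (if \<alpha> = \<beta> then 1 else 0))"

definition IW ::
  "('v::euclidean_space, 'm) elliptic_scheme \<Rightarrow> (nat \<Rightarrow> 'v cplxfn) \<Rightarrow> 'v yfun \<Rightarrow> 'v yfun \<Rightarrow> 'v yfun" where
  "IW S z f h = (\<lambda>p. \<Sum>\<gamma>1\<le>nn S. \<Sum>\<gamma>2\<le>nn S.
      pd S z \<gamma>1 f p * pd S z \<gamma>2 h p * cform S (z \<gamma>1) (z \<gamma>2))"

end

theory Submission
  imports Defs "HOL-Complex_Analysis.Complex_Analysis"
begin

text \<open>The coordinates $z^0, \dots, z^{n-1}$ lie in $F$ and $z^n$ pairs to $-2\pi\sqrt{-1}$ with $\delta$, so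
  the Euler field is $c \partial/\partial z^n$ with $c = -2\pi\sqrt{-1} (I_R : I) d_n / m_{max}$. Pairing
  with $dx^0$ is $\partial/\partial z^n$, and (i) and (ii) follow from the Euler relation.

  For (iii), give $z^i$ the weight $d_i$. By equivariance under $g$ the Taylor expansion of $x^\alpha$
  along $L^\perp$ contains only weights congruent to $d_\alpha$ modulo $d_n$, and goodness and
  compatibility then say that $x^\alpha$ is $z^\alpha$ (plus the constant $c/d_n$ if $\alpha = n$) up to
  weight at least $d_\alpha + d_n$. Hence $\partial x^\alpha/\partial z^\gamma$ is the Kronecker delta up to
  weight at least $d_\alpha + d_{n-\gamma}$, and in the sum over $\gamma$ of
  $\partial x^\alpha/\partial z^\gamma \cdot \partial x^\beta/\partial z^{n-\gamma}$ the products of two error terms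
  have weight at least $d_\alpha + d_\beta + d_n$, because $d_\gamma + d_{n-\gamma} = d_n$. The sum is an
  invariant of degree $d_\alpha + d_\beta$, that is, a polynomial in the $x^i$, and its coefficients can be
  read off from the terms of weight at most $d_\alpha + d_\beta$ on the slice $z^n = 0$.\<close>

section \<open>Holomorphic functions and directional derivatives\<close>

text \<open>Goodness concerns the leading Taylor part of an invariant in some homogeneous basis of
  L, compatibility concerns first derivatives in the flat one. Both bases consist of eigenvectors of
  \<open>g\<close>, and since 0 < d_i \<le> d_n the eigenvalues separate the weights. The transition
  matrix therefore mixes only coordinates of equal weight, and weighted orders carry over. The other
  difficulty is that the invariant in (iii) may a priori involve x^n in any monomial. On the slice
  z^n = 0 the function x^n agrees with its constant value K on \<open>Lperp\<close> up to weight 2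
  d_n, so a monomial with k factors x^n looks like K^k times one whose weight is lower by k d_n. Its
  coefficient would show up in a derivative of too low a weight; as K is nonzero, it must vanish.
  Subtracting a multiple of x^n beforehand cancels the constant term of the form, which is where the
  factor 1/x^n on \<open>Lperp\<close> comes from. Holomorphy is given by one complex derivative
  only, so higher derivatives and their commutation rest on Cauchy's formula. Positivity of the
  degrees comes from goodness and algebraic independence, their duality from the
  \<open>g\<close>-invariance of the form.\<close>

lemma hsc_apply [simp]: "blinfun_apply (hsc c h) v = c * blinfun_apply h v"
proof -
  have "bounded_linear (\<lambda>v. c * blinfun_apply h v)"
    by (intro bounded_linear_const_mult blinfun.bounded_linear_right)
  then show ?thesis by (simp add: hsc_def bounded_linear_Blinfun_apply)
qed

lemma bounded_bilinear_hsc: "bounded_bilinear hsc"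
proof
  show "\<exists>K. \<forall>c (h :: 'v::euclidean_space \<Rightarrow>\<^sub>L complex). norm (hsc c h) \<le> norm c * norm h * K"
  proof (intro exI[of _ 1] allI)
    fix c and h :: "'v \<Rightarrow>\<^sub>L complex"
    have "norm (blinfun_apply (hsc c h) v) \<le> (norm c * norm h) * norm v" for v
      using norm_blinfun[of h v] by (simp add: norm_mult mult.assoc mult_left_mono)
    then show "norm (hsc c h) \<le> norm c * norm h * 1"
      by (simp add: norm_blinfun_bound)
  qed
qed (auto intro!: blinfun_eqI simp: blinfun.bilinear_simps algebra_simps)

lemmas hsc_simps = bounded_bilinear.add_left[OF bounded_bilinear_hsc]
  bounded_bilinear.add_right[OF bounded_bilinear_hsc]
  bounded_bilinear.zero_left[OF bounded_bilinear_hsc]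
  bounded_bilinear.zero_right[OF bounded_bilinear_hsc]
  bounded_bilinear.diff_right[OF bounded_bilinear_hsc]
  bounded_bilinear.diff_left[OF bounded_bilinear_hsc]
  bounded_bilinear.minus_left[OF bounded_bilinear_hsc]

lemmas hsc_sum_right = bounded_bilinear.sum_right[OF bounded_bilinear_hsc]
lemmas hsc_bounded_linear_left = bounded_bilinear.bounded_linear_left[OF bounded_bilinear_hsc]

lemma hsc_hsc [simp]: "hsc c (hsc d h) = hsc (c * d) h"
  by (rule blinfun_eqI) simp

lemma bounded_linear_cpair: "bounded_linear (cpair w)"
  unfolding cpair_def
  by (intro bounded_linear_add bounded_linear_const_mult blinfun.bounded_linear_left)

lemma cpair_hsc [simp]: "cpair w (hsc c h) = c * cpair w h"
  by (simp add: cpair_def algebra_simps)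

lemma cpair_csc [simp]: "cpair (csc c w) h = c * cpair w h"
proof -
  have "c * (a + \<i> * b) = Re c *\<^sub>R a - Im c *\<^sub>R b + \<i> * (Re c *\<^sub>R b + Im c *\<^sub>R a)" for a b :: complex
    by (simp add: complex_eq_iff algebra_simps)
  then show ?thesis
    by (simp add: cpair_def csc_def blinfun.bilinear_simps)
qed

lemma cpair_add_right: "cpair w (h + k) = cpair w h + cpair w k"
  and cpair_diff_right: "cpair w (h - k) = cpair w h - cpair w k"
  and cpair_sum_right: "cpair w (sum F A) = (\<Sum>a\<in>A. cpair w (F a))"
  and cpair_zero_right [simp]: "cpair w 0 = 0"
  using bounded_linear.linear[OF bounded_linear_cpair[of w]]
  by (simp_all add: linear_add linear_diff linear_sum linear_0)

lemma cpair_add_left: "cpair (w + w') h = cpair w h + cpair w' h"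
  by (simp add: cpair_def blinfun.bilinear_simps algebra_simps)

lemma cpair_zero_left [simp]: "cpair 0 h = 0"
  by (simp add: cpair_def blinfun.bilinear_simps)

lemma cpair_sum_left: "cpair (sum F A) h = (\<Sum>a\<in>A. cpair (F a) h)"
  by (induction A rule: infinite_finite_induct) (auto simp: cpair_add_left)

section \<open>Complex lines inside Y and the ring of holomorphic functions\<close>

lemma Y_shift_iff:
  assumes "p \<in> Y S" "blinfun_apply h (va S) = 0"
  shows "p + hsc t h \<in> Y S \<longleftrightarrow> Re (blinfun_apply p (vdelta S) + t * blinfun_apply h (vdelta S)) > 0"
  using assms by (simp add: Y_def blinfun.bilinear_simps)

lemma FY_has_derivative:
  assumes "f \<in> FY S" "p \<in> Y S"
  shows "\<exists>D. (f has_derivative D) (at p within Y S) \<and>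
    (\<forall>c h. blinfun_apply h (va S) = 0 \<longrightarrow> D (hsc c h) = c * D h)"
  using assms unfolding FY_def by blast

text \<open>A complex line in a direction killing a stays in the affine hyperplane of Y, and the
  parameters that keep it in Y form an open set. A derivative relative to Y, which need not be open
  in the ambient space, thus becomes an ordinary complex derivative at 0.\<close>

lemma has_derivative_along:
  assumes D: "(f has_derivative D) (at p within Y S)" and p: "p \<in> Y S"
    and h: "blinfun_apply h (va S) = 0" and hom: "\<And>c. D (hsc c h) = c * D h"
  shows "((\<lambda>t. f (p + hsc t h)) has_field_derivative D h) (at 0)"
proof -
  define U where "U = {t. Re (blinfun_apply p (vdelta S) + t * blinfun_apply h (vdelta S)) > 0}"
  have oU: "open U" unfolding U_def
    by (intro open_Collect_less continuous_intros)
  have 0: "0 \<in> U" using p by (simp add: U_def Y_def)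
  have sub: "(\<lambda>t. p + hsc t h) ` U \<subseteq> Y S"
    using p h by (auto simp: U_def Y_shift_iff)
  have l: "((\<lambda>t. p + hsc t h) has_derivative (\<lambda>t. hsc t h)) (at 0 within U)"
    using has_derivative_add[OF has_derivative_const
        bounded_linear.has_derivative[OF hsc_bounded_linear_left has_derivative_ident]] by simp
  have "((\<lambda>t. f (p + hsc t h)) has_derivative (\<lambda>t. D (hsc t h))) (at 0 within U)"
    by (rule has_derivative_in_compose[OF l has_derivative_subset[OF _ sub]])
       (use D in \<open>simp add: hsc_simps\<close>)
  then have "((\<lambda>t. f (p + hsc t h)) has_derivative (\<lambda>t. D (hsc t h))) (at 0)"
    using at_within_open[OF 0 oU] by simp
  moreover have "(\<lambda>t. D (hsc t h)) = (*) (D h)"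
    by (rule ext) (simp only: hom mult.commute)
  ultimately show ?thesis
    by (simp only: has_field_derivative_def)
qed

lemma FY_derivative:
  assumes f: "f \<in> FY S" and p: "p \<in> Y S"
  obtains D where "(f has_derivative D) (at p within Y S)"
    "\<And>c h. blinfun_apply h (va S) = 0 \<Longrightarrow> D (hsc c h) = c * D h"
    "\<And>h. blinfun_apply h (va S) = 0 \<Longrightarrow>
       ((\<lambda>t. f (p + hsc t h)) has_field_derivative D h) (at 0)"
    "\<And>h. blinfun_apply h (va S) = 0 \<Longrightarrow> dir_deriv h f p = D h"
proof -
  obtain D where D: "(f has_derivative D) (at p within Y S)"
    "\<And>c h. blinfun_apply h (va S) = 0 \<Longrightarrow> D (hsc c h) = c * D h"
    using FY_has_derivative[OF f p] by blast
  have der: "((\<lambda>t. f (p + hsc t h)) has_field_derivative D h) (at 0)"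
    if "blinfun_apply h (va S) = 0" for h
    by (rule has_derivative_along[OF D(1) p that D(2)[OF that]])
  have dd: "dir_deriv h f p = D h" if "blinfun_apply h (va S) = 0" for h
    unfolding dir_deriv_def by (rule DERIV_imp_deriv[OF der[OF that]])
  show thesis
    by (rule that[OF D]) (assumption | rule der dd)+
qed

lemma dir_deriv_at:
  assumes f: "f \<in> FY S" and p: "p \<in> Y S" and h: "blinfun_apply h (va S) = 0"
  shows "((\<lambda>t. f (p + hsc t h)) has_field_derivative dir_deriv h f p) (at 0)"
proof (rule FY_derivative[OF f p])
  fix D
  assume D: "\<And>h. blinfun_apply h (va S) = 0 \<Longrightarrow> ((\<lambda>t. f (p + hsc t h)) has_field_derivative D h) (at 0)"
    "\<And>h. blinfun_apply h (va S) = 0 \<Longrightarrow> dir_deriv h f p = D h"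
  show ?thesis using D(1)[OF h] D(2)[OF h] by simp
qed

lemma FY_field_differentiable:
  assumes f: "f \<in> FY S" and p: "p \<in> Y S" and h: "blinfun_apply h (va S) = 0"
    and t: "p + hsc t h \<in> Y S"
  shows "((\<lambda>t. f (p + hsc t h)) has_field_derivative dir_deriv h f (p + hsc t h)) (at t)"
proof -
  have "((\<lambda>s. f (p + hsc t h + hsc s h)) has_field_derivative dir_deriv h f (p + hsc t h)) (at 0)"
    using dir_deriv_at[OF f t h] .
  then have "((\<lambda>s. f (p + hsc (s + t) h)) has_field_derivative dir_deriv h f (p + hsc t h)) (at 0)"
    by (simp only: hsc_simps(1) add.assoc add.commute[of "hsc _ h" "hsc t h"])
  then show ?thesis
    using DERIV_shift[of "\<lambda>t. f (p + hsc t h)" "dir_deriv h f (p + hsc t h)" 0 t] by (simp only: add_0_left)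
qed

lemma FY_continuous_on: "f \<in> FY S \<Longrightarrow> continuous_on (Y S) f"
  unfolding continuous_on_eq_continuous_within
  by (metis (no_types, lifting) FY_has_derivative has_derivative_continuous)

lemma FY_I:
  assumes "\<And>p. p \<in> Y S \<Longrightarrow> (f has_derivative D p) (at p within Y S)"
    and "\<And>p c h. p \<in> Y S \<Longrightarrow> blinfun_apply h (va S) = 0 \<Longrightarrow> D p (hsc c h) = c * D p h"
  shows "f \<in> FY S"
  unfolding FY_def using assms by blast

lemma FY_cong:
  assumes "f \<in> FY S" "\<And>p. p \<in> Y S \<Longrightarrow> f p = g p"
  shows "g \<in> FY S"
proof -
  have "(g has_derivative D) (at p within Y S)"
    if "(f has_derivative D) (at p within Y S)" "p \<in> Y S" for D p
    using has_derivative_transform[OF that(2) _ that(1), of g] assms(2) by simp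
  then show ?thesis
    using assms(1) unfolding FY_def by blast
qed

lemma FY_const [simp, intro]: "(\<lambda>_. c) \<in> FY S"
  by (rule FY_I[where D = "\<lambda>_ _. 0"]) auto

lemma FY_add [intro]:
  assumes f: "f \<in> FY S" and g: "g \<in> FY S"
  shows "(\<lambda>p. f p + g p) \<in> FY S"
proof -
  have "\<exists>D. ((\<lambda>p. f p + g p) has_derivative D) (at p within Y S) \<and>
            (\<forall>c h. blinfun_apply h (va S) = 0 \<longrightarrow> D (hsc c h) = c * D h)" if p: "p \<in> Y S" for p
  proof -
    obtain D D' where D: "(f has_derivative D) (at p within Y S)" "(g has_derivative D') (at p within Y S)"
      and l: "\<And>c h. blinfun_apply h (va S) = 0 \<Longrightarrow> D (hsc c h) = c * D h"
      "\<And>c h. blinfun_apply h (va S) = 0 \<Longrightarrow> D' (hsc c h) = c * D' h"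
      using FY_has_derivative[OF f p] FY_has_derivative[OF g p] by blast
    show ?thesis
      by (intro exI[of _ "\<lambda>h. D h + D' h"] conjI has_derivative_add D) (simp add: l algebra_simps)
  qed
  then show ?thesis by (auto simp: FY_def)
qed

lemma FY_mult [intro]:
  assumes f: "f \<in> FY S" and g: "g \<in> FY S"
  shows "(\<lambda>p. f p * g p) \<in> FY S"
proof -
  have "\<exists>D. ((\<lambda>p. f p * g p) has_derivative D) (at p within Y S) \<and>
            (\<forall>c h. blinfun_apply h (va S) = 0 \<longrightarrow> D (hsc c h) = c * D h)" if p: "p \<in> Y S" for p
  proof -
    obtain D D' where D: "(f has_derivative D) (at p within Y S)" "(g has_derivative D') (at p within Y S)"
      and l: "\<And>c h. blinfun_apply h (va S) = 0 \<Longrightarrow> D (hsc c h) = c * D h"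
      "\<And>c h. blinfun_apply h (va S) = 0 \<Longrightarrow> D' (hsc c h) = c * D' h"
      using FY_has_derivative[OF f p] FY_has_derivative[OF g p] by blast
    show ?thesis
      by (intro exI[of _ "\<lambda>h. f p * D' h + D h * g p"] conjI has_derivative_mult D) (simp add: l algebra_simps)
  qed
  then show ?thesis by (auto simp: FY_def)
qed

lemma FY_sum [intro]: "(\<And>a. a \<in> A \<Longrightarrow> F a \<in> FY S) \<Longrightarrow> (\<lambda>p. \<Sum>a\<in>A. F a p) \<in> FY S"
  by (induction A rule: infinite_finite_induct) (auto intro: FY_add)

lemma FY_prod [intro]: "(\<And>a. a \<in> A \<Longrightarrow> F a \<in> FY S) \<Longrightarrow> (\<lambda>p. \<Prod>a\<in>A. F a p) \<in> FY S"
  by (induction A rule: infinite_finite_induct) (auto intro: FY_mult)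

lemma FY_power [intro]: "f \<in> FY S \<Longrightarrow> (\<lambda>p. f p ^ k) \<in> FY S"
  by (induction k) (auto intro: FY_mult)

lemma FY_diff [intro]: "f \<in> FY S \<Longrightarrow> g \<in> FY S \<Longrightarrow> (\<lambda>p. f p - g p) \<in> FY S"
  using FY_add[of f S "\<lambda>p. (-1) * g p"] FY_mult[of "\<lambda>_. -1" S g] by simp

lemma FY_uminus [intro]: "f \<in> FY S \<Longrightarrow> (\<lambda>p. - f p) \<in> FY S"
  using FY_diff[of "\<lambda>_. 0" S f] by simp

lemma FY_cpair [intro]: "cpair w \<in> FY S"
  by (rule FY_I[where D = "\<lambda>_. cpair w"])
     (auto intro: bounded_linear.has_derivative[OF bounded_linear_cpair] has_derivative_ident)

lemma FY_mono_fun [intro]: "(\<And>i. i \<in> {1..n} \<Longrightarrow> x i \<in> FY S) \<Longrightarrow> mono_fun n x b \<in> FY S"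
  unfolding mono_fun_def by (intro FY_prod FY_power) auto

section \<open>Rules for directional derivatives\<close>

lemma dir_deriv_cong:
  assumes "f \<in> FY S" "p \<in> Y S" "blinfun_apply h (va S) = 0" "\<And>p. p \<in> Y S \<Longrightarrow> f p = g p"
  shows "dir_deriv h f p = dir_deriv h g p"
proof -
  have g: "g \<in> FY S" using FY_cong assms by blast
  define U where "U = {t. Re (blinfun_apply p (vdelta S) + t * blinfun_apply h (vdelta S)) > 0}"
  have oU: "open U" unfolding U_def
    by (intro open_Collect_less continuous_intros)
  have "0 \<in> U" using assms by (simp add: U_def Y_def)
  then have "\<forall>\<^sub>F t in nhds 0. t \<in> U" using oU by (simp add: eventually_nhds_in_open)
  then have "\<forall>\<^sub>F t in nhds 0. f (p + hsc t h) = g (p + hsc t h)"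
    by eventually_elim (use assms in \<open>simp add: U_def Y_shift_iff\<close>)
  then show ?thesis unfolding dir_deriv_def by (rule deriv_cong_ev) simp
qed

lemma dir_deriv_eqI:
  assumes "((\<lambda>t. f (p + hsc t h)) has_field_derivative D) (at 0)"
  shows "dir_deriv h f p = D"
  using assms by (auto simp: dir_deriv_def intro: DERIV_imp_deriv)

lemma dir_deriv_const [simp]: "dir_deriv h (\<lambda>_. c) p = 0"
  by (rule dir_deriv_eqI) simp

lemma dir_deriv_add:
  assumes "f \<in> FY S" "g \<in> FY S" "p \<in> Y S" "blinfun_apply h (va S) = 0"
  shows "dir_deriv h (\<lambda>p. f p + g p) p = dir_deriv h f p + dir_deriv h g p"
  by (rule dir_deriv_eqI) (intro DERIV_add dir_deriv_at[where S = S] assms)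

lemma dir_deriv_mult:
  assumes "f \<in> FY S" "g \<in> FY S" "p \<in> Y S" "blinfun_apply h (va S) = 0"
  shows "dir_deriv h (\<lambda>p. f p * g p) p = dir_deriv h f p * g p + f p * dir_deriv h g p"
proof (rule dir_deriv_eqI)
  show "((\<lambda>t. f (p + hsc t h) * g (p + hsc t h)) has_field_derivative
     dir_deriv h f p * g p + f p * dir_deriv h g p) (at 0)"
    using DERIV_mult[OF dir_deriv_at[OF assms(1,3,4)] dir_deriv_at[OF assms(2,3,4)]]
    by (simp add: hsc_simps algebra_simps)
qed

lemma dir_deriv_cmult:
  assumes "f \<in> FY S" "p \<in> Y S" "blinfun_apply h (va S) = 0"
  shows "dir_deriv h (\<lambda>p. c * f p) p = c * dir_deriv h f p"
  using dir_deriv_mult[of "\<lambda>_. c" S f p h] assms by simp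

lemma dir_deriv_diff:
  assumes "f \<in> FY S" "g \<in> FY S" "p \<in> Y S" "blinfun_apply h (va S) = 0"
  shows "dir_deriv h (\<lambda>p. f p - g p) p = dir_deriv h f p - dir_deriv h g p"
  by (rule dir_deriv_eqI) (intro DERIV_diff dir_deriv_at[where S = S] assms)

lemma dir_deriv_sum:
  assumes "\<And>a. a \<in> A \<Longrightarrow> F a \<in> FY S" "p \<in> Y S" "blinfun_apply h (va S) = 0"
  shows "dir_deriv h (\<lambda>p. \<Sum>a\<in>A. F a p) p = (\<Sum>a\<in>A. dir_deriv h (F a) p)"
  by (rule dir_deriv_eqI) (intro DERIV_sum dir_deriv_at[where S = S] assms)

lemma dir_deriv_cpair: "dir_deriv h (cpair w) p = cpair w h"
proof (rule dir_deriv_eqI)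
  have "((\<lambda>t. cpair w p + t * cpair w h) has_field_derivative cpair w h) (at 0)"
    by (auto intro!: derivative_eq_intros)
  then show "((\<lambda>t. cpair w (p + hsc t h)) has_field_derivative cpair w h) (at 0)"
    by (simp add: cpair_add_right)
qed

text \<open>Additivity in the direction comes from the full derivative of \<open>f\<close>, not from
  its restrictions to single lines.\<close>

lemma dir_deriv_linear_arg:
  assumes f: "f \<in> FY S" and p: "p \<in> Y S"
  shows dir_deriv_hsc: "blinfun_apply h (va S) = 0 \<Longrightarrow> dir_deriv (hsc c h) f p = c * dir_deriv h f p"
    and dir_deriv_sum_arg: "(\<And>i. i \<in> A \<Longrightarrow> blinfun_apply (H i) (va S) = 0) \<Longrightarrow>
      dir_deriv (\<Sum>i\<in>A. H i) f p = (\<Sum>i\<in>A. dir_deriv (H i) f p)"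
proof -
  obtain D where D: "(f has_derivative D) (at p within Y S)"
    and hom: "\<And>c h. blinfun_apply h (va S) = 0 \<Longrightarrow> D (hsc c h) = c * D h"
    and dd: "\<And>h. blinfun_apply h (va S) = 0 \<Longrightarrow> dir_deriv h f p = D h"
  proof (rule FY_derivative[OF f p])
    fix D
    assume "(f has_derivative D) (at p within Y S)"
      and "\<And>c h. blinfun_apply h (va S) = 0 \<Longrightarrow> D (hsc c h) = c * D h"
      and "\<And>h. blinfun_apply h (va S) = 0 \<Longrightarrow> dir_deriv h f p = D h"
    then show thesis by (rule that)
  qed
  show "blinfun_apply h (va S) = 0 \<Longrightarrow> dir_deriv (hsc c h) f p = c * dir_deriv h f p"
    using hom dd by simp
  assume H: "\<And>i. i \<in> A \<Longrightarrow> blinfun_apply (H i) (va S) = 0"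
  then have "blinfun_apply (\<Sum>i\<in>A. H i) (va S) = 0" by (simp add: blinfun.sum_left)
  then show "dir_deriv (\<Sum>i\<in>A. H i) f p = (\<Sum>i\<in>A. dir_deriv (H i) f p)"
    using dd H linear_sum[OF has_derivative_linear[OF D], of H A] by simp
qed

section \<open>Derivatives are holomorphic and commute\<close>

text \<open>Since \<open>nn S\<close> unfolds to a successor, these rules would split off the last term of every
  sum over the coordinates.\<close>

declare sum.atMost_Suc [simp del] sum.cl_ivl_Suc [simp del] prod.cl_ivl_Suc [simp del]

text \<open>Cauchy's formula for the derivative of t \<mapsto> f (p + t h) on the circle of radius
  \<open>r\<close>, parametrised over [0, 1]; the bound on \<open>r\<close> keeps the closed disc
  inside the half plane. The derivative becomes an integral over a fixed interval of values of
  \<open>f\<close> at translates of \<open>p\<close>, ready to be differentiated in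
  \<open>p\<close>.\<close>

lemma dir_deriv_integral:
  assumes f: "f \<in> FY S" and p: "p \<in> Y S" and h: "blinfun_apply h (va S) = 0"
    and r: "r > 0" "r * norm (blinfun_apply h (vdelta S)) < Re (blinfun_apply p (vdelta S))"
  shows "dir_deriv h f p = integral {0..1}
    (\<lambda>\<theta>. exp (- 2 * of_real pi * \<i> * of_real \<theta>) / of_real r *
      f (p + hsc (of_real r * exp (2 * of_real pi * \<i> * of_real \<theta>)) h))"
proof -
  define U where "U = {t. Re (blinfun_apply p (vdelta S) + t * blinfun_apply h (vdelta S)) > 0}"
  define G where "G = (\<lambda>t. f (p + hsc t h))"
  have oU: "open U" unfolding U_def
    by (intro open_Collect_less continuous_intros)
  have sub: "cball 0 r \<subseteq> U"
  proof
    fix t :: complex assume "t \<in> cball 0 r"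
    then have "norm (t * blinfun_apply h (vdelta S)) \<le> r * norm (blinfun_apply h (vdelta S))"
      by (simp add: norm_mult mult_right_mono)
    moreover have "- norm (t * blinfun_apply h (vdelta S)) \<le> Re (t * blinfun_apply h (vdelta S))"
      using abs_Re_le_cmod[of "t * blinfun_apply h (vdelta S)"] by linarith
    ultimately show "t \<in> U" using r by (simp add: U_def)
  qed
  have hol: "G holomorphic_on U"
    unfolding holomorphic_on_open[OF oU] G_def
  proof
    fix t assume "t \<in> U"
    then have "p + hsc t h \<in> Y S" using p h by (simp add: U_def Y_shift_iff)
    then show "\<exists>f'. ((\<lambda>t. f (p + hsc t h)) has_field_derivative f') (at t)"
      using FY_field_differentiable[OF f p h] by blast
  qed
  have "(G has_field_derivative (1 / (2 * of_real pi * \<i>) * contour_integral (circlepath 0 r) (\<lambda>u. G u / (u - 0)\<^sup>2))) (at 0)"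
    by (rule Cauchy_derivative_integral_circlepath)
       (use sub r holomorphic_on_imp_continuous_on[OF hol] hol ball_subset_cball in
         \<open>blast intro: continuous_on_subset holomorphic_on_subset | simp\<close>)+
  then have "dir_deriv h f p = 1 / (2 * of_real pi * \<i>) * contour_integral (circlepath 0 r) (\<lambda>u. G u / (u - 0)\<^sup>2)"
    unfolding G_def by (rule dir_deriv_eqI)
  also have "contour_integral (circlepath 0 r) (\<lambda>u. G u / (u - 0)\<^sup>2) =
     integral {0..1} (\<lambda>\<theta>. (2 * of_real pi * \<i>) * (exp (- 2 * of_real pi * \<i> * of_real \<theta>) / of_real r *
      G (of_real r * exp (2 * of_real pi * \<i> * of_real \<theta>))))"
    unfolding contour_integral_integral
  proof (rule integral_cong)
    fix \<theta> :: real assume \<theta>: "\<theta> \<in> {0..1}"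
    define E where "E = exp (2 * of_real pi * \<i> * of_real \<theta>)"
    have inv: "exp (- 2 * of_real pi * \<i> * of_real \<theta>) = inverse E"
      unfolding E_def by (simp add: exp_minus)
    have vd: "vector_derivative (circlepath 0 r) (at \<theta>) = 2 * of_real pi * \<i> * of_real r * E"
      by (simp add: vector_derivative_circlepath E_def)
    have cp: "circlepath 0 r \<theta> = of_real r * E"
      by (simp add: circlepath E_def)
    have "E \<noteq> 0" by (simp add: E_def)
    then show "G (circlepath 0 r \<theta>) / (circlepath 0 r \<theta> - 0)\<^sup>2 * vector_derivative (circlepath 0 r) (at \<theta>) =
      (2 * of_real pi * \<i>) * (exp (- 2 * of_real pi * \<i> * of_real \<theta>) / of_real r *
      G (of_real r * exp (2 * of_real pi * \<i> * of_real \<theta>)))"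
      unfolding inv vd cp E_def[symmetric] using r by (simp add: field_simps power2_eq_square)
  qed
  finally show ?thesis by (simp add: G_def)
qed

text \<open>The margin \<epsilon> lets one radius of the Cauchy circle serve all points at once. The
  set is relatively open in Y, so derivatives are unaffected, and convex, as differentiation under
  the integral sign requires.\<close>

definition half_Y :: "('v::euclidean_space, 'm) elliptic_scheme \<Rightarrow> real \<Rightarrow> ('v \<Rightarrow>\<^sub>L complex) set" where
  "half_Y S \<epsilon> = {p \<in> Y S. Re (blinfun_apply p (vdelta S)) > \<epsilon>}"

lemma half_Y_nhd:
  assumes "p \<in> half_Y S \<epsilon>"
  shows "at p within half_Y S \<epsilon> = at p within Y S"
proof (rule at_within_nhd)
  show "open {p. Re (blinfun_apply p (vdelta S)) > \<epsilon>}"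
    by (intro open_Collect_less continuous_intros)
qed (use assms in \<open>auto simp: half_Y_def\<close>)

lemma convex_half_Y: "convex (half_Y S \<epsilon>)"
proof -
  have *: "half_Y S \<epsilon> = {p. blinfun_apply p (va S) = - 2 * of_real pi * \<i>} \<inter>
     ({p. Re (blinfun_apply p (vdelta S)) > 0} \<inter> {p. Re (blinfun_apply p (vdelta S)) > \<epsilon>})"
    by (auto simp: half_Y_def Y_def)
  have l: "linear (\<lambda>p. Re (blinfun_apply p (vdelta S)))"
    by (intro linearI) (auto simp: blinfun.bilinear_simps)
  have "convex {p. Re (blinfun_apply p (vdelta S)) > c}" for c
    using convex_linear_vimage[OF l, of "{c<..}"] by (simp add: vimage_def)
  moreover have "convex {p. blinfun_apply p (va S) = - 2 * of_real pi * \<i>}"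
    using convex_linear_vimage[of "\<lambda>p. blinfun_apply p (va S)" "{- 2 * of_real pi * \<i>}"]
      linearI[of "\<lambda>p. blinfun_apply p (va S)"] by (simp add: vimage_def blinfun.bilinear_simps)
  ultimately show ?thesis unfolding * by (intro convex_Int)
qed

lemma circle_shift_half_Y:
  assumes p: "p \<in> half_Y S \<epsilon>" and h: "blinfun_apply h (va S) = 0"
    and r: "r > 0" "r * norm (blinfun_apply h (vdelta S)) \<le> \<epsilon>"
  shows "p + hsc (of_real r * exp (2 * of_real pi * \<i> * of_real \<theta>)) h \<in> Y S"
proof -
  define t where "t = of_real r * exp (2 * of_real pi * \<i> * of_real \<theta>)"
  have "norm (t * blinfun_apply h (vdelta S)) = r * norm (blinfun_apply h (vdelta S))"
    using r by (simp add: norm_mult t_def)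
  then have "Re (t * blinfun_apply h (vdelta S)) \<ge> - \<epsilon>"
    using abs_Re_le_cmod[of "t * blinfun_apply h (vdelta S)"] r by linarith
  then show ?thesis
    using p h by (simp add: Y_shift_iff half_Y_def t_def[symmetric])
qed

lemma continuous_on_circle_shift:
  assumes f: "continuous_on (Y S) f" and h: "blinfun_apply h (va S) = 0"
    and r: "r > 0" "r * norm (blinfun_apply h (vdelta S)) \<le> \<epsilon>"
  shows "continuous_on (half_Y S \<epsilon> \<times> cbox 0 1) (\<lambda>(p, \<theta>).
    exp (- 2 * of_real pi * \<i> * of_real \<theta>) / of_real r *
      f (p + hsc (of_real r * exp (2 * of_real pi * \<i> * of_real \<theta>)) h))"
proof -
  have hs: "continuous_on A (\<lambda>y. hsc (t y) h)" if "continuous_on A t" for A and t :: "'c::topological_space \<Rightarrow> complex"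
    using bounded_linear.continuous_on[OF hsc_bounded_linear_left that] .
  have "continuous_on (half_Y S \<epsilon> \<times> cbox 0 1)
     (\<lambda>y. fst y + hsc (of_real r * exp (2 * of_real pi * \<i> * of_real (snd y))) h)"
    by (intro continuous_intros hs)
  then have "continuous_on (half_Y S \<epsilon> \<times> cbox 0 1)
     (\<lambda>y. f (fst y + hsc (of_real r * exp (2 * of_real pi * \<i> * of_real (snd y))) h))"
    by (rule continuous_on_compose2[OF f]) (use circle_shift_half_Y[OF _ h r] in auto)
  then show ?thesis
    unfolding case_prod_beta using r by (intro continuous_intros) auto
qed

lemma half_Y_radius:
  assumes p: "p \<in> Y S"
  obtains \<epsilon> r where "p \<in> half_Y S \<epsilon>" "r > 0" "r * norm (blinfun_apply h (vdelta S)) \<le> \<epsilon>"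
    "\<epsilon> > 0"
proof -
  define \<epsilon> where "\<epsilon> = Re (blinfun_apply p (vdelta S)) / 2"
  have "\<epsilon> > 0" using p by (simp add: \<epsilon>_def Y_def)
  then have 1: "p \<in> half_Y S \<epsilon>" "\<epsilon> > 0" using p by (simp_all add: half_Y_def \<epsilon>_def Y_def)
  \<comment> \<open>The summand 1 avoids a division by zero when \<open>h\<close> kills
    \<delta>.\<close>
  have 2: "\<epsilon> / (1 + norm (blinfun_apply h (vdelta S))) > 0"
    using \<open>\<epsilon> > 0\<close> by (simp add: add_pos_nonneg)
  have "\<epsilon> / (1 + norm (blinfun_apply h (vdelta S))) * norm (blinfun_apply h (vdelta S)) \<le>
    \<epsilon> / (1 + norm (blinfun_apply h (vdelta S))) * (1 + norm (blinfun_apply h (vdelta S)))"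
    by (intro mult_left_mono) (use \<open>\<epsilon> > 0\<close> in auto)
  also have "\<dots> = \<epsilon>"
    using norm_ge_zero[of "blinfun_apply h (vdelta S)"] by (simp add: add_nonneg_eq_0_iff)
  finally have 3: "\<epsilon> / (1 + norm (blinfun_apply h (vdelta S))) * norm (blinfun_apply h (vdelta S)) \<le> \<epsilon>" .
  show thesis by (rule that[OF 1(1) 2 3 1(2)])
qed

lemma dir_deriv_integral_half_Y:
  assumes f: "f \<in> FY S" and p: "p \<in> half_Y S \<epsilon>" and h: "blinfun_apply h (va S) = 0"
    and r: "r > 0" "r * norm (blinfun_apply h (vdelta S)) \<le> \<epsilon>"
  shows "dir_deriv h f p = integral (cbox 0 1)
    (\<lambda>\<theta>. exp (- 2 * of_real pi * \<i> * of_real \<theta>) / of_real r *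
      f (p + hsc (of_real r * exp (2 * of_real pi * \<i> * of_real \<theta>)) h))"
  using dir_deriv_integral[OF f _ h r(1)] p r(2) by (simp add: half_Y_def cbox_interval)

text \<open>Continuity of the derivative is not part of the definition of \<open>FY\<close>; locally
  the derivative is a parameter integral with a continuous integrand.\<close>

lemma continuous_on_dir_deriv:
  assumes f: "f \<in> FY S" and h: "blinfun_apply h (va S) = 0"
  shows "continuous_on (Y S) (dir_deriv h f)"
  unfolding continuous_on_eq_continuous_within
proof
  fix p assume p: "p \<in> Y S"
  obtain \<epsilon> r where er: "p \<in> half_Y S \<epsilon>" "r > 0" "r * norm (blinfun_apply h (vdelta S)) \<le> \<epsilon>"
    using half_Y_radius[OF p] by blast
  have "continuous_on (half_Y S \<epsilon>) (dir_deriv h f)"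
    using integral_continuous_on_param[OF continuous_on_circle_shift[OF FY_continuous_on[OF f] h er(2,3)]]
      dir_deriv_integral_half_Y[OF f _ h er(2,3)] by (simp cong: continuous_on_cong)
  then have "continuous (at p within half_Y S \<epsilon>) (dir_deriv h f)"
    using er(1) by (simp add: continuous_on_eq_continuous_within)
  then show "continuous (at p within Y S) (dir_deriv h f)"
    by (simp only: half_Y_nhd[OF er(1)])
qed

text \<open>The vector \<open>e i\<close> is the value of the constant vector field $\partial/\partial z^i$.\<close>

locale dual_coordinates =
  fixes S :: "'v::euclidean_space elliptic" and z :: "nat \<Rightarrow> 'v cplxfn" and e :: "nat \<Rightarrow> 'v \<Rightarrow>\<^sub>L complex"
  assumes e_va: "i \<le> nn S \<Longrightarrow> blinfun_apply (e i) (va S) = 0"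
    and dual: "i \<le> nn S \<Longrightarrow> j \<le> nn S \<Longrightarrow> cpair (z i) (e j) = (if i = j then 1 else 0)"
    and sep: "blinfun_apply h (va S) = 0 \<Longrightarrow> (\<And>i. i \<le> nn S \<Longrightarrow> cpair (z i) h = 0) \<Longrightarrow> h = 0"
begin

lemma sum_dual:
  assumes "j \<le> nn S"
  shows "(\<Sum>i\<le>nn S. c i * cpair (z i) (e j)) = c j"
    and "(\<Sum>i\<le>nn S. c i * cpair (z j) (e i)) = c j"
proof -
  have "(\<Sum>i\<le>nn S. c i * cpair (z i) (e j)) = (\<Sum>i\<le>nn S. if i = j then c i else 0)"
    by (rule sum.cong) (use assms dual in auto)
  then show "(\<Sum>i\<le>nn S. c i * cpair (z i) (e j)) = c j"
    using assms by (simp only: sum.delta finite_atMost atMost_iff if_True)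
  have "(\<Sum>i\<le>nn S. c i * cpair (z j) (e i)) = (\<Sum>i\<le>nn S. if i = j then c i else 0)"
    by (rule sum.cong) (use assms dual in auto)
  then show "(\<Sum>i\<le>nn S. c i * cpair (z j) (e i)) = c j"
    using assms by (simp only: sum.delta finite_atMost atMost_iff if_True)
qed

lemma expansion:
  assumes "blinfun_apply h (va S) = 0"
  shows "h = (\<Sum>i\<le>nn S. hsc (cpair (z i) h) (e i))"
proof -
  have "h - (\<Sum>i\<le>nn S. hsc (cpair (z i) h) (e i)) = 0"
  proof (rule sep)
    have "(\<Sum>i\<le>nn S. blinfun_apply (hsc (cpair (z i) h) (e i)) (va S)) = 0"
      by (rule sum.neutral) (auto simp: e_va)
    then show "blinfun_apply (h - (\<Sum>i\<le>nn S. hsc (cpair (z i) h) (e i))) (va S) = 0"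
      using assms by (simp add: blinfun.diff_left blinfun.sum_left)
    fix i assume "i \<le> nn S"
    from sum_dual(2)[OF this, of "\<lambda>i. cpair (z i) h"]
    show "cpair (z i) (h - (\<Sum>i\<le>nn S. hsc (cpair (z i) h) (e i))) = 0"
      by (simp only: cpair_diff_right cpair_sum_right cpair_hsc) simp
  qed
  then show ?thesis by simp
qed

text \<open>By \<open>sep\<close> a vector is determined by its coordinates, so the definite
  description in \<open>pd\<close> denotes \<open>e i\<close>.\<close>

lemma pd_eq_dir_deriv:
  assumes "i \<le> nn S"
  shows "pd S z i = dir_deriv (e i)"
proof -
  have "(THE h. blinfun_apply h (va S) = 0 \<and> (\<forall>\<beta>\<le>nn S. cpair (z \<beta>) h = (if \<beta> = i then 1 else 0))) = e i"
  proof (rule the_equality)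
    fix h assume h: "blinfun_apply h (va S) = 0 \<and> (\<forall>\<beta>\<le>nn S. cpair (z \<beta>) h = (if \<beta> = i then 1 else 0))"
    have "h - e i = 0"
      by (rule sep) (use h assms in \<open>auto simp: blinfun.bilinear_simps e_va cpair_diff_right dual\<close>)
    then show "h = e i" by simp
  qed (use assms e_va dual in auto)
  then show ?thesis by (simp add: pd_def)
qed

text \<open>All increments within Y kill a, so a derivative there may be changed arbitrarily off
  these directions as long as it stays bounded linear. The representative chosen here is written in
  the fixed functionals z^i with partial derivatives as coefficients; it therefore varies
  continuously with \<open>p\<close>.\<close>

lemma FY_has_derivative_coord:
  assumes f: "f \<in> FY S" and p: "p \<in> Y S"
  shows "(f has_derivative (\<lambda>u. \<Sum>i\<le>nn S. dir_deriv (e i) f p * cpair (z i) u)) (at p within Y S)"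
proof (rule FY_derivative[OF f p])
  fix D
  assume D: "(f has_derivative D) (at p within Y S)"
    and D_hsc: "\<And>c h. blinfun_apply h (va S) = 0 \<Longrightarrow> D (hsc c h) = c * D h"
    and D_dd: "\<And>h. blinfun_apply h (va S) = 0 \<Longrightarrow> dir_deriv h f p = D h"
  let ?D = "\<lambda>u. \<Sum>i\<le>nn S. dir_deriv (e i) f p * cpair (z i) u"
  have eq: "D u = ?D u" if "blinfun_apply u (va S) = 0" for u
  proof -
    have "D u = D (\<Sum>i\<le>nn S. hsc (cpair (z i) u) (e i))"
      using expansion[OF that] by simp
    also have "\<dots> = (\<Sum>i\<le>nn S. D (hsc (cpair (z i) u) (e i)))"
      by (rule linear_sum[OF has_derivative_linear[OF D]])
    also have "\<dots> = ?D u"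
      by (intro sum.cong) (auto simp: D_hsc e_va D_dd)
    finally show ?thesis .
  qed
  have bl: "bounded_linear ?D"
    by (intro bounded_linear_sum bounded_linear_const_mult bounded_linear_cpair)
  have "\<forall>\<^sub>F y in at p within Y S. (1 / norm (y - p)) *\<^sub>R (f y - (f p + D (y - p))) =
      (1 / norm (y - p)) *\<^sub>R (f y - (f p + ?D (y - p)))"
    unfolding eventually_at_filter
  proof (rule always_eventually, intro allI impI)
    fix y assume "y \<in> Y S"
    then have "D (y - p) = ?D (y - p)"
      using p by (intro eq) (simp add: Y_def blinfun.bilinear_simps)
    then show "(1 / norm (y - p)) *\<^sub>R (f y - (f p + D (y - p))) =
      (1 / norm (y - p)) *\<^sub>R (f y - (f p + ?D (y - p)))" by simp
  qed
  from tendsto_cong[OF this] D bl show "(f has_derivative ?D) (at p within Y S)"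
    by (simp only: has_derivative_within)
qed

text \<open>Differentiating the Cauchy integral for the derivative under the integral sign yields at once
  that derivatives are holomorphic and that they commute.\<close>

lemma dir_deriv_has_derivative:
  assumes f: "f \<in> FY S" and p: "p \<in> Y S" and h: "blinfun_apply h (va S) = 0"
  obtains D where "(dir_deriv h f has_derivative D) (at p within Y S)"
    "\<And>c u. D (hsc c u) = c * D u"
    "\<And>i. i \<le> nn S \<Longrightarrow> dir_deriv (e i) f \<in> FY S \<Longrightarrow> D (e i) = dir_deriv h (dir_deriv (e i) f) p"
proof -
  obtain \<epsilon> r where er: "p \<in> half_Y S \<epsilon>" "r > 0" "r * norm (blinfun_apply h (vdelta S)) \<le> \<epsilon>"
    using half_Y_radius[OF p] by blast
  define \<kappa> where "\<kappa> = (\<lambda>\<theta>. exp (- 2 * of_real pi * \<i> * of_real \<theta>) / of_real r)"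
  define \<sigma> where "\<sigma> = (\<lambda>\<theta>. hsc (of_real r * exp (2 * of_real pi * \<i> * of_real \<theta>)) h)"
  define Z where "Z = (\<lambda>i. Blinfun (cpair (z i)))"
  have Z: "blinfun_apply (Z i) u = cpair (z i) u" for i u
    by (simp add: Z_def bounded_linear_Blinfun_apply bounded_linear_cpair)
  \<comment> \<open>The derivative of the integrand, with values in bounded linear maps, so that its
    integral over \<theta> is again such a map.\<close>
  define fx where "fx = (\<lambda>q \<theta>. \<Sum>i\<le>nn S. blinfun_mult_right (\<kappa> \<theta> * dir_deriv (e i) f (q + \<sigma> \<theta>)) o\<^sub>L Z i)"
  have fx: "blinfun_apply (fx q \<theta>) u = (\<Sum>i\<le>nn S. \<kappa> \<theta> * dir_deriv (e i) f (q + \<sigma> \<theta>) * cpair (z i) u)" for q \<theta> u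
    by (simp add: fx_def blinfun.sum_left Z)
  have shift: "q + \<sigma> \<theta> \<in> Y S" if "q \<in> half_Y S \<epsilon>" for q \<theta>
    unfolding \<sigma>_def by (rule circle_shift_half_Y[OF that h er(2,3)])
  have cont: "continuous_on (half_Y S \<epsilon> \<times> cbox 0 1) (\<lambda>(q, \<theta>). \<kappa> \<theta> * k (q + \<sigma> \<theta>))" if "continuous_on (Y S) k" for k
    unfolding \<kappa>_def \<sigma>_def by (rule continuous_on_circle_shift[OF that h er(2,3)])
  have cont_e: "continuous_on (half_Y S \<epsilon> \<times> cbox 0 1) (\<lambda>(q, \<theta>). \<kappa> \<theta> * dir_deriv (e i) f (q + \<sigma> \<theta>))"
    if "i \<le> nn S" for i
    by (rule cont[OF continuous_on_dir_deriv[OF f e_va[OF that]]])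
  have contq: "continuous_on (cbox 0 1) (\<lambda>\<theta>. F q \<theta>)"
    if "continuous_on (half_Y S \<epsilon> \<times> cbox 0 1) (\<lambda>(q, \<theta>). F q \<theta>)" "q \<in> half_Y S \<epsilon>"
    for q and F :: "('v \<Rightarrow>\<^sub>L complex) \<Rightarrow> real \<Rightarrow> 'b::topological_space"
  proof -
    have "continuous_on (cbox 0 1 :: real set) (Pair q)" by (intro continuous_intros)
    from continuous_on_compose2[OF that(1) this] that(2) show ?thesis by auto
  qed
  have cont_fx: "continuous_on (half_Y S \<epsilon> \<times> cbox 0 1) (\<lambda>(q, \<theta>). fx q \<theta>)"
    unfolding fx_def case_prod_beta
    by (intro continuous_on_sum bounded_bilinear.continuous_on[OF bounded_bilinear_blinfun_compose]
          continuous_on_const bounded_linear.continuous_on[OF bounded_linear_blinfun_mult_right]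
          cont_e[unfolded case_prod_beta]) simp
  define D where "D = blinfun_apply (integral (cbox 0 1) (fx p))"
  have "((\<lambda>q. integral (cbox 0 1) (\<lambda>\<theta>. \<kappa> \<theta> * f (q + \<sigma> \<theta>))) has_derivative D) (at p within half_Y S \<epsilon>)"
    unfolding D_def
  proof (rule leibniz_rule)
    fix q \<theta> assume q: "q \<in> half_Y S \<epsilon>"
    have "((\<lambda>x. f (x + \<sigma> \<theta>)) has_derivative (\<lambda>u. \<Sum>i\<le>nn S. dir_deriv (e i) f (q + \<sigma> \<theta>) * cpair (z i) u))
        (at q within half_Y S \<epsilon>)"
      by (rule has_derivative_in_compose[where f = "\<lambda>x. x + \<sigma> \<theta>" and f' = "\<lambda>u. u",
            OF _ has_derivative_subset[OF FY_has_derivative_coord[OF f shift[OF q]]]])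
         (use shift in \<open>auto intro!: derivative_eq_intros\<close>)
    then have "((\<lambda>x. \<kappa> \<theta> * f (x + \<sigma> \<theta>)) has_derivative
        (\<lambda>u. \<kappa> \<theta> * (\<Sum>i\<le>nn S. dir_deriv (e i) f (q + \<sigma> \<theta>) * cpair (z i) u))) (at q within half_Y S \<epsilon>)"
      by (rule has_derivative_mult_right)
    then show "((\<lambda>x. \<kappa> \<theta> * f (x + \<sigma> \<theta>)) has_derivative blinfun_apply (fx q \<theta>)) (at q within half_Y S \<epsilon>)"
      by (rule has_derivative_eq_rhs) (simp add: fun_eq_iff fx sum_distrib_left mult.assoc)
  next
    fix q assume q: "q \<in> half_Y S \<epsilon>"
    show "(\<lambda>\<theta>. \<kappa> \<theta> * f (q + \<sigma> \<theta>)) integrable_on cbox 0 1"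
      by (rule integrable_continuous[OF contq[OF cont[OF FY_continuous_on[OF f]] q]])
  qed (use cont_fx er(1) convex_half_Y in auto)
  then have "(dir_deriv h f has_derivative D) (at p within half_Y S \<epsilon>)"
    by (rule has_derivative_transform[OF er(1), rotated])
       (simp add: dir_deriv_integral_half_Y[OF f _ h er(2,3)] \<kappa>_def \<sigma>_def)
  then have 1: "(dir_deriv h f has_derivative D) (at p within Y S)"
    by (simp only: half_Y_nhd[OF er(1)])
  have "fx p integrable_on cbox 0 1"
    by (rule integrable_continuous[OF contq[OF cont_fx er(1)]])
  then have D: "D u = integral (cbox 0 1) (\<lambda>\<theta>. blinfun_apply (fx p \<theta>) u)" for u
    unfolding D_def by (rule blinfun_apply_integral)
  have 2: "D (hsc c u) = c * D u" for c u
  proof -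
    have "(\<lambda>\<theta>. blinfun_apply (fx p \<theta>) (hsc c u)) = (\<lambda>\<theta>. c * blinfun_apply (fx p \<theta>) u)"
      by (simp add: fx sum_distrib_left mult_ac)
    then show ?thesis by (simp add: D)
  qed
  \<comment> \<open>The membership premise avoids a circle: the first two claims alone give
    \<open>FY_dir_deriv\<close>, which then discharges it.\<close>
  have 3: "D (e i) = dir_deriv h (dir_deriv (e i) f) p" if "i \<le> nn S" "dir_deriv (e i) f \<in> FY S" for i
  proof -
    have "blinfun_apply (fx p \<theta>) (e i) = \<kappa> \<theta> * dir_deriv (e i) f (p + \<sigma> \<theta>)" for \<theta>
      using sum_dual(1)[OF that(1)] by (simp only: fx)
    then show ?thesis
      unfolding D dir_deriv_integral_half_Y[OF that(2) er(1) h er(2,3)]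
      by (simp only: \<kappa>_def \<sigma>_def)
  qed
  show thesis by (rule that[OF 1 2 3])
qed

lemma FY_dir_deriv:
  assumes f: "f \<in> FY S" and h: "blinfun_apply h (va S) = 0"
  shows "dir_deriv h f \<in> FY S"
  unfolding FY_def mem_Collect_eq
proof
  fix p assume p: "p \<in> Y S"
  show "\<exists>D. (dir_deriv h f has_derivative D) (at p within Y S) \<and>
    (\<forall>c h. blinfun_apply h (va S) = 0 \<longrightarrow> D (hsc c h) = c * D h)"
  proof (rule dir_deriv_has_derivative[OF f p h])
    fix D assume "(dir_deriv h f has_derivative D) (at p within Y S)" "\<And>c u. D (hsc c u) = c * D u"
    then show ?thesis by blast
  qed
qed

lemma FY_pd [intro]: "f \<in> FY S \<Longrightarrow> i \<le> nn S \<Longrightarrow> pd S z i f \<in> FY S"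
  by (simp only: pd_eq_dir_deriv) (intro FY_dir_deriv e_va)

lemma dir_deriv_commute:
  assumes f: "f \<in> FY S" and h: "blinfun_apply h (va S) = 0" and i: "i \<le> nn S" and p: "p \<in> Y S"
  shows "dir_deriv (e i) (dir_deriv h f) p = dir_deriv h (dir_deriv (e i) f) p"
proof (rule dir_deriv_has_derivative[OF f p h])
  fix D assume D: "(dir_deriv h f has_derivative D) (at p within Y S)" "\<And>c u. D (hsc c u) = c * D u"
    "\<And>i. i \<le> nn S \<Longrightarrow> dir_deriv (e i) f \<in> FY S \<Longrightarrow> D (e i) = dir_deriv h (dir_deriv (e i) f) p"
  have "dir_deriv (e i) (dir_deriv h f) p = D (e i)"
    by (rule dir_deriv_eqI[OF has_derivative_along[OF D(1) p e_va[OF i] D(2)]])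
  also have "\<dots> = dir_deriv h (dir_deriv (e i) f) p"
    by (rule D(3)[OF i FY_dir_deriv[OF f e_va[OF i]]])
  finally show ?thesis .
qed

lemma pd_commute:
  assumes "f \<in> FY S" "i \<le> nn S" "j \<le> nn S" "p \<in> Y S"
  shows "pd S z i (pd S z j f) p = pd S z j (pd S z i f) p"
  unfolding pd_eq_dir_deriv[OF assms(2)] pd_eq_dir_deriv[OF assms(3)]
  by (rule dir_deriv_commute[OF assms(1) e_va[OF assms(3)] assms(2,4)])

end

section \<open>Multi-indices and iterated derivatives\<close>

definition supp_in :: "nat set \<Rightarrow> (nat \<Rightarrow> nat) \<Rightarrow> bool" where
  "supp_in J b \<longleftrightarrow> (\<forall>i. i \<notin> J \<longrightarrow> b i = 0)"

lemma midx_eq: "midx n = {b. supp_in {1..n} b}"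
  by (auto simp: midx_def supp_in_def)

lemma supp_in_mono: "supp_in J b \<Longrightarrow> J \<subseteq> J' \<Longrightarrow> supp_in J' b"
  by (auto simp: supp_in_def)

lemma supp_in_zero [simp]: "supp_in J (\<lambda>_. 0)"
  by (simp add: supp_in_def)

lemma supp_in_upd: "supp_in J b \<Longrightarrow> i \<in> J \<Longrightarrow> supp_in J (b(i := k))"
  by (simp add: supp_in_def)

text \<open>Multi-indices are built by raising one entry at a time; the descent is on the sum of the
  entries.\<close>

lemma supp_in_induct [consumes 2, case_names zero inc]:
  assumes "finite J" "supp_in J b" "P (\<lambda>_. 0)"
    and "\<And>b i. supp_in J b \<Longrightarrow> i \<in> J \<Longrightarrow> P b \<Longrightarrow> P (b(i := b i + 1))"
  shows "P b"
  using assms(2)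
proof (induction "\<Sum>i\<in>J. b i" arbitrary: b rule: less_induct)
  case less
  show ?case
  proof (cases "\<forall>i\<in>J. b i = 0")
    case True
    then have "b = (\<lambda>_. 0)" using less.prems by (auto simp: supp_in_def)
    then show ?thesis using assms(3) by simp
  next
    case False
    then obtain i where i: "i \<in> J" "b i > 0" by auto
    define b' where "b' = b(i := b i - 1)"
    have "b = b'(i := b' i + 1)" using i by (auto simp: b'_def)
    moreover have s: "supp_in J b'" unfolding b'_def by (rule supp_in_upd[OF less.prems i(1)])
    moreover have "(\<Sum>i\<in>J. b' i) < (\<Sum>i\<in>J. b i)"
      by (rule sum_strict_mono_ex1) (use assms(1) i in \<open>auto simp: b'_def\<close>)
    ultimately show ?thesis using assms(4)[OF s i(1) less.hyps] by metis
  qed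
qed

lemma ddot_inc:
  assumes "i \<in> {1..nn S}"
  shows "ddot S (b(i := b i + 1)) = ddot S b + dg S i"
proof -
  have "(\<Sum>j\<in>{1..nn S} - {i}. dg S j * (b(i := b i + 1)) j) = (\<Sum>j\<in>{1..nn S} - {i}. dg S j * b j)"
    by (rule sum.cong) auto
  then show ?thesis
    unfolding ddot_def sum.remove[OF finite_atLeastAtMost assms] by simp
qed

lemma ddot_zero [simp]: "ddot S (\<lambda>_. 0) = 0"
  by (simp add: ddot_def)

lemma ddot_ge_component: "i \<in> {1..nn S} \<Longrightarrow> dg S i * b i \<le> ddot S b"
  unfolding ddot_def by (rule member_le_sum) auto

text \<open>Positive weights bound every entry of \<open>b\<close> by \<open>m\<close>.\<close>

lemma finite_ddot_eq:
  assumes "\<And>i. i \<in> {1..nn S} \<Longrightarrow> dg S i > 0"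
  shows "finite {b \<in> midx (nn S). ddot S b = m}"
proof (rule finite_subset)
  show "{b \<in> midx (nn S). ddot S b = m} \<subseteq>
      {f. \<forall>x. (x \<in> {1..nn S} \<longrightarrow> f x \<in> {0..m}) \<and> (x \<notin> {1..nn S} \<longrightarrow> f x = 0)}"
  proof safe
    fix b i assume "b \<in> midx (nn S)" and i: "i \<in> {1..nn S}" and "m = ddot S b"
    have "b i \<le> dg S i * b i" using assms[OF i] by simp
    also have "\<dots> \<le> ddot S b" by (rule ddot_ge_component[OF i])
    finally show "b i \<in> {0..ddot S b}" by simp
  qed (simp_all add: midx_def)
qed (rule finite_set_of_finite_funs, auto)

lemma mfact_inc:
  assumes "i \<in> {1..n}"
  shows "mfact n (b(i := b i + 1)) = (b i + 1) * mfact n b"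
proof -
  have "(\<Prod>j\<in>{1..n} - {i}. fact ((b(i := b i + 1)) j)) = (\<Prod>j\<in>{1..n} - {i}. fact (b j) :: nat)"
    by (rule prod.cong) auto
  then show ?thesis
    unfolding mfact_def prod.remove[OF finite_atLeastAtMost assms] by (simp add: algebra_simps)
qed

lemma mfact_zero [simp]: "mfact n (\<lambda>_. 0) = 1"
  by (simp add: mfact_def)

lemma mono_fun_zero [simp]: "mono_fun n x (\<lambda>_. 0) = (\<lambda>_. 1)"
  by (simp add: mono_fun_def fun_eq_iff)

lemma mono_fun_inc:
  assumes "i \<in> {1..n}"
  shows "mono_fun n x (b(i := b i + 1)) p = x i p * mono_fun n x b p"
proof -
  have "(\<Prod>j\<in>{1..n} - {i}. x j p ^ (b(i := b i + 1)) j) = (\<Prod>j\<in>{1..n} - {i}. x j p ^ b j)"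
    by (rule prod.cong) auto
  then show ?thesis
    unfolding mono_fun_def prod.remove[OF finite_atLeastAtMost assms] by simp
qed

context dual_coordinates
begin

section \<open>Rules for coordinate derivatives\<close>

lemma pd_cong:
  assumes "f \<in> FY S" "i \<le> nn S" "p \<in> Y S" "\<And>p. p \<in> Y S \<Longrightarrow> f p = f' p"
  shows "pd S z i f p = pd S z i f' p"
  unfolding pd_eq_dir_deriv[OF assms(2)] by (rule dir_deriv_cong[OF assms(1,3) e_va[OF assms(2)] assms(4)])

lemma pd_add:
  assumes "i \<le> nn S" "f \<in> FY S" "f' \<in> FY S" "p \<in> Y S"
  shows "pd S z i (\<lambda>p. f p + f' p) p = pd S z i f p + pd S z i f' p"
  unfolding pd_eq_dir_deriv[OF assms(1)] by (rule dir_deriv_add[OF assms(2-4) e_va[OF assms(1)]])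

lemma pd_diff:
  assumes "i \<le> nn S" "f \<in> FY S" "f' \<in> FY S" "p \<in> Y S"
  shows "pd S z i (\<lambda>p. f p - f' p) p = pd S z i f p - pd S z i f' p"
  unfolding pd_eq_dir_deriv[OF assms(1)] by (rule dir_deriv_diff[OF assms(2-4) e_va[OF assms(1)]])

lemma pd_mult:
  assumes "i \<le> nn S" "f \<in> FY S" "f' \<in> FY S" "p \<in> Y S"
  shows "pd S z i (\<lambda>p. f p * f' p) p = pd S z i f p * f' p + f p * pd S z i f' p"
  unfolding pd_eq_dir_deriv[OF assms(1)] by (rule dir_deriv_mult[OF assms(2-4) e_va[OF assms(1)]])

lemma pd_cmult:
  assumes "i \<le> nn S" "f \<in> FY S" "p \<in> Y S"
  shows "pd S z i (\<lambda>p. c * f p) p = c * pd S z i f p"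
  unfolding pd_eq_dir_deriv[OF assms(1)] by (rule dir_deriv_cmult[OF assms(2-3) e_va[OF assms(1)]])

lemma pd_sum:
  assumes "i \<le> nn S" "\<And>a. a \<in> A \<Longrightarrow> F a \<in> FY S" "p \<in> Y S"
  shows "pd S z i (\<lambda>p. \<Sum>a\<in>A. F a p) p = (\<Sum>a\<in>A. pd S z i (F a) p)"
  unfolding pd_eq_dir_deriv[OF assms(1)] by (rule dir_deriv_sum[OF assms(2,3) e_va[OF assms(1)]])

lemma pd_const [simp]: "i \<le> nn S \<Longrightarrow> pd S z i (\<lambda>_. c) = (\<lambda>_. 0)"
  by (rule ext) (simp only: pd_eq_dir_deriv dir_deriv_const)

lemma pd_coord:
  assumes "i \<le> nn S" "j \<le> nn S"
  shows "pd S z i (cpair (z j)) p = (if i = j then 1 else 0)"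
  unfolding pd_eq_dir_deriv[OF assms(1)] dir_deriv_cpair using dual[OF assms(2,1)] by auto

lemma pd_pow:
  assumes i: "i \<le> nn S" and f: "f \<in> FY S"
  shows FY_pd_pow: "(pd S z i ^^ k) f \<in> FY S"
    and pd_pow_cong: "(\<And>p. p \<in> Y S \<Longrightarrow> f p = f' p) \<Longrightarrow> p \<in> Y S \<Longrightarrow> (pd S z i ^^ k) f p = (pd S z i ^^ k) f' p"
    and pd_pow_commute: "j \<le> nn S \<Longrightarrow> p \<in> Y S \<Longrightarrow> (pd S z i ^^ k) (pd S z j f) p = pd S z j ((pd S z i ^^ k) f) p"
proof -
  show F: "(pd S z i ^^ k) f \<in> FY S" for k
    by (induction k) (auto intro: FY_pd i f)
  show "(pd S z i ^^ k) f p = (pd S z i ^^ k) f' p" if "\<And>p. p \<in> Y S \<Longrightarrow> f p = f' p" "p \<in> Y S"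
    using that(2)
  proof (induction k arbitrary: p)
    case (Suc k)
    then show ?case using pd_cong[OF F i Suc.prems Suc.IH] by simp
  qed (use that in simp)
  show "(pd S z i ^^ k) (pd S z j f) p = pd S z j ((pd S z i ^^ k) f) p" if j: "j \<le> nn S" and "p \<in> Y S"
    using that(2)
  proof (induction k arbitrary: p)
    case (Suc k)
    have "pd S z j ((pd S z i ^^ k) f) \<in> FY S" by (rule FY_pd[OF F j])
    then have "(pd S z i ^^ k) (pd S z j f) \<in> FY S"
      by (rule FY_cong) (simp add: Suc.IH)
    then have "pd S z i ((pd S z i ^^ k) (pd S z j f)) p = pd S z i (pd S z j ((pd S z i ^^ k) f)) p"
      using Suc by (intro pd_cong[OF _ i]) auto
    also have "\<dots> = pd S z j (pd S z i ((pd S z i ^^ k) f)) p"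
      by (rule pd_commute[OF F i j Suc.prems])
    finally show ?case by simp
  qed simp
qed

text \<open>\<open>mpd\<close> for an arbitrary list of directions, so that induction on the list is
  available.\<close>

definition mpd_list :: "nat list \<Rightarrow> (nat \<Rightarrow> nat) \<Rightarrow> 'v yfun \<Rightarrow> 'v yfun" where
  "mpd_list xs b = foldr (\<lambda>i F. (pd S z i ^^ b i) \<circ> F) xs id"

lemma mpd_list_Nil [simp]: "mpd_list [] b f = f"
  and mpd_list_Cons [simp]: "mpd_list (i # xs) b f = (pd S z i ^^ b i) (mpd_list xs b f)"
  by (simp_all add: mpd_list_def)

lemma mpd_eq_mpd_list: "mpd S z b = mpd_list [1..<nn S + 1] b"
  by (simp only: mpd_def mpd_list_def)

lemma mpd_list:
  assumes xs: "set xs \<subseteq> {..nn S}" and f: "f \<in> FY S"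
  shows FY_mpd_list: "mpd_list xs b f \<in> FY S"
    and mpd_list_cong: "(\<And>p. p \<in> Y S \<Longrightarrow> f p = f' p) \<Longrightarrow> p \<in> Y S \<Longrightarrow> mpd_list xs b f p = mpd_list xs b f' p"
    and mpd_list_commute: "j \<le> nn S \<Longrightarrow> p \<in> Y S \<Longrightarrow> mpd_list xs b (pd S z j f) p = pd S z j (mpd_list xs b f) p"
proof -
  have F: "mpd_list xs b f \<in> FY S" if "set xs \<subseteq> {..nn S}" "f \<in> FY S" for xs f
    using that by (induction xs) (auto intro: FY_pd_pow)
  show "mpd_list xs b f \<in> FY S" by (rule F[OF xs f])
  show "mpd_list xs b f p = mpd_list xs b f' p" if "\<And>p. p \<in> Y S \<Longrightarrow> f p = f' p" "p \<in> Y S"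
    using that(2) xs
  proof (induction xs arbitrary: p)
    case (Cons i xs)
    show ?case unfolding mpd_list_Cons
      by (rule pd_pow_cong) (use Cons F f in auto)
  qed (use that in simp)
  show "mpd_list xs b (pd S z j f) p = pd S z j (mpd_list xs b f) p" if j: "j \<le> nn S" and "p \<in> Y S"
    using that(2) xs
  proof (induction xs arbitrary: p)
    case (Cons i xs)
    have sx: "set xs \<subseteq> {..nn S}" and i: "i \<le> nn S" using Cons.prems by auto
    have "(pd S z i ^^ b i) (mpd_list xs b (pd S z j f)) p = (pd S z i ^^ b i) (pd S z j (mpd_list xs b f)) p"
      by (rule pd_pow_cong[OF i F[OF sx FY_pd[OF f j]] Cons.IH[OF _ sx] Cons.prems(1)])
    also have "\<dots> = pd S z j ((pd S z i ^^ b i) (mpd_list xs b f)) p"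
      by (rule pd_pow_commute[OF i F[OF sx f] j Cons.prems(1)])
    finally show ?case by simp
  qed simp
qed

text \<open>The additional derivative is commuted past all operators further inside until it acts on
  \<open>f\<close> directly. Distinctness ensures that raising \<open>b j\<close> adds only one
  derivative. This is the recursion behind every later induction on the order of
  differentiation.\<close>

lemma mpd_list_inc:
  assumes xs: "set xs \<subseteq> {..nn S}" and f: "f \<in> FY S" and "distinct xs" and "p \<in> Y S"
  shows "mpd_list xs (b(j := b j + 1)) f p = (if j \<in> set xs then mpd_list xs b (pd S z j f) p else mpd_list xs b f p)"
  using xs \<open>distinct xs\<close> \<open>p \<in> Y S\<close>
proof (induction xs arbitrary: p)
  case (Cons i xs)
  have sx: "set xs \<subseteq> {..nn S}" and i: "i \<le> nn S" and dx: "distinct xs" using Cons.prems by auto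
  note IH = Cons.IH[OF sx dx]
  show ?case
  proof (cases "i = j")
    case True
    then have j: "j \<notin> set xs" using Cons.prems by auto
    have "mpd_list (i # xs) (b(j := b j + 1)) f p = (pd S z i ^^ (b i + 1)) (mpd_list xs (b(j := b j + 1)) f) p"
      by (simp only: mpd_list_Cons True fun_upd_same)
    also have "\<dots> = (pd S z i ^^ (b i + 1)) (mpd_list xs b f) p"
      by (rule pd_pow_cong[OF i FY_mpd_list[OF sx f] _ Cons.prems(3), symmetric]) (simp only: IH j if_False)
    also have "\<dots> = pd S z i ((pd S z i ^^ b i) (mpd_list xs b f)) p" by simp
    also have "\<dots> = (pd S z i ^^ b i) (pd S z i (mpd_list xs b f)) p"
      by (rule pd_pow_commute[OF i FY_mpd_list[OF sx f] i Cons.prems(3), symmetric])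
    also have "\<dots> = (pd S z i ^^ b i) (mpd_list xs b (pd S z i f)) p"
      by (rule pd_pow_cong[OF i FY_pd[OF FY_mpd_list[OF sx f] i]])
         (simp_all only: mpd_list_commute[OF sx f i] Cons.prems(3))
    finally show ?thesis by (simp only: mpd_list_Cons True list.set insert_iff simp_thms if_True)
  next
    case False
    have "mpd_list (i # xs) (b(j := b j + 1)) f p = (pd S z i ^^ b i) (mpd_list xs (b(j := b j + 1)) f) p"
      using False by (simp only: mpd_list_Cons fun_upd_other[OF False])
    also have "\<dots> = (pd S z i ^^ b i) (if j \<in> set xs then mpd_list xs b (pd S z j f) else mpd_list xs b f) p"
      by (rule pd_pow_cong[OF i FY_mpd_list[OF sx f] _ Cons.prems(3)]) (simp only: IH split: if_split, blast)
    finally show ?thesis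
      using False by (cases "j \<in> set xs") (simp_all only: fun_upd_other[OF False] False[symmetric] mpd_list_Cons list.set insert_iff simp_thms if_True if_False)
  qed
qed (simp only: mpd_list_Nil list.set empty_iff if_False)

lemma mpd_zero [simp]: "mpd S z (\<lambda>_. 0) f = f"
proof -
  have "mpd_list xs (\<lambda>_. 0) f = f" for xs by (induction xs) auto
  then show ?thesis by (simp only: mpd_eq_mpd_list)
qed

lemma set_indices: "set [1..<nn S + 1] = {1..nn S}" "set [1..<nn S + 1] \<subseteq> {..nn S}"
  by auto

lemma FY_mpd: "f \<in> FY S \<Longrightarrow> mpd S z b f \<in> FY S"
  unfolding mpd_eq_mpd_list by (rule FY_mpd_list[OF set_indices(2)])

lemma mpd_cong: "f \<in> FY S \<Longrightarrow> (\<And>p. p \<in> Y S \<Longrightarrow> f p = f' p) \<Longrightarrow> p \<in> Y S \<Longrightarrow> mpd S z b f p = mpd S z b f' p"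
  unfolding mpd_eq_mpd_list by (rule mpd_list_cong[OF set_indices(2)])

lemma mpd_pd: "f \<in> FY S \<Longrightarrow> j \<le> nn S \<Longrightarrow> p \<in> Y S \<Longrightarrow> mpd S z b (pd S z j f) p = pd S z j (mpd S z b f) p"
  unfolding mpd_eq_mpd_list by (rule mpd_list_commute[OF set_indices(2)])

lemma mpd_inc:
  assumes "f \<in> FY S" "j \<in> {1..nn S}" "p \<in> Y S"
  shows "mpd S z (b(j := b j + 1)) f p = mpd S z b (pd S z j f) p"
  unfolding mpd_eq_mpd_list mpd_list_inc[OF set_indices(2) assms(1) distinct_upt assms(3)]
  using assms(2) by (simp only: set_indices(1) if_True)

lemma midx_induct [consumes 1, case_names zero inc]:
  assumes "b \<in> midx m" "P (\<lambda>_. 0)" "\<And>b i. b \<in> midx m \<Longrightarrow> i \<in> {1..m} \<Longrightarrow> P b \<Longrightarrow> P (b(i := b i + 1))"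
  shows "P b"
  by (rule supp_in_induct[of "{1..m}" b P]) (use assms in \<open>auto simp: midx_eq\<close>)

section \<open>Iterated derivatives of sums, products and monomials\<close>

lemma mpd_add:
  assumes "b \<in> midx (nn S)" "f \<in> FY S" "f' \<in> FY S" "p \<in> Y S"
  shows "mpd S z b (\<lambda>p. f p + f' p) p = mpd S z b f p + mpd S z b f' p"
  using assms
proof (induction b arbitrary: f f' rule: midx_induct)
  case (inc b i)
  have i: "i \<le> nn S" using inc by simp
  have "mpd S z (b(i := b i + 1)) (\<lambda>p. f p + f' p) p = mpd S z b (pd S z i (\<lambda>p. f p + f' p)) p"
    by (rule mpd_inc) (use inc in auto)
  also have "\<dots> = mpd S z b (\<lambda>p. pd S z i f p + pd S z i f' p) p"
    by (rule mpd_cong) (use inc i in \<open>auto simp: pd_add\<close>)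
  also have "\<dots> = mpd S z b (pd S z i f) p + mpd S z b (pd S z i f') p"
    by (rule inc.IH) (use inc i in auto)
  finally show ?case using inc by (simp only: mpd_inc)
qed simp

text \<open>Only z^1, ..., z^n are tested, since they are the coordinates on the fibres of \<pi>.
  Elements of \<open>FH\<close> and restrictions to \<open>Lperp\<close> are the instances; such
  functions act as scalars for \<open>mpd\<close>.\<close>

definition fibre_const :: "'v yfun \<Rightarrow> bool" where
  "fibre_const c \<longleftrightarrow> c \<in> FY S \<and> (\<forall>i\<in>{1..nn S}. \<forall>p\<in>Y S. pd S z i c p = 0)"

lemma fibre_const_const [simp, intro]: "fibre_const (\<lambda>_. c)"
  by (auto simp: fibre_const_def)

lemma mpd_mult_left:
  assumes "b \<in> midx (nn S)" "fibre_const c" "f \<in> FY S" "p \<in> Y S"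
  shows "mpd S z b (\<lambda>p. c p * f p) p = c p * mpd S z b f p"
  using assms
proof (induction b arbitrary: f rule: midx_induct)
  case (inc b i)
  have i: "i \<le> nn S" using inc by simp
  have c: "c \<in> FY S" "\<And>p. p \<in> Y S \<Longrightarrow> pd S z i c p = 0" using inc by (auto simp: fibre_const_def)
  have "mpd S z (b(i := b i + 1)) (\<lambda>p. c p * f p) p = mpd S z b (pd S z i (\<lambda>p. c p * f p)) p"
    by (rule mpd_inc) (use inc c in auto)
  also have "\<dots> = mpd S z b (\<lambda>p. c p * pd S z i f p) p"
    by (rule mpd_cong) (use inc i c in \<open>auto simp: pd_mult\<close>)
  also have "\<dots> = c p * mpd S z b (pd S z i f) p"
    by (rule inc.IH) (use inc i in auto)
  finally show ?case using inc by (simp only: mpd_inc)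
qed simp

lemma mpd_sum:
  assumes "finite A" "b \<in> midx (nn S)" "\<And>a. a \<in> A \<Longrightarrow> F a \<in> FY S" "p \<in> Y S"
  shows "mpd S z b (\<lambda>p. \<Sum>a\<in>A. F a p) p = (\<Sum>a\<in>A. mpd S z b (F a) p)"
  using assms
proof (induction A rule: finite_induct)
  case empty
  then show ?case using mpd_mult_left[of b "\<lambda>_. 0" "\<lambda>_. 0" p] by simp
next
  case (insert a A)
  then have "mpd S z b (\<lambda>p. F a p + (\<Sum>a\<in>A. F a p)) p = mpd S z b (F a) p + mpd S z b (\<lambda>p. \<Sum>a\<in>A. F a p) p"
    by (intro mpd_add) auto
  then show ?case using insert by simp
qed

lemma mpd_diff:
  assumes "b \<in> midx (nn S)" "f \<in> FY S" "f' \<in> FY S" "p \<in> Y S"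
  shows "mpd S z b (\<lambda>p. f p - f' p) p = mpd S z b f p - mpd S z b f' p"
proof -
  have "mpd S z b (\<lambda>p. f p + (-1) * f' p) p = mpd S z b f p + mpd S z b (\<lambda>p. (-1) * f' p) p"
    using assms by (intro mpd_add) auto
  also have "mpd S z b (\<lambda>p. (-1) * f' p) p = (-1) * mpd S z b f' p"
    using assms by (intro mpd_mult_left) auto
  finally show ?thesis by simp
qed

text \<open>For \<open>b i = 0\<close> the truncated exponent \<open>b i - 1\<close> is harmless
  because of the factor \<open>of_nat (b i)\<close>.\<close>

lemma pd_mono_fun:
  assumes i: "i \<in> {1..nn S}" and b: "b \<in> midx (nn S)" and p: "p \<in> Y S"
  shows "pd S z i (mono_fun (nn S) (\<lambda>i. cpair (z i)) b) p =
    of_nat (b i) * mono_fun (nn S) (\<lambda>i. cpair (z i)) (b(i := b i - 1)) p"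
  using b p
proof (induction b arbitrary: p rule: midx_induct)
  case zero
  then show ?case using i by simp
next
  case (inc b j)
  let ?Z = "\<lambda>i. cpair (z i)"
  have "pd S z i (mono_fun (nn S) ?Z (b(j := b j + 1))) p = pd S z i (\<lambda>p. cpair (z j) p * mono_fun (nn S) ?Z b p) p"
    by (rule pd_cong) (use i inc in \<open>auto simp: mono_fun_inc simp del: One_nat_def\<close>)
  also have "\<dots> = pd S z i (cpair (z j)) p * mono_fun (nn S) ?Z b p + cpair (z j) p * pd S z i (mono_fun (nn S) ?Z b) p"
    by (rule pd_mult) (use i inc in auto)
  also have "pd S z i (cpair (z j)) p = (if i = j then 1 else 0)"
    by (rule pd_coord) (use i inc in auto)
  also have "pd S z i (mono_fun (nn S) ?Z b) p = of_nat (b i) * mono_fun (nn S) ?Z (b(i := b i - 1)) p"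
    by (rule inc.IH[OF inc.prems])
  also have "(if i = j then 1 else 0) * mono_fun (nn S) ?Z b p +
      cpair (z j) p * (of_nat (b i) * mono_fun (nn S) ?Z (b(i := b i - 1)) p) =
    of_nat ((b(j := b j + 1)) i) * mono_fun (nn S) ?Z ((b(j := b j + 1))(i := (b(j := b j + 1)) i - 1)) p"
  proof (cases "i = j")
    case True
    have "cpair (z i) p * (of_nat (b i) * mono_fun (nn S) ?Z (b(i := b i - 1)) p) = of_nat (b i) * mono_fun (nn S) ?Z b p"
    proof (cases "b i")
      case (Suc k)
      then show ?thesis
        using mono_fun_inc[OF i, of ?Z "b(i := b i - 1)" p] by (simp add: fun_upd_idem)
    qed simp
    then show ?thesis using True by (simp add: algebra_simps)
  next
    case False
    have "mono_fun (nn S) ?Z ((b(i := b i - 1))(j := (b(i := b i - 1)) j + 1)) p =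
       cpair (z j) p * mono_fun (nn S) ?Z (b(i := b i - 1)) p"
      by (rule mono_fun_inc[OF inc(2)])
    then show ?thesis using False by (simp add: fun_upd_twist)
  qed
  finally show ?case .
qed

end

section \<open>The locus orthogonal to L\<close>

text \<open>With $z^i$ of weight $d_i$, this is the property of having weighted order at least \<open>w\<close> along
  $L^\perp$, where only the directions in \<open>J\<close> are taken into account; omitting \<open>n\<close> from \<open>J\<close>
  amounts to restricting to the slice $z^n = 0$.\<close>

definition van ::
  "'v::euclidean_space elliptic \<Rightarrow> 'v set \<Rightarrow> (nat \<Rightarrow> 'v cplxfn) \<Rightarrow> nat set \<Rightarrow> nat \<Rightarrow> 'v yfun \<Rightarrow> bool" where
  "van S L z J w f \<longleftrightarrow> f \<in> FY S \<and>
     (\<forall>b. supp_in J b \<longrightarrow> ddot S b < w \<longrightarrow> (\<forall>p\<in>Lperp S L. mpd S z b f p = 0))"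

definition pull :: "('v \<Rightarrow> 'v) \<Rightarrow> ('v::euclidean_space \<Rightarrow>\<^sub>L complex) \<Rightarrow> ('v \<Rightarrow>\<^sub>L complex)" where
  "pull w p = p o\<^sub>L Blinfun w"

lemma pull_apply: "linear w \<Longrightarrow> blinfun_apply (pull w p) v = blinfun_apply p (w v)"
  by (simp add: pull_def linear_conv_bounded_linear bounded_linear_Blinfun_apply)

lemma pull_add: "pull w (p + q) = pull w p + pull w q"
  by (rule blinfun_eqI) (simp add: pull_def blinfun.add_left)

lemma pull_hsc: "pull w (hsc c p) = hsc c (pull w p)"
  by (rule blinfun_eqI) (simp add: pull_def)

lemma dir_deriv_pull: "dir_deriv h (\<lambda>p. f (pull w p)) p = dir_deriv (pull w h) f (pull w p)"
  by (simp add: dir_deriv_def pull_add pull_hsc)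

text \<open>The action on functions inverts \<open>w\<close> and the action on points inverts it
  again, so what remains is composition with the transpose.\<close>

lemma act_fun_eq_pull:
  assumes "linear w" "bij w"
  shows "act_fun w f p = f (pull w p)"
proof -
  have "act_pt (inv w) p = pull w p"
  proof (rule blinfun_eqI)
    fix v
    have "(\<lambda>\<gamma>. blinfun_apply p (w \<gamma>)) = blinfun_apply (pull w p)"
      using pull_apply[OF assms(1)] by auto
    then show "blinfun_apply (act_pt (inv w) p) v = blinfun_apply (pull w p) v"
      by (simp add: act_pt_def inv_inv_eq[OF assms(2)] blinfun_apply_inverse)
  qed
  then show ?thesis by (simp add: act_fun_def)
qed

lemma FH_cong_vdelta:
  assumes "c \<in> FH S" "p \<in> Y S" "q \<in> Y S" "blinfun_apply p (vdelta S) = blinfun_apply q (vdelta S)"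
  shows "c p = c q"
  using assms by (auto simp: FH_def)

text \<open>No bilinear form enters, so that the locale applies both to the flat basis and to
  whichever homogeneous basis witnesses goodness.\<close>

locale taylor_coordinates = dual_coordinates S z e
  for S :: "'v::euclidean_space elliptic" and z e +
  fixes L :: "'v set"
  assumes z_0: "z 0 = z0 S"
    and z_L: "i \<in> {1..nn S} \<Longrightarrow> z i \<in> cspace L"
    and L_span: "v \<in> L \<Longrightarrow> \<exists>c. (v, 0) = (\<Sum>i\<in>{1..nn S}. csc (c i) (z i))"
    and rad_eq: "radF S = span {va S, vdelta S}"
    and L_rad: "{u + v | u v. u \<in> L \<and> v \<in> radF S} = UNIV"
begin

abbreviation "Z \<equiv> \<lambda>i. cpair (z i)"

lemma Lperp_Y: "p \<in> Lperp S L \<Longrightarrow> p \<in> Y S"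
  by (simp add: Lperp_def)

lemma coord_Lperp:
  assumes "i \<in> {1..nn S}" "p \<in> Lperp S L"
  shows "cpair (z i) p = 0"
  using z_L[OF assms(1)] assms(2) by (auto simp: cpair_def cspace_def Lperp_def)

lemma cpair_L:
  assumes "v \<in> L" "\<And>i. i \<in> {1..nn S} \<Longrightarrow> cpair (z i) h = 0"
  shows "blinfun_apply h v = 0"
proof -
  obtain c where c: "(v, 0) = (\<Sum>i\<in>{1..nn S}. csc (c i) (z i))"
    using L_span[OF assms(1)] by blast
  have "blinfun_apply h v = cpair (v, 0) h"
    by (simp add: cpair_def blinfun.bilinear_simps)
  also have "\<dots> = (\<Sum>i\<in>{1..nn S}. c i * cpair (z i) h)"
    by (simp only: c cpair_sum_left cpair_csc)
  also have "\<dots> = 0"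
    by (rule sum.neutral) (use assms in auto)
  finally show ?thesis .
qed

lemma Lperp_iff: "p \<in> Y S \<Longrightarrow> p \<in> Lperp S L \<longleftrightarrow> (\<forall>i\<in>{1..nn S}. cpair (z i) p = 0)"
  using coord_Lperp cpair_L by (auto simp: Lperp_def)

lemma Lperp_unique:
  assumes "p \<in> Lperp S L" "q \<in> Lperp S L" "blinfun_apply p (vdelta S) = blinfun_apply q (vdelta S)"
  shows "p = q"
proof (rule blinfun_eqI)
  fix v
  obtain u t where ut: "v = u + t" "u \<in> L" "t \<in> span {va S, vdelta S}"
    using L_rad rad_eq by blast
  have "blinfun_apply p (va S) = blinfun_apply q (va S)"
    using assms by (simp add: Lperp_def Y_def)
  then have "blinfun_apply p t = blinfun_apply q t"
    using linear_eq_on_span[OF bounded_linear.linear[OF blinfun.bounded_linear_right]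
        bounded_linear.linear[OF blinfun.bounded_linear_right] _ ut(3), of p q] assms(3) by auto
  then show "blinfun_apply p v = blinfun_apply q v"
    using assms ut by (simp add: blinfun.bilinear_simps Lperp_def)
qed

lemma cpair_z0: "cpair (z 0) h = 1 / (- 2 * of_real pi * \<i>) * blinfun_apply h (vdelta S)"
  by (simp add: z_0 z0_def del: mult_minus_left) (simp add: cpair_def blinfun.bilinear_simps)

lemma e_vdelta:
  assumes "i \<in> {1..nn S}"
  shows "blinfun_apply (e i) (vdelta S) = 0"
  using dual[of 0 i] assms cpair_z0[of "e i"] by auto

lemma e0_L: "v \<in> L \<Longrightarrow> blinfun_apply (e 0) v = 0"
  by (rule cpair_L) (use dual[of _ 0] in auto)

text \<open>The retraction of Y onto \<open>Lperp\<close> along the fibres of \<pi>. It replaces the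
  definite description in \<open>res\<close> by a complex linear formula, which makes holomorphy of
  restrictions visible.\<close>

definition proj :: "('v \<Rightarrow>\<^sub>L complex) \<Rightarrow> ('v \<Rightarrow>\<^sub>L complex)" where
  "proj p = p - (\<Sum>i\<in>{1..nn S}. hsc (cpair (z i) p) (e i))"

lemma proj_vdelta [simp]: "blinfun_apply (proj p) (vdelta S) = blinfun_apply p (vdelta S)"
proof -
  have "(\<Sum>i\<in>{1..nn S}. blinfun_apply (hsc (cpair (z i) p) (e i)) (vdelta S)) = 0"
    by (rule sum.neutral) (use e_vdelta in auto)
  then show ?thesis by (simp add: proj_def blinfun.diff_left blinfun.sum_left)
qed

lemma proj_va: "blinfun_apply (proj p) (va S) = blinfun_apply p (va S)"
proof -
  have "(\<Sum>i\<in>{1..nn S}. blinfun_apply (hsc (cpair (z i) p) (e i)) (va S)) = 0"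
    by (rule sum.neutral) (use e_va in auto)
  then show ?thesis by (simp add: proj_def blinfun.diff_left blinfun.sum_left)
qed

lemma proj_Y: "p \<in> Y S \<Longrightarrow> proj p \<in> Y S"
  by (simp add: Y_def proj_va)

lemma coord_proj:
  assumes "j \<in> {1..nn S}"
  shows "cpair (z j) (proj p) = 0"
proof -
  have "(\<Sum>i\<in>{1..nn S}. cpair (z i) p * cpair (z j) (e i)) = (\<Sum>i\<in>{1..nn S}. if i = j then cpair (z i) p else 0)"
    by (rule sum.cong) (use assms dual in auto)
  also have "\<dots> = cpair (z j) p"
    using assms by (simp only: sum.delta finite_atLeastAtMost if_True)
  finally show ?thesis
    by (simp only: proj_def cpair_diff_right cpair_sum_right cpair_hsc) simp
qed

lemma proj_Lperp: "p \<in> Y S \<Longrightarrow> proj p \<in> Lperp S L"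
  using Lperp_iff[OF proj_Y] coord_proj by blast

lemma proj_eqI: "p \<in> Y S \<Longrightarrow> q \<in> Lperp S L \<Longrightarrow> blinfun_apply q (vdelta S) = blinfun_apply p (vdelta S) \<Longrightarrow> proj p = q"
  by (rule Lperp_unique) (auto intro: proj_Lperp)

lemma proj_id: "p \<in> Lperp S L \<Longrightarrow> proj p = p"
  by (rule proj_eqI) (auto intro: Lperp_Y)

lemma res_eq:
  assumes p: "p \<in> Y S"
  shows "res S L f p = f (proj p)"
proof -
  have "(THE y. y \<in> Lperp S L \<and> (\<forall>v\<in>radF S. blinfun_apply y v = blinfun_apply p v)) = proj p"
  proof (rule the_equality)
    have "blinfun_apply (proj p) v = blinfun_apply p v" if "v \<in> radF S" for v
    proof (rule linear_eq_on_span[OF bounded_linear.linear[OF blinfun.bounded_linear_right]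
        bounded_linear.linear[OF blinfun.bounded_linear_right] _ that[unfolded rad_eq]])
      fix x assume "x \<in> {va S, vdelta S}"
      then show "blinfun_apply (proj p) x = blinfun_apply p x" using proj_va by auto
    qed
    then show "proj p \<in> Lperp S L \<and> (\<forall>v\<in>radF S. blinfun_apply (proj p) v = blinfun_apply p v)"
      using proj_Lperp[OF p] by blast
    fix y assume y: "y \<in> Lperp S L \<and> (\<forall>v\<in>radF S. blinfun_apply y v = blinfun_apply p v)"
    have "vdelta S \<in> radF S" unfolding rad_eq by (rule span_base) simp
    then show "y = proj p" using y proj_eqI[OF p, of y] by auto
  qed
  then show ?thesis by (simp add: res_def)
qed

lemma FY_res:
  assumes f: "f \<in> FY S"
  shows "(\<lambda>p. f (proj p)) \<in> FY S"
  unfolding FY_def mem_Collect_eq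
proof
  fix p assume p: "p \<in> Y S"
  obtain D where D: "(f has_derivative D) (at (proj p) within Y S)"
    "\<And>c h. blinfun_apply h (va S) = 0 \<Longrightarrow> D (hsc c h) = c * D h"
    using FY_has_derivative[OF f proj_Y[OF p]] by blast
  have bl: "bounded_linear proj"
    unfolding proj_def
    by (intro bounded_linear_sub bounded_linear_ident bounded_linear_sum
        bounded_linear_compose[OF hsc_bounded_linear_left bounded_linear_cpair])
  have hom: "proj (hsc c h) = hsc c (proj h)" for c h
    by (simp add: proj_def hsc_simps hsc_sum_right mult.commute)
  have "((\<lambda>p. f (proj p)) has_derivative (\<lambda>u. D (proj u))) (at p within Y S)"
    by (rule has_derivative_in_compose[OF bounded_linear.has_derivative[OF bl has_derivative_ident]
          has_derivative_subset[OF D(1)]]) (use proj_Y in auto)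
  then show "\<exists>D. ((\<lambda>p. f (proj p)) has_derivative D) (at p within Y S) \<and>
            (\<forall>c h. blinfun_apply h (va S) = 0 \<longrightarrow> D (hsc c h) = c * D h)"
    using D(2) hom proj_va by (intro exI[of _ "\<lambda>u. D (proj u)"]) auto
qed

text \<open>Moving along a coordinate direction with index at least 1 does not change the value at
  \<delta>, hence not the projection to \<open>Lperp\<close>.\<close>

lemma fibre_constI:
  assumes "c \<in> FY S" "\<And>p. p \<in> Y S \<Longrightarrow> c p = c (proj p)"
  shows "fibre_const c"
  unfolding fibre_const_def
proof (intro conjI ballI)
  fix i p assume i: "i \<in> {1..nn S}" and p: "p \<in> Y S"
  then have i': "i \<le> nn S" by simp
  have "c (p + hsc t (e i)) = c p" for t
  proof -
    have q: "p + hsc t (e i) \<in> Y S"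
      using p i e_vdelta e_va by (simp add: Y_shift_iff) (simp add: Y_def)
    have "proj (p + hsc t (e i)) = proj p"
      by (rule proj_eqI[OF q proj_Lperp[OF p]]) (use e_vdelta[OF i] in \<open>simp add: blinfun.bilinear_simps\<close>)
    then show ?thesis using assms(2)[OF p] assms(2)[OF q] by simp
  qed
  then show "pd S z i c p = 0"
    unfolding pd_eq_dir_deriv[OF i'] by (simp add: dir_deriv_def)
qed (rule assms(1))

lemma FH_FY:
  assumes "c \<in> FH S"
  shows "c \<in> FY S"
proof -
  obtain k where k: "k holomorphic_on {s. Re s > 0}" and ck: "\<And>p. p \<in> Y S \<Longrightarrow> c p = k (blinfun_apply p (vdelta S))"
    using assms by (auto simp: FH_def)
  have o: "open {s. Re s > 0}" by (intro open_Collect_less continuous_intros)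
  have "(\<lambda>p. k (blinfun_apply p (vdelta S))) \<in> FY S"
  proof (rule FY_I)
    fix p assume "p \<in> Y S"
    then have "Re (blinfun_apply p (vdelta S)) > 0" by (simp add: Y_def)
    then have "(k has_field_derivative deriv k (blinfun_apply p (vdelta S))) (at (blinfun_apply p (vdelta S)))"
      using holomorphic_derivI[OF k o] by simp
    then have "(k has_derivative (\<lambda>u. deriv k (blinfun_apply p (vdelta S)) * u)) (at (blinfun_apply p (vdelta S)))"
      by (simp add: has_field_derivative_def)
    from has_derivative_compose[OF bounded_linear.has_derivative[OF blinfun.bounded_linear_left has_derivative_ident] this]
    show "((\<lambda>p. k (blinfun_apply p (vdelta S))) has_derivative
       (\<lambda>u. deriv k (blinfun_apply p (vdelta S)) * blinfun_apply u (vdelta S))) (at p within Y S)" .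
  qed simp
  then show ?thesis by (rule FY_cong) (simp add: ck)
qed

lemma FH_proj: "c \<in> FH S \<Longrightarrow> p \<in> Y S \<Longrightarrow> c (proj p) = c p"
  by (rule FH_cong_vdelta) (auto intro: proj_Y)

lemma fibre_const_FH: "c \<in> FH S \<Longrightarrow> fibre_const c"
  by (rule fibre_constI) (auto intro: FH_FY simp: FH_proj)

text \<open>The coordinates z^1, ..., z^n vanish on \<open>Lperp\<close>, so a monomial contributes
  to no Taylor coefficient but its own.\<close>

lemma mpd_mono_fun:
  assumes "c \<in> midx (nn S)" "b \<in> midx (nn S)" "p \<in> Lperp S L"
  shows "mpd S z c (mono_fun (nn S) Z b) p = (if b = c then of_nat (mfact (nn S) b) else 0)"
  using assms(1,2)
proof (induction c arbitrary: b rule: midx_induct)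
  case zero
  show ?case
  proof (cases "b = (\<lambda>_. 0)")
    case False
    then obtain i where i: "i \<in> {1..nn S}" "b i > 0"
      using zero by (auto simp: midx_def)
    have "mono_fun (nn S) Z b p = 0"
      unfolding mono_fun_def
      by (rule prod_zero) (use i coord_Lperp[OF i(1) assms(3)] in \<open>auto intro!: bexI[of _ i]\<close>)
    then show ?thesis using False by simp
  qed simp
next
  case (inc c i)
  have p: "p \<in> Y S" using assms(3) by (rule Lperp_Y)
  have i: "i \<in> {1..nn S}" by (rule inc.hyps(2))
  have b': "b(i := b i - 1) \<in> midx (nn S)" using inc i by (auto simp: midx_def)
  have "mpd S z (c(i := c i + 1)) (mono_fun (nn S) Z b) p = mpd S z c (pd S z i (mono_fun (nn S) Z b)) p"
    by (rule mpd_inc[OF _ i p]) auto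
  also have "\<dots> = mpd S z c (\<lambda>p. of_nat (b i) * mono_fun (nn S) Z (b(i := b i - 1)) p) p"
    by (rule mpd_cong[OF FY_pd _ p]) (use i pd_mono_fun[OF i inc.prems] in auto)
  also have "\<dots> = of_nat (b i) * mpd S z c (mono_fun (nn S) Z (b(i := b i - 1))) p"
    by (rule mpd_mult_left) (use inc p in auto)
  also have "mpd S z c (mono_fun (nn S) Z (b(i := b i - 1))) p =
      (if b(i := b i - 1) = c then of_nat (mfact (nn S) (b(i := b i - 1))) else 0)"
    by (rule inc.IH[OF b'])
  also have "of_nat (b i) * (if b(i := b i - 1) = c then of_nat (mfact (nn S) (b(i := b i - 1))) else 0) =
     (if b = c(i := c i + 1) then of_nat (mfact (nn S) b) else (0::complex))"
  proof (cases "b i = 0")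
    case True
    then have "b \<noteq> c(i := c i + 1)" by (metis Suc_eq_plus1 fun_upd_same nat.simps(3))
    then show ?thesis using True by simp
  next
    case False
    have "b(i := b i - 1) = c \<longleftrightarrow> b = c(i := c i + 1)"
      using False by (auto simp: fun_eq_iff)
    moreover have "mfact (nn S) b = b i * mfact (nn S) (b(i := b i - 1))"
      using mfact_inc[OF i, of "b(i := b i - 1)"] False by (simp add: fun_upd_idem)
    ultimately show ?thesis by (auto simp: algebra_simps)
  qed
  finally show ?case .
qed

end

section \<open>Weighted order of vanishing\<close>

context taylor_coordinates
begin

context
  fixes J assumes J: "J \<subseteq> {1..nn S}"
begin

lemma supp_midx: "supp_in J b \<Longrightarrow> b \<in> midx (nn S)"
  using supp_in_mono[OF _ J] by (simp add: midx_eq)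

lemma van_FY: "van S L z J w f \<Longrightarrow> f \<in> FY S"
  by (simp add: van_def)

lemma van_0: "f \<in> FY S \<Longrightarrow> van S L z J 0 f"
  by (simp add: van_def)

lemma van_antimono: "van S L z J w f \<Longrightarrow> w' \<le> w \<Longrightarrow> van S L z J w' f"
  by (auto simp: van_def)

lemma van_cong: "van S L z J w f \<Longrightarrow> (\<And>p. p \<in> Y S \<Longrightarrow> f p = f' p) \<Longrightarrow> van S L z J w f'"
  using FY_cong[of f S f'] mpd_cong[of f f'] Lperp_Y by (auto simp: van_def)

lemma van_add:
  assumes "van S L z J w f" "van S L z J w f'"
  shows "van S L z J w (\<lambda>p. f p + f' p)"
  unfolding van_def
proof (intro conjI allI impI ballI)
  fix b p assume b: "supp_in J b" "ddot S b < w" and p: "p \<in> Lperp S L"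
  have "mpd S z b (\<lambda>p. f p + f' p) p = mpd S z b f p + mpd S z b f' p"
    by (rule mpd_add) (use assms supp_midx[OF b(1)] Lperp_Y[OF p] van_FY in auto)
  then show "mpd S z b (\<lambda>p. f p + f' p) p = 0"
    using assms b p by (simp add: van_def)
qed (use assms in \<open>auto simp: van_def\<close>)

lemma van_mult_left:
  assumes "fibre_const c" "van S L z J w f"
  shows "van S L z J w (\<lambda>p. c p * f p)"
  unfolding van_def
proof (intro conjI allI impI ballI)
  fix b p assume b: "supp_in J b" "ddot S b < w" and p: "p \<in> Lperp S L"
  have "mpd S z b (\<lambda>p. c p * f p) p = c p * mpd S z b f p"
    by (rule mpd_mult_left) (use assms supp_midx[OF b(1)] Lperp_Y[OF p] van_FY in auto)
  then show "mpd S z b (\<lambda>p. c p * f p) p = 0"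
    using assms b p by (simp add: van_def)
qed (use assms in \<open>auto simp: van_def fibre_const_def\<close>)

lemma van_diff:
  assumes "van S L z J w f" "van S L z J w f'"
  shows "van S L z J w (\<lambda>p. f p - f' p)"
  using van_add[OF assms(1) van_mult_left[of "\<lambda>_. -1", OF _ assms(2)]] by simp

lemma van_zero: "van S L z J w (\<lambda>_. 0)"
  using van_mult_left[of "\<lambda>_. 0" 0 "\<lambda>_. 0"] mpd_mult_left[of _ "\<lambda>_. 0" "\<lambda>_. 0"] supp_midx Lperp_Y
  by (fastforce simp: van_def)

lemma van_sum: "(\<And>a. a \<in> A \<Longrightarrow> van S L z J w (F a)) \<Longrightarrow> van S L z J w (\<lambda>p. \<Sum>a\<in>A. F a p)"
  by (induction A rule: infinite_finite_induct) (auto intro: van_zero van_add)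

text \<open>Differentiation in z^i costs weight d_i. If d_i exceeds \<open>w\<close>, the truncated
  difference is 0 and only holomorphy is claimed.\<close>

lemma van_pd:
  assumes f: "van S L z J w f" and i: "i \<in> J"
  shows "van S L z J (w - dg S i) (pd S z i f)"
  unfolding van_def
proof (intro conjI allI impI ballI)
  have i': "i \<in> {1..nn S}" using i J by auto
  then show "pd S z i f \<in> FY S" using FY_pd[OF van_FY[OF f], of i] by simp
  fix b p assume b: "supp_in J b" "ddot S b < w - dg S i" and p: "p \<in> Lperp S L"
  have "ddot S (b(i := b i + 1)) < w"
    unfolding ddot_inc[OF i'] using b(2) by linarith
  note vf = supp_in_upd[OF b(1) i, of "b i + 1"] this
  have "mpd S z b (pd S z i f) p = mpd S z (b(i := b i + 1)) f p"
    by (rule mpd_inc[OF van_FY[OF f] i' Lperp_Y[OF p], symmetric])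
  also have "\<dots> = 0"
    using f p vf unfolding van_def by blast
  finally show "mpd S z b (pd S z i f) p = 0" .
qed

text \<open>Converse of \<open>van_pd\<close>: the order is decided by the value on
  \<open>Lperp\<close> and the first derivatives, which makes induction on the weight
  possible.\<close>

lemma vanI:
  assumes f: "f \<in> FY S" and 0: "\<And>p. w > 0 \<Longrightarrow> p \<in> Lperp S L \<Longrightarrow> f p = 0"
    and d: "\<And>i. i \<in> J \<Longrightarrow> van S L z J (w - dg S i) (pd S z i f)"
  shows "van S L z J w f"
  unfolding van_def
proof (intro conjI allI impI ballI)
  fix b p assume b: "supp_in J b" "ddot S b < w" and p: "p \<in> Lperp S L"
  have fJ: "finite J" using J finite_subset by blast
  show "mpd S z b f p = 0"
    using fJ b
  proof (induction b rule: supp_in_induct)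
    case zero
    then show ?case using 0 p by simp
  next
    case (inc b i)
    have i: "i \<in> {1..nn S}" using inc J by auto
    have lt: "ddot S b < w - dg S i"
      using inc.prems unfolding ddot_inc[OF i] by linarith
    have "mpd S z (b(i := b i + 1)) f p = mpd S z b (pd S z i f) p"
      by (rule mpd_inc[OF f i Lperp_Y[OF p]])
    also have "\<dots> = 0"
      using d[OF inc.hyps(2)] inc.hyps(1) lt p unfolding van_def by blast
    finally show ?case .
  qed
qed (rule f)

text \<open>Leibniz rule and induction on \<open>v\<close>, which decreases because the weights are
  positive. A bound v \<le> w + w' instead of an equation survives the truncated subtractions w -
  d_i and w' - d_i.\<close>

lemma van_mult:
  assumes pos: "\<And>i. i \<in> J \<Longrightarrow> dg S i > 0"
    and "van S L z J w f" "van S L z J w' f'" "v \<le> w + w'"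
  shows "van S L z J v (\<lambda>p. f p * f' p)"
  using assms(2-4)
proof (induction v arbitrary: w w' f f' rule: less_induct)
  case (less v)
  note F = van_FY[OF less.prems(1)] van_FY[OF less.prems(2)]
  show ?case
  proof (cases "v = 0")
    case True
    then show ?thesis using van_0[OF FY_mult[OF F]] by simp
  next
    case False
    show ?thesis
    proof (rule vanI[OF FY_mult[OF F]])
      fix p assume p: "p \<in> Lperp S L"
      have "f p = 0 \<or> f' p = 0"
      proof (cases "w > 0")
        case True
        then have "mpd S z (\<lambda>_. 0) f p = 0"
          using less.prems(1) p unfolding van_def by (metis ddot_zero supp_in_zero)
        then show ?thesis by simp
      next
        case False
        then have "mpd S z (\<lambda>_. 0) f' p = 0"
          using less.prems p \<open>v \<noteq> 0\<close> unfolding van_def by (metis add_0 ddot_zero supp_in_zero gr0I le_0_eq)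
        then show ?thesis by simp
      qed
      then show "f p * f' p = 0" by auto
    next
      fix i assume i: "i \<in> J"
      have i': "i \<le> nn S" using i J by auto
      have lt: "v - dg S i < v" using pos[OF i] False by simp
      have "van S L z J (v - dg S i) (\<lambda>p. pd S z i f p * f' p)"
        by (rule less.IH[OF lt van_pd[OF less.prems(1) i] less.prems(2)]) (use less.prems(3) in linarith)
      moreover have "van S L z J (v - dg S i) (\<lambda>p. f p * pd S z i f' p)"
        by (rule less.IH[OF lt less.prems(1) van_pd[OF less.prems(2) i]]) (use less.prems(3) in linarith)
      ultimately have "van S L z J (v - dg S i) (\<lambda>p. pd S z i f p * f' p + f p * pd S z i f' p)"
        by (rule van_add)
      then show "van S L z J (v - dg S i) (pd S z i (\<lambda>p. f p * f' p))"
        by (rule van_cong) (simp only: pd_mult[OF i' F])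
    qed
  qed
qed

lemma van_power:
  assumes pos: "\<And>i. i \<in> J \<Longrightarrow> dg S i > 0" and f: "van S L z J w f"
  shows "van S L z J (w * k) (\<lambda>p. f p ^ k)"
proof (induction k)
  case (Suc k)
  then show ?case
    using van_mult[OF pos f Suc, of "w * Suc k"] by simp
qed (simp add: van_0)

lemma van_prod:
  assumes pos: "\<And>i. i \<in> J \<Longrightarrow> dg S i > 0" and "finite A" "\<And>a. a \<in> A \<Longrightarrow> van S L z J (w a) (F a)"
  shows "van S L z J (\<Sum>a\<in>A. w a) (\<lambda>p. \<Prod>a\<in>A. F a p)"
  using assms(2,3)
proof (induction A rule: finite_induct)
  case (insert a A)
  then have "van S L z J (w a + (\<Sum>a\<in>A. w a)) (\<lambda>p. F a p * (\<Prod>a\<in>A. F a p))"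
    by (intro van_mult[OF pos, of "w a" _ "\<Sum>a\<in>A. w a"]) auto
  then show ?case using insert by simp
qed (simp add: van_0)

lemma van_mono_fun:
  assumes "\<And>i. i \<in> J \<Longrightarrow> dg S i > 0" and "\<And>i. i \<in> {1..nn S} \<Longrightarrow> van S L z J (dg S i) (F i)"
  shows "van S L z J (ddot S b) (mono_fun (nn S) F b)"
  unfolding mono_fun_def ddot_def
proof (rule van_prod)
  fix i assume "i \<in> {1..nn S}"
  then show "van S L z J (dg S i * b i) (\<lambda>p. F i p ^ b i)"
    by (intro van_power assms)
qed (auto intro: assms(1))

text \<open>A coordinate outside \<open>J\<close> has infinite order: no derivative in the
  directions of \<open>J\<close> sees it. This is what setting z^n = 0 amounts to.\<close>

lemma van_coord:
  assumes j: "j \<in> {1..nn S}"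
  shows "van S L z J (dg S j) (Z j)"
    and "j \<notin> J \<Longrightarrow> van S L z J w (Z j)"
proof -
  have *: "van S L z J w (Z j)" if w: "j \<in> J \<Longrightarrow> w \<le> dg S j" for w
  proof (rule vanI)
    show "Z j p = 0" if "p \<in> Lperp S L" for p
      using coord_Lperp[OF j that] .
    fix i assume i: "i \<in> J"
    have "pd S z i (Z j) = (\<lambda>_. if i = j then 1 else 0)"
      by (rule ext, rule pd_coord) (use i J j in auto)
    moreover have "van S L z J (w - dg S i) (\<lambda>_. if i = j then 1 else 0)"
      using w i van_zero by (auto intro!: van_0)
    ultimately show "van S L z J (w - dg S i) (pd S z i (Z j))" by simp
  qed auto
  show "van S L z J (dg S j) (Z j)" by (rule *) simp
  show "j \<notin> J \<Longrightarrow> van S L z J w (Z j)" by (rule *) simp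
qed

text \<open>The vector \<open>e 0\<close> kills L, so the derivative in z^0 runs along
  \<open>Lperp\<close>, where the Taylor coefficients in question vanish identically. Thus z^0 has
  weight 0.\<close>

lemma van_pd0:
  assumes f: "van S L z J w f"
  shows "van S L z J w (pd S z 0 f)"
  unfolding van_def
proof (intro conjI allI impI ballI)
  show "pd S z 0 f \<in> FY S" using FY_pd[OF van_FY[OF f]] by simp
  fix b p assume b: "supp_in J b" "ddot S b < w" and p: "p \<in> Lperp S L"
  define h where "h = mpd S z b f"
  have h: "h \<in> FY S" "\<And>p. p \<in> Lperp S L \<Longrightarrow> h p = 0"
    using f b by (auto simp: h_def van_def FY_mpd)
  have e0: "blinfun_apply (e 0) (va S) = 0" using e_va by simp
  have "mpd S z b (pd S z 0 f) p = pd S z 0 h p"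
    unfolding h_def by (rule mpd_pd[OF van_FY[OF f] _ Lperp_Y[OF p]]) simp
  also have "\<dots> = dir_deriv (e 0) h p" by (simp add: pd_eq_dir_deriv)
  also have "\<dots> = deriv (\<lambda>t. h (p + hsc t (e 0))) 0" by (simp add: dir_deriv_def)
  also have "\<dots> = deriv (\<lambda>t. 0) 0"
  proof (rule deriv_cong_ev)
    define U where "U = {t. Re (blinfun_apply p (vdelta S) + t * blinfun_apply (e 0) (vdelta S)) > 0}"
    have "open U" unfolding U_def
      by (intro open_Collect_less continuous_intros)
    moreover have "0 \<in> U" using Lperp_Y[OF p] by (simp add: U_def Y_def)
    ultimately have "\<forall>\<^sub>F t in nhds 0. t \<in> U" by (simp add: eventually_nhds_in_open)
    then show "\<forall>\<^sub>F t in nhds 0. h (p + hsc t (e 0)) = 0"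
    proof eventually_elim
      case (elim t)
      then have "p + hsc t (e 0) \<in> Y S"
        using Y_shift_iff[OF Lperp_Y[OF p] e0] by (simp add: U_def)
      then have "p + hsc t (e 0) \<in> Lperp S L"
        using p e0_L by (auto simp: Lperp_def blinfun.add_left)
      then show ?case by (rule h(2))
    qed
  qed simp
  finally show "mpd S z b (pd S z 0 f) p = 0" by simp
qed

end

lemma van_Lperp:
  assumes "van S L z J w f" "w > 0" "p \<in> Lperp S L"
  shows "f p = 0"
proof -
  have "mpd S z (\<lambda>_. 0) f p = 0"
    using assms unfolding van_def by (metis ddot_zero supp_in_zero)
  then show ?thesis by (simp only: mpd_zero)
qed

lemma van_subset: "van S L z J w f \<Longrightarrow> J' \<subseteq> J \<Longrightarrow> van S L z J' w f"
  using supp_in_mono[of J' _ J] by (auto simp: van_def)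

text \<open>Subtracting the weight \<open>m\<close> part of the Taylor expansion raises the order by
  one: the coefficients are constant on fibres and pass through the derivatives, and
  \<open>mpd_mono_fun\<close> picks out one term. The sum has the shape of \<open>psi_mono\<close>,
  which is how \<psi> takes leading parts.\<close>

lemma van_taylor:
  assumes pos: "\<And>i. i \<in> {1..nn S} \<Longrightarrow> dg S i > 0" and f: "van S L z {1..nn S} m f"
  shows "van S L z {1..nn S} (m + 1) (\<lambda>p. f p - (\<Sum>b | b \<in> midx (nn S) \<and> ddot S b = m.
     1 / of_nat (mfact (nn S) b) * res S L (mpd S z b f) p * mono_fun (nn S) Z b p))"
proof -
  let ?B = "{b. b \<in> midx (nn S) \<and> ddot S b = m}"
  let ?n = "nn S"
  define C where "C = (\<lambda>b p. 1 / of_nat (mfact ?n b) * mpd S z b f (proj p))"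
  have fin: "finite ?B" by (rule finite_ddot_eq[OF pos])
  have F: "f \<in> FY S" using f by (simp add: van_def)
  have C: "fibre_const (C b)" for b
    unfolding C_def
    by (rule fibre_constI) (intro FY_mult FY_const FY_res FY_mpd F, simp only: proj_id proj_Lperp)
  have CY: "C b \<in> FY S" for b using C[of b] by (simp add: fibre_const_def)
  have mY: "mono_fun ?n Z b \<in> FY S" for b by (rule FY_mono_fun) auto
  have "van S L z {1..?n} (m + 1) (\<lambda>p. f p - (\<Sum>b\<in>?B. C b p * mono_fun ?n Z b p))"
    unfolding van_def
  proof (intro conjI allI impI ballI)
    show "(\<lambda>p. f p - (\<Sum>b\<in>?B. C b p * mono_fun ?n Z b p)) \<in> FY S"
      by (intro FY_diff FY_sum FY_mult F CY mY)
    fix c p assume "supp_in {1..?n} c" and cm: "ddot S c < m + 1" and p: "p \<in> Lperp S L"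
    then have c: "c \<in> midx ?n" by (simp add: midx_eq)
    note pY = Lperp_Y[OF p]
    have "mpd S z c (\<lambda>p. f p - (\<Sum>b\<in>?B. C b p * mono_fun ?n Z b p)) p =
       mpd S z c f p - mpd S z c (\<lambda>p. \<Sum>b\<in>?B. C b p * mono_fun ?n Z b p) p"
      by (rule mpd_diff[OF c F _ pY]) (intro FY_sum FY_mult CY mY)
    also have "mpd S z c (\<lambda>p. \<Sum>b\<in>?B. C b p * mono_fun ?n Z b p) p =
      (\<Sum>b\<in>?B. mpd S z c (\<lambda>p. C b p * mono_fun ?n Z b p) p)"
      by (rule mpd_sum[OF fin c _ pY]) (intro FY_mult CY mY)
    also have "\<dots> = (\<Sum>b\<in>?B. if b = c then mpd S z b f p else 0)"
    proof (rule sum.cong[OF refl])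
      fix b assume b: "b \<in> ?B"
      have "mpd S z c (\<lambda>p. C b p * mono_fun ?n Z b p) p = C b p * mpd S z c (mono_fun ?n Z b) p"
        by (rule mpd_mult_left[OF c C mY pY])
      also have "mpd S z c (mono_fun ?n Z b) p = (if b = c then of_nat (mfact ?n b) else 0)"
        by (rule mpd_mono_fun[OF c _ p]) (use b in simp)
      finally show "mpd S z c (\<lambda>p. C b p * mono_fun ?n Z b p) p = (if b = c then mpd S z b f p else 0)"
        by (simp add: C_def proj_id[OF p] mfact_def)
    qed
    also have "\<dots> = (if c \<in> ?B then mpd S z c f p else 0)"
      by (rule sum.delta[OF fin])
    also have "mpd S z c f p - \<dots> = 0"
    proof (cases "ddot S c = m")
      case True
      then show ?thesis using c by simp
    next
      case False
      then show ?thesis using f cm p c unfolding van_def by (simp add: midx_eq)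
    qed
    finally show "mpd S z c (\<lambda>p. f p - (\<Sum>b\<in>?B. C b p * mono_fun ?n Z b p)) p = 0" .
  qed
  then show ?thesis
    by (rule van_cong[OF order_refl]) (simp add: C_def res_eq)
qed

end

text \<open>Each derivative in the new coordinates is a combination of derivatives of the same
  weight in the old ones, so both sides lose the same weight and induction on \<open>m\<close>
  applies.\<close>

lemma van_base_change:
  assumes z: "taylor_coordinates S z e L" and w: "taylor_coordinates S w f L"
    and f: "\<And>i. i \<in> {1..nn S} \<Longrightarrow> f i = (\<Sum>j\<in>{1..nn S}. hsc (B i j) (e j))"
    and B: "\<And>i j. i \<in> {1..nn S} \<Longrightarrow> j \<in> {1..nn S} \<Longrightarrow> B i j \<noteq> 0 \<Longrightarrow> dg S j = dg S i"
    and pos: "\<And>i. i \<in> {1..nn S} \<Longrightarrow> dg S i > 0"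
    and F: "van S L z {1..nn S} m F"
  shows "van S L w {1..nn S} m F"
  using F
proof (induction m arbitrary: F rule: less_induct)
  case (less m)
  interpret z: taylor_coordinates S z e L by (rule z)
  interpret w: taylor_coordinates S w f L by (rule w)
  note FY = z.van_FY[OF order_refl less.prems]
  show ?case
  proof (cases "m = 0")
    case True
    then show ?thesis using w.van_0[OF order_refl FY] by simp
  next
    case False
    show ?thesis
    proof (rule w.vanI[OF order_refl FY])
      fix p assume "p \<in> Lperp S L"
      then have "mpd S z (\<lambda>_. 0) F p = 0"
        using less.prems False unfolding van_def by (metis ddot_zero supp_in_zero gr0I)
      then show "F p = 0" by (simp only: z.mpd_zero)
    next
      fix i assume i: "i \<in> {1..nn S}"
      have "van S L z {1..nn S} (m - dg S i) (\<lambda>p. \<Sum>j\<in>{1..nn S}. B i j * pd S z j F p)"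
      proof (rule z.van_sum[OF order_refl])
        fix j assume j: "j \<in> {1..nn S}"
        show "van S L z {1..nn S} (m - dg S i) (\<lambda>p. B i j * pd S z j F p)"
        proof (cases "B i j = 0")
          case True
          then show ?thesis using z.van_zero[OF order_refl] by simp
        next
          case False
          then have "van S L z {1..nn S} (m - dg S i) (pd S z j F)"
            using z.van_pd[OF order_refl less.prems j] B[OF i j] by simp
          then show ?thesis
            using z.van_mult_left[OF order_refl z.fibre_const_const] by blast
        qed
      qed
      then have "van S L z {1..nn S} (m - dg S i) (pd S w i F)"
      proof (rule z.van_cong[OF order_refl])
        fix p assume p: "p \<in> Y S"
        have "pd S w i F p = dir_deriv (\<Sum>j\<in>{1..nn S}. hsc (B i j) (e j)) F p"
          using i by (simp only: w.pd_eq_dir_deriv f[OF i] atLeastAtMost_iff)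
        also have "\<dots> = (\<Sum>j\<in>{1..nn S}. dir_deriv (hsc (B i j) (e j)) F p)"
          by (rule dir_deriv_sum_arg[OF FY p]) (use z.e_va in auto)
        also have "\<dots> = (\<Sum>j\<in>{1..nn S}. B i j * pd S z j F p)"
          by (intro sum.cong refl) (use dir_deriv_hsc[OF FY p] z.e_va z.pd_eq_dir_deriv in auto)
        finally show "(\<Sum>j\<in>{1..nn S}. B i j * pd S z j F p) = pd S w i F p" by simp
      qed
      then show "van S L w {1..nn S} (m - dg S i) (pd S w i F)"
        by (rule less.IH[rotated]) (use False pos[OF i] in simp)
    qed
  qed
qed

locale equivariant_coordinates = taylor_coordinates S z e L
  for S :: "'v::euclidean_space elliptic" and z e L +
  fixes g :: "'v \<Rightarrow> 'v" and \<zeta> :: complex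
  assumes pull_Y: "p \<in> Y S \<Longrightarrow> pull g p \<in> Y S"
    and pull_vdelta: "p \<in> Y S \<Longrightarrow> blinfun_apply (pull g p) (vdelta S) = blinfun_apply p (vdelta S)"
    and pull_Lperp: "p \<in> Lperp S L \<Longrightarrow> pull g p = p"
    and pull_e: "i \<in> {1..nn S} \<Longrightarrow> pull g (e i) = hsc (\<zeta> ^ dg S i) (e i)"
begin

text \<open>Each differentiation in direction \<open>e i\<close> brings out a factor \<zeta>^d_i;
  the parameter \<kappa> accumulates these factors during the induction.\<close>

lemma mpd_pull:
  assumes "b \<in> midx (nn S)" "f \<in> FY S" "\<And>p. p \<in> Y S \<Longrightarrow> \<kappa> * f (pull g p) = \<mu> * f p" "p \<in> Y S"
  shows "\<kappa> * \<zeta> ^ ddot S b * mpd S z b f (pull g p) = \<mu> * mpd S z b f p"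
  using assms
proof (induction b arbitrary: f \<kappa> rule: midx_induct)
  case (inc b i)
  have i: "i \<le> nn S" using inc by simp
  have "\<kappa> * \<zeta> ^ dg S i * pd S z i f (pull g q) = \<mu> * pd S z i f q" if q: "q \<in> Y S" for q
  proof -
    have F: "(\<lambda>p. \<mu> * f p) \<in> FY S" using inc by auto
    have "((\<lambda>t. f (pull g q + hsc t (pull g (e i)))) has_field_derivative dir_deriv (pull g (e i)) f (pull g q)) (at 0)"
      by (rule dir_deriv_at[OF inc.prems(1) pull_Y[OF q]]) (use pull_e[OF inc.hyps(2)] e_va[OF i] in simp)
    then have "((\<lambda>t. f (pull g (q + hsc t (e i)))) has_field_derivative dir_deriv (pull g (e i)) f (pull g q)) (at 0)"
      by (simp add: pull_add pull_hsc)
    then have "dir_deriv (e i) (\<lambda>p. \<kappa> * f (pull g p)) q = \<kappa> * dir_deriv (pull g (e i)) f (pull g q)"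
      by (intro dir_deriv_eqI DERIV_cmult)
    moreover have "dir_deriv (pull g (e i)) f (pull g q) = \<zeta> ^ dg S i * pd S z i f (pull g q)"
      using pull_e[OF inc.hyps(2)] dir_deriv_hsc[OF inc.prems(1) pull_Y[OF q] e_va[OF i]] pd_eq_dir_deriv[OF i] by simp
    moreover have "dir_deriv (e i) (\<lambda>p. \<kappa> * f (pull g p)) q = dir_deriv (e i) (\<lambda>p. \<mu> * f p) q"
      by (rule dir_deriv_cong[OF F q e_va[OF i], symmetric]) (simp add: inc.prems(2))
    moreover have "dir_deriv (e i) (\<lambda>p. \<mu> * f p) q = \<mu> * pd S z i f q"
      using dir_deriv_cmult[OF inc.prems(1) q e_va[OF i]] pd_eq_dir_deriv[OF i] by simp
    ultimately show ?thesis by simp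
  qed
  then have "\<kappa> * \<zeta> ^ dg S i * \<zeta> ^ ddot S b * mpd S z b (pd S z i f) (pull g p) = \<mu> * mpd S z b (pd S z i f) p"
    using inc.prems by (intro inc.IH FY_pd i) auto
  then show ?case
    using mpd_inc[OF inc.prems(1) inc.hyps(2) inc.prems(3), of b]
      mpd_inc[OF inc.prems(1) inc.hyps(2) pull_Y[OF inc.prems(3)], of b] ddot_inc[OF inc.hyps(2), of b]
    by (simp only: power_add mult_ac)
qed simp

text \<open>The transpose of \<open>g\<close> fixes \<open>Lperp\<close> pointwise, so a Taylor
  coefficient of weight k is multiplied by \<zeta>^m / \<zeta>^k while staying the same. It vanishes
  unless the two powers agree, and the order can jump over all weights of the wrong residue.\<close>

lemma van_improve:
  assumes J: "J \<subseteq> {1..nn S}" and f: "van S L z J w f" and eq: "\<And>p. p \<in> Y S \<Longrightarrow> f (pull g p) = \<zeta> ^ m * f p"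
    and ne: "\<And>k. w \<le> k \<Longrightarrow> k < w' \<Longrightarrow> \<zeta> ^ k \<noteq> \<zeta> ^ m"
  shows "van S L z J w' f"
  unfolding van_def
proof (intro conjI allI impI ballI)
  show F: "f \<in> FY S" by (rule van_FY[OF J f])
  fix b p assume b: "supp_in J b" "ddot S b < w'" and p: "p \<in> Lperp S L"
  show "mpd S z b f p = 0"
  proof (cases "ddot S b < w")
    case True
    then show ?thesis using f b p by (simp add: van_def)
  next
    case False
    have "1 * \<zeta> ^ ddot S b * mpd S z b f (pull g p) = \<zeta> ^ m * mpd S z b f p"
      by (rule mpd_pull[OF supp_midx[OF J b(1)] F _ Lperp_Y[OF p]]) (simp add: eq)
    then have "(\<zeta> ^ ddot S b - \<zeta> ^ m) * mpd S z b f p = 0"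
      by (simp add: pull_Lperp[OF p] algebra_simps)
    then show ?thesis using ne[of "ddot S b"] False b by auto
  qed
qed

end

section \<open>Exponents and isometries\<close>

text \<open>For two non-orthogonal roots the ratio of squared lengths is a quotient of Cartan
  integers. Hence the roots commensurable with \<alpha> are orthogonal to all others, and
  irreducibility leaves no others.\<close>

lemma form_ratio_rational:
  assumes S: "elliptic_root_system S" and sym: "\<And>u v. form S u v = form S v u"
    and bil: "bilinear (form S)"
    and \<alpha>: "\<alpha> \<in> roots S" and \<beta>: "\<beta> \<in> roots S"
  shows "form S \<beta> \<beta> / form S \<alpha> \<alpha> \<in> \<rat>"
proof -
  define R1 where "R1 = {\<beta> \<in> roots S. form S \<beta> \<beta> / form S \<alpha> \<alpha> \<in> \<rat>}"
  have nz: "form S \<gamma> \<gamma> \<noteq> 0" if "\<gamma> \<in> roots S" for \<gamma>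
    using S that by (auto simp: elliptic_root_system_def)
  have int: "2 * form S \<gamma> \<gamma>' / form S \<gamma>' \<gamma>' \<in> \<int>" if "\<gamma> \<in> roots S" "\<gamma>' \<in> roots S" for \<gamma> \<gamma>'
  proof -
    have "form S \<gamma> (coroot S \<gamma>') \<in> \<int>"
      using S that by (auto simp: elliptic_root_system_def)
    then show ?thesis by (simp add: coroot_def bilinear_rmul[OF bil])
  qed
  have perp: "form S \<gamma> \<gamma>' = 0" if "\<gamma> \<in> R1" "\<gamma>' \<in> roots S - R1" for \<gamma> \<gamma>'
  proof (rule ccontr)
    assume ne: "form S \<gamma> \<gamma>' \<noteq> 0"
    have r: "\<gamma> \<in> roots S" "\<gamma>' \<in> roots S" using that by (auto simp: R1_def)
    have q: "2 * form S \<gamma> \<gamma>' / form S \<gamma>' \<gamma>' \<in> \<rat>" "2 * form S \<gamma>' \<gamma> / form S \<gamma> \<gamma> \<in> \<rat>"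
      using int r Ints_subset_Rats by blast+
    have q': "form S \<gamma> \<gamma> / form S \<alpha> \<alpha> \<in> \<rat>" using that by (simp add: R1_def)
    have eq: "(2 * form S \<gamma>' \<gamma> / form S \<gamma> \<gamma>) / (2 * form S \<gamma> \<gamma>' / form S \<gamma>' \<gamma>') * (form S \<gamma> \<gamma> / form S \<alpha> \<alpha>) =
        form S \<gamma>' \<gamma>' / form S \<alpha> \<alpha>"
      using ne nz[OF r(1)] nz[OF r(2)] nz[OF \<alpha>] sym[of \<gamma>' \<gamma>] by (simp add: field_simps)
    have "form S \<gamma>' \<gamma>' / form S \<alpha> \<alpha> \<in> \<rat>"
      unfolding eq[symmetric] by (rule Rats_mult[OF Rats_divide[OF q(2,1)] q'])
    then show False using that r by (simp add: R1_def)
  qed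
  have conn: "\<And>R1 R2. roots S = R1 \<union> R2 \<and> (\<forall>\<alpha>\<in>R1. \<forall>\<beta>\<in>R2. form S \<alpha> \<beta> = 0) \<longrightarrow> R1 = {} \<or> R2 = {}"
    using S by (auto simp: elliptic_root_system_def)
  have "R1 = {} \<or> roots S - R1 = {}"
  proof (rule conn[THEN mp], intro conjI ballI)
    show "roots S = R1 \<union> (roots S - R1)" by (auto simp: R1_def)
  qed (rule perp)
  moreover have "\<alpha> \<in> R1" using \<alpha> nz[OF \<alpha>] by (simp add: R1_def)
  ultimately show ?thesis using \<beta> by (auto simp: R1_def)
qed

lemma common_denominator:
  assumes "finite I" "\<And>i. i \<in> I \<Longrightarrow> r i \<in> \<rat>"
  shows "\<exists>D::nat. D > 0 \<and> (\<forall>i\<in>I. of_nat D * (r i :: real) \<in> \<int>)"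
  using assms
proof (induction I rule: finite_induct)
  case (insert i I)
  then obtain D :: nat where D: "D > 0" "\<And>i. i \<in> I \<Longrightarrow> of_nat D * r i \<in> \<int>" by auto
  obtain a b :: int where ab: "b > 0" "r i = of_int a / of_int b"
    using insert.prems[of i] by (auto elim: Rats_cases')
  have "of_nat (D * nat b) * r j \<in> \<int>" if "j \<in> insert i I" for j
  proof (cases "j = i")
    case True
    have "of_nat (D * nat b) * r j = of_int (int D * a)" using ab True by simp
    then show ?thesis by (simp only: Ints_of_int)
  next
    case False
    then have "of_nat D * r j \<in> \<int>" using that D by auto
    then have "of_nat (nat b) * (of_nat D * r j) \<in> \<int>" by (rule Ints_mult[OF Ints_of_nat])
    then show ?thesis by (simp add: mult_ac)
  qed
  then show ?case using D(1) ab(1) by (intro exI[of _ "D * nat b"]) auto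
qed auto

text \<open>The positivity of d_n comes from the triplet, as the order of the primitive root
  \<zeta>; it forces \<open>mmax\<close> to be nonzero.\<close>

locale codim_one_setting =
  fixes S :: "'v::euclidean_space elliptic"
  assumes setting: "elliptic_setting S"
    and codim: "codim_one S"
    and dg_top_pos: "dg S (nn S) > 0"
begin

lemma root_system: "elliptic_root_system S"
  and marking: "marking S"
  and hyperbolic: "hyperbolic_extension S"
  and simple_lifts: "simple_lifts S"
  using setting by (auto simp: elliptic_setting_def)

lemma bil: "bilinear (form S)"
  and sym: "form S u v = form S v u"
  and form_va: "form S (va S) u = 0"
  and DIM: "DIM('v) = rk S + 3"
proof -
  show "bilinear (form S)" "form S u v = form S v u" "DIM('v) = rk S + 3"
    using hyperbolic by (auto simp: hyperbolic_extension_def)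
  have "va S \<in> {v. \<forall>u. form S v u = 0}"
    using hyperbolic span_base[of "va S" "{va S}"] by (simp add: hyperbolic_extension_def)
  then show "form S (va S) u = 0" by simp
qed

text \<open>The number \<open>K\<close> absorbs (I_R : I) and the squared length of one root; what
  is left is rational by \<open>form_ratio_rational\<close>. Nothing is said about the sign of
  \<open>K\<close>.\<close>

lemma expo_cases:
  obtains K where "\<And>i. i \<le> rk S \<Longrightarrow> \<exists>q\<in>\<rat>. q \<ge> 0 \<and> expo S i = K * q"
proof
  let ?\<alpha> = "simp_lift S"
  let ?m = "\<lambda>j. IRI S * form S (?\<alpha> j) (?\<alpha> j) * of_nat (lab S j) / (2 * of_nat (kk S (?\<alpha> j)))"
  fix i assume i: "i \<le> rk S"
  let ?xs = "map ?m [0..<rk S + 1]"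
  have "sort ?xs ! i \<in> set (sort ?xs)"
    by (rule nth_mem) (use i in \<open>simp only: length_sort length_map length_upt\<close>)
  then have "expo S i \<in> ?m ` set [0..<rk S + 1]"
    by (simp only: expo_def set_sort set_map)
  then obtain j where "expo S i = ?m j" "j \<in> set [0..<rk S + 1]" by (rule imageE)
  then have j: "j \<le> rk S" "expo S i = ?m j" by (simp_all only: set_upt) auto
  have r: "?\<alpha> j \<in> roots S" "?\<alpha> 0 \<in> roots S"
    using simple_lifts j by (auto simp: simple_lifts_def)
  have nz: "form S v v > 0" if "v \<in> roots S" for v
    using root_system that unfolding elliptic_root_system_def by (metis order_le_less subsetD)
  let ?q = "form S (?\<alpha> j) (?\<alpha> j) / form S (?\<alpha> 0) (?\<alpha> 0) * (of_nat (lab S j) / (2 * of_nat (kk S (?\<alpha> j))))"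
  have "?q \<in> \<rat>"
    by (rule Rats_mult[OF form_ratio_rational[OF root_system sym bil r(2,1)] Rats_divide]) auto
  moreover have "?q \<ge> 0" using nz[OF r(1)] nz[OF r(2)] by simp
  moreover have "expo S i = IRI S * form S (?\<alpha> 0) (?\<alpha> 0) * ?q"
    using nz[OF r(2)] j(2) by simp
  ultimately show "\<exists>q\<in>\<rat>. q \<ge> 0 \<and> expo S i = (IRI S * form S (?\<alpha> 0) (?\<alpha> 0)) * q" by blast
qed

lemma expo_ratio:
  assumes "i \<le> rk S"
  shows "expo S i / mmax S \<in> \<rat>" "expo S i / mmax S \<ge> 0"
proof -
  obtain K where K: "\<And>i. i \<le> rk S \<Longrightarrow> \<exists>q\<in>\<rat>. q \<ge> 0 \<and> expo S i = K * q"
    using expo_cases by blast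
  obtain q where q: "q \<in> \<rat>" "q \<ge> 0" "expo S i = K * q" using K[OF assms] by auto
  obtain q' where q': "q' \<in> \<rat>" "q' \<ge> 0" "mmax S = K * q'" using K[of "rk S"] by (auto simp: mmax_def)
  \<comment> \<open>The case \<open>K = 0\<close>, and likewise \<open>q' = 0\<close>, is covered by
    the convention that division by zero gives 0.\<close>
  have "expo S i / mmax S = (if K = 0 then 0 else q / q')" using q(3) q'(3) by simp
  then show "expo S i / mmax S \<in> \<rat>" "expo S i / mmax S \<ge> 0"
    using q q' by (auto intro: Rats_divide)
qed

text \<open>The exponent ratios are rational, so a common denominator exists and the
  \<open>LEAST\<close> in \<open>dtop\<close> has its defining property.\<close>

lemma dtop: "dtop S > 0" "\<And>i. i \<le> rk S \<Longrightarrow> of_nat (dtop S) * (expo S i / mmax S) \<in> \<int>"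
proof -
  have "\<exists>D::nat. D > 0 \<and> (\<forall>i\<in>{..rk S}. of_nat D * (expo S i / mmax S) \<in> \<int>)"
    by (rule common_denominator) (use expo_ratio(1) in auto)
  then have "\<exists>D::nat. D > 0 \<and> (\<forall>i\<le>rk S. of_nat D * (expo S i / mmax S) \<in> \<int>)" by auto
  then have "dtop S > 0 \<and> (\<forall>i\<le>rk S. of_nat (dtop S) * (expo S i / mmax S) \<in> \<int>)"
    unfolding dtop_def by (rule LeastI_ex)
  then show "dtop S > 0" "\<And>i. i \<le> rk S \<Longrightarrow> of_nat (dtop S) * (expo S i / mmax S) \<in> \<int>"
    by auto
qed

lemma dg_zero [simp]: "dg S 0 = 0"
  by (simp add: dg_def)

lemma real_dg:
  assumes "\<alpha> \<in> {1..nn S}"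
  shows "real (dg S \<alpha>) = expo S (\<alpha> - 1) / mmax S * of_nat (dtop S)"
proof -
  have i: "\<alpha> - 1 \<le> rk S" "\<alpha> \<noteq> 0" using assms by auto
  define r where "r = expo S (\<alpha> - 1) / mmax S * of_nat (dtop S)"
  have "r \<in> \<int>" "r \<ge> 0"
    using dtop(2)[OF i(1)] mult_nonneg_nonneg[OF expo_ratio(2)[OF i(1)] of_nat_0_le_iff]
    by (simp_all only: r_def mult.commute)
  then have "real (nat \<lfloor>r\<rfloor>) = r" by (auto elim!: Ints_cases)
  moreover have "dg S \<alpha> = nat \<lfloor>r\<rfloor>" using i by (simp add: dg_def r_def)
  ultimately show ?thesis by (simp add: r_def)
qed

lemma mmax_nz: "mmax S \<noteq> 0"
  using real_dg[of "nn S"] dg_top_pos by auto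

lemma dg_top: "dg S (nn S) = dtop S"
proof -
  have "expo S (nn S - 1) = mmax S" by (simp add: mmax_def)
  then show ?thesis using real_dg[of "nn S"] mmax_nz by simp
qed

lemma expo_eq_dg:
  assumes "\<alpha> \<in> {1..nn S}"
  shows "expo S (\<alpha> - 1) = mmax S * of_nat (dg S \<alpha>) / of_nat (dg S (nn S))"
  using real_dg[OF assms] dtop(1) mmax_nz unfolding dg_top by (simp add: field_simps)

lemma rk_pos: "rk S \<ge> 1"
  using root_system by (simp add: elliptic_root_system_def)

lemma expo_mono: "i \<le> j \<Longrightarrow> j \<le> rk S \<Longrightarrow> expo S i \<le> expo S j"
  unfolding expo_def by (rule sorted_nth_mono) (simp_all only: sorted_sort length_sort length_map length_upt)

text \<open>The sign of \<^const>\<open>IRI\<close>, a least element of a set of reals, has not been determined, and a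
  negative value would reverse the order of the exponents; codimension one excludes this.\<close>

lemma mmax_pos: "mmax S > 0"
proof (rule ccontr)
  assume "\<not> mmax S > 0"
  then have neg: "mmax S < 0" using mmax_nz by simp
  have le: "expo S (rk S - 1) \<le> mmax S" unfolding mmax_def by (rule expo_mono) auto
  have r: "nn S - 1 \<in> {1..nn S}" using rk_pos by auto
  have "real (dg S (nn S)) = of_nat (dtop S)" by (simp only: dg_top)
  also have "\<dots> \<le> expo S (rk S - 1) / mmax S * of_nat (dtop S)"
    using mult_right_mono[of 1 "expo S (rk S - 1) / mmax S" "real (dtop S)"] le neg
    by (simp add: neg_le_divide_eq)
  also have "\<dots> = real (dg S (nn S - 1))" using real_dg[OF r] by simp
  finally show False using codim by (simp add: codim_one_def)
qed

lemma dg_mono: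
  assumes "\<alpha> \<le> \<beta>" "\<beta> \<le> nn S"
  shows "dg S \<alpha> \<le> dg S \<beta>"
proof (cases "\<alpha> = 0")
  case False
  have "expo S (\<alpha> - 1) \<le> expo S (\<beta> - 1)" by (rule expo_mono) (use assms in auto)
  then have "real (dg S \<alpha>) \<le> real (dg S \<beta>)"
    using assms False mmax_pos by (subst (1 2) real_dg) (auto intro!: mult_right_mono divide_right_mono)
  then show ?thesis by simp
qed simp

lemma dg_lt_top:
  assumes "\<alpha> < nn S"
  shows "dg S \<alpha> < dg S (nn S)"
proof -
  have "dg S \<alpha> \<le> dg S (nn S - 1)" by (rule dg_mono) (use assms in auto)
  also have "\<dots> < dg S (nn S)" using codim by (simp only: codim_one_def)
  finally show ?thesis .
qed

lemma dg_le_top: "\<alpha> \<le> nn S \<Longrightarrow> dg S \<alpha> \<le> dg S (nn S)"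
  by (rule dg_mono) auto

section \<open>The radical and the isometries that fix it\<close>

lemma subspace_Fsp: "subspace (Fsp S)" and dim_Fsp: "dim (Fsp S) = rk S + 2"
  and roots_Fsp: "roots S \<subseteq> Fsp S"
  using root_system by (auto simp: elliptic_root_system_def)

lemma vdelta_radF: "vdelta S \<in> radF S" and va_radF: "va S \<in> radF S"
proof -
  have "of_int 0 *\<^sub>R va S + of_int 1 *\<^sub>R vdelta S \<in> QR S \<inter> radF S"
    using marking unfolding marking_def by blast
  then show "vdelta S \<in> radF S" by simp
  show "va S \<in> radF S" using marking by (simp add: marking_def)
qed

lemma radF_eq: "radF S = span {va S, vdelta S}"
proof
  have ss: "subspace (radF S)"
    unfolding radF_def subspace_def
    using subspace_Fsp bilinear_ladd[OF bil] bilinear_lmul[OF bil] bilinear_lzero[OF bil]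
    by (auto simp: subspace_def)
  show "span {va S, vdelta S} \<subseteq> radF S"
    by (rule span_minimal[OF _ ss]) (use va_radF vdelta_radF in auto)
  have c: "card {va S, vdelta S} = 2" using marking by (simp add: marking_def)
  have "dim (radF S) = 2" using root_system by (auto simp: elliptic_root_system_def)
  then show "radF S \<subseteq> span {va S, vdelta S}"
    using card_ge_dim_independent[of "{va S, vdelta S}" "radF S"] va_radF vdelta_radF marking c
    by (simp only: marking_def) auto
qed

lemma form_vdelta: "v \<in> Fsp S \<Longrightarrow> form S v (vdelta S) = 0"
  using vdelta_radF sym by (auto simp: radF_def)

lemma vdelta_nz: "vdelta S \<noteq> 0"
  using marking dependent_zero[of "{va S, vdelta S}"] by (auto simp: marking_def)

text \<open>Common ground of the elliptic Weyl group and of \<open>g\<close>. Fixing a and \<delta>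
  makes the transpose preserve Y and the projection \<pi>.\<close>

definition isom :: "('v \<Rightarrow> 'v) \<Rightarrow> bool" where
  "isom w \<longleftrightarrow> linear w \<and> bij w \<and> (\<forall>u v. form S (w u) (w v) = form S u v) \<and>
     w (va S) = va S \<and> w (vdelta S) = vdelta S"

lemma isom_refl:
  assumes "\<alpha> \<in> roots S"
  shows "isom (refl S \<alpha>)"
proof -
  have nz: "form S \<alpha> \<alpha> \<noteq> 0" using root_system assms by (auto simp: elliptic_root_system_def)
  have r: "refl S \<alpha> u = u - (2 * form S u \<alpha> / form S \<alpha> \<alpha>) *\<^sub>R \<alpha>" for u
    by (simp add: refl_def coroot_def bilinear_rmul[OF bil])
  have lin: "linear (refl S \<alpha>)"
    by (rule linearI) (simp_all add: r bilinear_ladd[OF bil] bilinear_lmul[OF bil] algebra_simps add_divide_distrib)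
  have inv: "refl S \<alpha> (refl S \<alpha> u) = u" for u
    using nz by (simp add: r bilinear_lsub[OF bil] bilinear_lmul[OF bil] algebra_simps)
  then have "bij (refl S \<alpha>)" by (metis bijI' )
  moreover have "form S (refl S \<alpha> u) (refl S \<alpha> v) = form S u v" for u v
    using nz sym[of \<alpha> v] sym[of \<alpha> u]
    by (simp add: r bilinear_lsub[OF bil] bilinear_lmul[OF bil] bilinear_rsub[OF bil] bilinear_rmul[OF bil] field_simps)
  moreover have "refl S \<alpha> (va S) = va S" by (simp add: r form_va)
  moreover have "form S (vdelta S) \<alpha> = 0"
    using form_vdelta[of \<alpha>] assms roots_Fsp sym[of \<alpha>] by auto
  then have "refl S \<alpha> (vdelta S) = vdelta S" by (simp add: r)
  ultimately show ?thesis using lin by (simp add: isom_def)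
qed

lemma isom_Weyl: "w \<in> Weyl S \<Longrightarrow> isom w"
proof (induction rule: Weyl.induct)
  case one
  then show ?case by (simp add: isom_def linear_id[unfolded id_def] id_def linear_iff bij_id[unfolded id_def])
next
  case (step \<alpha> w)
  then show ?case
    using isom_refl[OF step.hyps(1)] unfolding isom_def by (intro conjI linear_compose bij_comp) auto
qed

lemma isom_ortho: "w \<in> ortho_group S \<Longrightarrow> isom w"
  using va_radF vdelta_radF by (auto simp: ortho_group_def isom_def)

lemma pull_isom:
  assumes "isom w"
  shows pull_isom_Y: "p \<in> Y S \<Longrightarrow> pull w p \<in> Y S"
    and pull_isom_va: "blinfun_apply (pull w p) (va S) = blinfun_apply p (va S)"
    and pull_isom_vdelta: "blinfun_apply (pull w p) (vdelta S) = blinfun_apply p (vdelta S)"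
    and act_isom: "act_fun w f p = f (pull w p)"
    and cpair_pull: "cpair u (pull w p) = cpair (cmap w u) p"
  using assms pull_apply[of w] act_fun_eq_pull[of w]
  by (auto simp: isom_def Y_def cpair_def cmap_def)

end

section \<open>Flat coordinates\<close>

lemma csc_simps:
  "csc (a + b) w = csc a w + csc b w" "csc a (w + w') = csc a w + csc a w'"
  "csc (a - b) w = csc a w - csc b w" "csc a (w - w') = csc a w - csc a w'"
  "csc a (csc b w) = csc (a * b) w" "csc 0 w = 0" "csc a 0 = 0" "csc 1 w = w"
  by (auto simp: csc_def prod_eq_iff algebra_simps)

lemma csc_sum_left: "csc (sum c A) w = (\<Sum>a\<in>A. csc (c a) w)"
  by (induction A rule: infinite_finite_induct) (auto simp: csc_simps)

lemma csc_sum_right: "csc c (sum W A) = (\<Sum>a\<in>A. csc c (W a))"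
  by (induction A rule: infinite_finite_induct) (auto simp: csc_simps)

lemma cmap_csc: "linear w \<Longrightarrow> cmap w (csc c u) = csc c (cmap w u)"
  by (simp add: cmap_def csc_def linear_add linear_diff linear_scale)

lemma cmap_sum:
  assumes "linear w"
  shows "cmap w (sum U A) = (\<Sum>a\<in>A. cmap w (U a))"
proof (induction A rule: infinite_finite_induct)
  case (insert a A)
  have "cmap w (U a + V) = cmap w (U a) + cmap w V" for V
    using linear_add[OF assms] by (simp add: cmap_def)
  then show ?case using insert by simp
qed (use linear_0[OF assms] in \<open>auto simp: cmap_def zero_prod_def\<close>)

lemma cspace_csc: "subspace L \<Longrightarrow> w \<in> cspace L \<Longrightarrow> csc c w \<in> cspace L"
  by (auto simp: cspace_def csc_def subspace_add subspace_diff subspace_scale)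

lemma cspace_add: "subspace L \<Longrightarrow> w \<in> cspace L \<Longrightarrow> w' \<in> cspace L \<Longrightarrow> w + w' \<in> cspace L"
  and cspace_diff: "subspace L \<Longrightarrow> w \<in> cspace L \<Longrightarrow> w' \<in> cspace L \<Longrightarrow> w - w' \<in> cspace L"
  by (auto simp: cspace_def subspace_add subspace_diff)

lemma cspace_sum: "subspace L \<Longrightarrow> (\<And>a. a \<in> A \<Longrightarrow> W a \<in> cspace L) \<Longrightarrow> sum W A \<in> cspace L"
  by (induction A rule: infinite_finite_induct)
     (auto simp: cspace_add cspace_def zero_prod_def subspace_0 subspace_add mem_Times_iff)

section \<open>Powers of a primitive root of unity\<close>

lemma primitive_root_power_eq_one:
  assumes \<zeta>: "primitive_root N \<zeta>" and "\<zeta> ^ k = 1"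
  shows "N dvd k"
proof -
  have N: "N > 0" "\<zeta> ^ N = 1" "\<And>k. 0 < k \<Longrightarrow> k < N \<Longrightarrow> \<zeta> ^ k \<noteq> 1"
    using \<zeta> by (auto simp: primitive_root_def)
  have "\<zeta> ^ k = \<zeta> ^ (N * (k div N) + k mod N)" by simp
  also have "\<dots> = \<zeta> ^ (k mod N)" by (simp only: power_add power_mult N(2) power_one mult_1)
  finally have "\<zeta> ^ (k mod N) = 1" using assms(2) by simp
  then have "k mod N = 0" using N(3)[of "k mod N"] N(1) by (metis mod_less_divisor gr0I)
  then show ?thesis by auto
qed

lemma primitive_root_power_eq:
  assumes \<zeta>: "primitive_root N \<zeta>" and "\<zeta> ^ j = \<zeta> ^ k" "j \<le> k"
  shows "N dvd k - j"
proof -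
  have "\<zeta> \<noteq> 0" using \<zeta> by (auto simp: primitive_root_def power_0_left)
  moreover have "\<zeta> ^ k = \<zeta> ^ j * \<zeta> ^ (k - j)" using assms(3) by (simp flip: power_add)
  ultimately have "\<zeta> ^ (k - j) = 1" using assms(2) by simp
  then show ?thesis by (rule primitive_root_power_eq_one[OF \<zeta>])
qed

locale flat_coordinates = codim_one_setting S
  for S :: "'v::euclidean_space elliptic" +
  fixes g :: "'v \<Rightarrow> 'v" and \<zeta> :: complex and L :: "'v set" and z :: "nat \<Rightarrow> 'v cplxfn"
  assumes triplet: "admissible S g \<zeta> L"
    and flat: "flat_basis S g \<zeta> L z"
begin

lemma isom_g: "isom g"
  and prim: "primitive_root (dg S (nn S)) \<zeta>"
  and subspace_L: "subspace L" and L_radF: "L \<inter> radF S = {0}"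
  and L_radF_span: "{u + v | u v. u \<in> L \<and> v \<in> radF S} = UNIV"
  and g_L: "g ` L = L"
  using triplet by (auto simp: admissible_def intro: isom_ortho)

lemma linear_g: "linear g"
  using isom_g by (simp add: isom_def)

lemma basis: "cbasis {0..nn S} z (cspace {u + t *\<^sub>R vdelta S | u t. u \<in> L})"
  and z_0: "z 0 = z0 S"
  and z_form: "i \<le> nn S \<Longrightarrow> j \<le> nn S \<Longrightarrow> cform S (z i) (z j) = (if i + j = nn S then 1 else 0)"
  and z_g: "i \<le> nn S \<Longrightarrow> cmap g (z i) = csc (\<zeta> ^ dg S i) (z i)"
  and z_L: "i \<in> {1..nn S} \<Longrightarrow> z i \<in> cspace L"
proof -
  show "cbasis {0..nn S} z (cspace {u + t *\<^sub>R vdelta S | u t. u \<in> L})" "z 0 = z0 S"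
    using flat unfolding flat_basis_def by blast+
  show "i \<le> nn S \<Longrightarrow> j \<le> nn S \<Longrightarrow> cform S (z i) (z j) = (if i + j = nn S then 1 else 0)"
    and "i \<le> nn S \<Longrightarrow> cmap g (z i) = csc (\<zeta> ^ dg S i) (z i)"
    using flat unfolding flat_basis_def by blast+
  assume i: "i \<in> {1..nn S}"
  have "\<forall>\<alpha>\<in>{1..nn S - 1}. z \<alpha> \<in> cspace (L \<inter> Fsp S)" "z (nn S) \<in> cspace (LFperp S L)"
    using flat unfolding flat_basis_def by blast+
  then show "z i \<in> cspace L"
    using i by (cases "i = nn S") (auto simp: cspace_def LFperp_def mem_Times_iff)
qed

lemma basis_span: "v \<in> cspace {u + t *\<^sub>R vdelta S | u t. u \<in> L} \<Longrightarrow> \<exists>c. v = (\<Sum>i\<in>{0..nn S}. csc (c i) (z i))"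
  and basis_indep: "(\<Sum>i\<in>{0..nn S}. csc (c i) (z i)) = 0 \<Longrightarrow> \<forall>i\<in>{0..nn S}. c i = 0"
proof -
  note b = basis[unfolded cbasis_def]
  show "v \<in> cspace {u + t *\<^sub>R vdelta S | u t. u \<in> L} \<Longrightarrow> \<exists>c. v = (\<Sum>i\<in>{0..nn S}. csc (c i) (z i))"
    by (rule bspec[OF b[THEN conjunct2, THEN conjunct2]])
  show "(\<Sum>i\<in>{0..nn S}. csc (c i) (z i)) = 0 \<Longrightarrow> \<forall>i\<in>{0..nn S}. c i = 0"
    by (rule b[THEN conjunct2, THEN conjunct1, THEN spec, THEN mp])
qed

lemma cform_sym: "cform S w w' = cform S w' w"
  by (simp add: cform_def sym[of "fst w"] sym[of "snd w"] add.commute)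

definition form_dual :: "'v cplxfn \<Rightarrow> ('v \<Rightarrow>\<^sub>L complex)" where
  "form_dual w = Blinfun (\<lambda>v. cform S (v, 0) w)"

lemma form_dual_apply: "blinfun_apply (form_dual w) v = cform S (v, 0) w"
proof -
  have "linear (\<lambda>v. cform S (v, 0) w)"
    by (rule linearI) (simp_all add: cform_def complex_eq_iff bilinear_ladd[OF bil] bilinear_lmul[OF bil] bilinear_lzero[OF bil])
  then show ?thesis
    by (simp add: form_dual_def linear_conv_bounded_linear bounded_linear_Blinfun_apply)
qed

lemma cpair_form_dual: "cpair u (form_dual w) = cform S u w"
  by (simp add: cpair_def form_dual_apply cform_def complex_eq_iff bilinear_lzero[OF bil])

lemma form_dual_va: "blinfun_apply (form_dual w) (va S) = 0"
  by (simp add: form_dual_apply cform_def form_va bilinear_lzero[OF bil] complex_eq_iff)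

text \<open>The Gram matrix of the flat basis is antidiagonal, so pairing with z^(n-i) is the vector
  dual to z^i. It kills a because a spans the radical.\<close>

definition e :: "nat \<Rightarrow> 'v \<Rightarrow>\<^sub>L complex" where
  "e i = form_dual (z (nn S - i))"

lemma cpair_e: "cpair w (e i) = cform S w (z (nn S - i))"
  by (simp add: e_def cpair_form_dual)

lemma flat_sep:
  assumes "blinfun_apply h (va S) = 0" "\<And>i. i \<le> nn S \<Longrightarrow> cpair (z i) h = 0"
  shows "h = 0"
proof (rule blinfun_eqI)
  fix v
  obtain u r where v: "v = u + r" "u \<in> L" "r \<in> span {va S, vdelta S}"
    using L_radF_span radF_eq by blast
  then obtain s where "r - s *\<^sub>R va S \<in> span {vdelta S}" by (auto simp: span_insert)
  then obtain t where "r - s *\<^sub>R va S = t *\<^sub>R vdelta S" by (auto simp: span_singleton)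
  then have r: "r = s *\<^sub>R va S + t *\<^sub>R vdelta S" by (simp add: algebra_simps)
  let ?V = "{u + t *\<^sub>R vdelta S | u t. u \<in> L}"
  have "0 + 0 *\<^sub>R vdelta S \<in> ?V" using subspace_0[OF subspace_L] by blast
  then have "(u + t *\<^sub>R vdelta S, 0) \<in> cspace ?V" using v(2) by (auto simp: cspace_def)
  from basis_span[OF this]
  obtain c where c: "(u + t *\<^sub>R vdelta S, 0) = (\<Sum>i\<in>{0..nn S}. csc (c i) (z i))" ..
  have "blinfun_apply h v = cpair (u + t *\<^sub>R vdelta S, 0) h"
    using assms(1) by (simp add: v(1) r cpair_def blinfun.bilinear_simps)
  also have "\<dots> = (\<Sum>i\<in>{0..nn S}. c i * cpair (z i) h)"
    by (simp only: c cpair_sum_left cpair_csc)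
  also have "\<dots> = 0"
    by (rule sum.neutral) (use assms in auto)
  finally show "blinfun_apply h v = blinfun_apply 0 v" by simp
qed

text \<open>Since 1/(-2\<pi>i) = i/(2\<pi>), the vector z^0 is a purely imaginary multiple of
  \<delta>; its real component in the pair encoding is 0.\<close>

lemma csc_z0: "csc c (z 0) = (- (Im c / (2 * pi)) *\<^sub>R vdelta S, (Re c / (2 * pi)) *\<^sub>R vdelta S)"
proof -
  have "1 / (- 2 * of_real pi * \<i>) = Complex 0 (1 / (2 * pi))"
    by (simp add: complex_eq_iff Re_divide Im_divide power2_eq_square)
  then show ?thesis
    unfolding z_0 z0_def by (simp add: csc_def)
qed

text \<open>The flat basis spans L together with \<delta>. The z^0 component of a vector of L lies
  in L and in the radical, hence is 0.\<close>

lemma basis_L: "cbasis {1..nn S} z (cspace L)"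
  unfolding cbasis_def
proof (intro conjI allI ballI impI)
  fix i assume "i \<in> {1..nn S}"
  then show "z i \<in> cspace L" by (rule z_L)
next
  fix c i assume c: "(\<Sum>i\<in>{1..nn S}. csc (c i) (z i)) = 0" and i: "i \<in> {1..nn S}"
  let ?c = "c(0 := 0)"
  have "(\<Sum>i\<in>{0..nn S}. csc (?c i) (z i)) = csc (?c 0) (z 0) + (\<Sum>i\<in>{1..nn S}. csc (?c i) (z i))"
    by (simp only: sum.atLeast_Suc_atMost[of 0] le0 One_nat_def)
  also have "(\<Sum>i\<in>{1..nn S}. csc (?c i) (z i)) = (\<Sum>i\<in>{1..nn S}. csc (c i) (z i))"
    by (rule sum.cong) auto
  finally have "(\<Sum>i\<in>{0..nn S}. csc (?c i) (z i)) = 0" by (simp only: c csc_simps fun_upd_same add_0_left)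
  then have "\<forall>i\<in>{0..nn S}. ?c i = 0" by (rule basis_indep)
  moreover have "i \<in> {0..nn S}" using i by simp
  ultimately have "?c i = 0" by blast
  then show "c i = 0" using i by auto
next
  fix v assume v: "v \<in> cspace L"
  let ?V = "{u + t *\<^sub>R vdelta S | u t. u \<in> L}"
  have "L \<subseteq> ?V"
  proof
    fix u assume "u \<in> L"
    then have "u + 0 *\<^sub>R vdelta S \<in> ?V" by blast
    then show "u \<in> ?V" by simp
  qed
  then have "v \<in> cspace ?V" using v unfolding cspace_def by blast
  from basis_span[OF this] obtain c where "v = (\<Sum>i\<in>{0..nn S}. csc (c i) (z i))" ..
  then have c: "v = csc (c 0) (z 0) + (\<Sum>i\<in>{1..nn S}. csc (c i) (z i))"
    by (simp only: sum.atLeast_Suc_atMost[of 0] le0 One_nat_def)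
  have "(\<Sum>i\<in>{1..nn S}. csc (c i) (z i)) \<in> cspace L"
    by (intro cspace_sum cspace_csc subspace_L z_L)
  then have "csc (c 0) (z 0) \<in> cspace L"
    using c v cspace_diff[OF subspace_L v, of "\<Sum>i\<in>{1..nn S}. csc (c i) (z i)"] by simp
  then have "(Im (c 0) / (2 * pi)) *\<^sub>R vdelta S \<in> L \<inter> radF S" "(Re (c 0) / (2 * pi)) *\<^sub>R vdelta S \<in> L \<inter> radF S"
    unfolding csc_z0 cspace_def radF_eq
    using subspace_neg[OF subspace_L, of "- (Im (c 0) / (2 * pi)) *\<^sub>R vdelta S"]
    by (auto intro: span_scale span_base)
  then have "c 0 = 0" using L_radF vdelta_nz by (simp add: complex_eq_iff)
  then show "\<exists>c. v = (\<Sum>i\<in>{1..nn S}. csc (c i) (z i))"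
    using c by (intro exI[of _ c]) (simp add: csc_simps)
qed

text \<open>A point of \<open>Lperp\<close> is determined by its values on a and \<delta>, which
  \<open>g\<close> fixes, and \<open>g\<close> preserves L; so its transpose fixes
  \<open>Lperp\<close> pointwise. On dual vectors it has the same eigenvalues as \<open>g\<close> on
  the coordinates.\<close>

lemma equivariant_coordinatesI:
  assumes "taylor_coordinates S w f L" and w_g: "\<And>i. i \<le> nn S \<Longrightarrow> cmap g (w i) = csc (\<zeta> ^ dg S i) (w i)"
  shows "equivariant_coordinates S w f L g \<zeta>"
proof -
  interpret taylor_coordinates S w f L by (rule assms(1))
  show ?thesis
  proof
    show pY: "pull g p \<in> Y S" if "p \<in> Y S" for p by (rule pull_isom_Y[OF isom_g that])
    show "blinfun_apply (pull g p) (vdelta S) = blinfun_apply p (vdelta S)" for p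
      by (rule pull_isom_vdelta[OF isom_g])
    show "pull g p = p" if p: "p \<in> Lperp S L" for p
    proof (rule Lperp_unique[OF _ p pull_isom_vdelta[OF isom_g]])
      have "blinfun_apply (pull g p) v = 0" if "v \<in> L" for v
        using that p g_L pull_apply[OF linear_g, of p v] by (auto simp: Lperp_def)
      then show "pull g p \<in> Lperp S L" using pY p by (simp add: Lperp_def)
    qed
    show "pull g (f i) = hsc (\<zeta> ^ dg S i) (f i)" if i: "i \<in> {1..nn S}" for i
    proof -
      have i': "i \<le> nn S" using i by simp
      have "pull g (f i) - hsc (\<zeta> ^ dg S i) (f i) = 0"
      proof (rule sep)
        show "blinfun_apply (pull g (f i) - hsc (\<zeta> ^ dg S i) (f i)) (va S) = 0"
          using e_va[OF i'] pull_isom_va[OF isom_g, of "f i"] by (simp add: blinfun.diff_left)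
        fix k assume k: "k \<le> nn S"
        show "cpair (w k) (pull g (f i) - hsc (\<zeta> ^ dg S i) (f i)) = 0"
          using dual[OF k i'] by (simp add: cpair_diff_right cpair_pull[OF isom_g] w_g[OF k])
      qed
      then show ?thesis by simp
    qed
  qed
qed

lemma equivariant_coordinates_flat: "equivariant_coordinates S z e L g \<zeta>"
proof -
  interpret dual_coordinates S z e
  proof
    show "blinfun_apply (e i) (va S) = 0" for i
      unfolding e_def by (rule form_dual_va)
    show "cpair (z i) (e j) = (if i = j then 1 else 0)" if "i \<le> nn S" "j \<le> nn S" for i j
      using that z_form[of i "nn S - j"] by (auto simp: cpair_e)
    show "h = 0" if "blinfun_apply h (va S) = 0" "\<And>i. i \<le> nn S \<Longrightarrow> cpair (z i) h = 0" for h
      using that by (rule flat_sep)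
  qed
  interpret taylor_coordinates S z e L
  proof
    show "\<exists>c. (v, 0) = (\<Sum>i\<in>{1..nn S}. csc (c i) (z i))" if "v \<in> L" for v
      using basis_L that subspace_0[OF subspace_L] unfolding cbasis_def cspace_def by blast
  qed (use z_0 z_L radF_eq L_radF_span in auto)
  show ?thesis
    by (rule equivariant_coordinatesI[OF taylor_coordinates_axioms z_g])
qed

end

sublocale flat_coordinates \<subseteq> flat: equivariant_coordinates S z e L g \<zeta>
  by (rule equivariant_coordinates_flat)

context flat_coordinates
begin

section \<open>The form on invariants and the Euler field in flat coordinates\<close>

lemma cform_expand: "cform S u u' = (\<Sum>i\<le>nn S. cpair u (e i) * cpair u' (e (nn S - i)))"
proof -
  have "cform S u u' = cpair u (form_dual u')" by (simp add: cpair_form_dual)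
  also have "\<dots> = cpair u (\<Sum>i\<le>nn S. hsc (cpair (z i) (form_dual u')) (e i))"
    using flat.expansion[OF form_dual_va[of u']] by simp
  also have "\<dots> = (\<Sum>i\<le>nn S. cpair (z i) (form_dual u') * cpair u (e i))"
    by (simp only: cpair_sum_right cpair_hsc)
  also have "\<dots> = (\<Sum>i\<le>nn S. cpair u (e i) * cpair u' (e (nn S - i)))"
    by (rule sum.cong) (auto simp: cpair_form_dual cpair_e cform_sym)
  finally show ?thesis .
qed

lemma IW_eq: "IW S z f f' p = (\<Sum>i\<le>nn S. pd S z i f p * pd S z (nn S - i) f' p)"
  unfolding IW_def
proof (rule sum.cong[OF refl])
  fix i assume i: "i \<in> {..nn S}"
  have "(\<Sum>j\<le>nn S. pd S z i f p * pd S z j f' p * cform S (z i) (z j)) =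
    (\<Sum>j\<le>nn S. if j = nn S - i then pd S z i f p * pd S z j f' p else 0)"
    by (rule sum.cong) (use i z_form in auto)
  also have "\<dots> = pd S z i f p * pd S z (nn S - i) f' p"
    by (simp only: sum.delta finite_atMost atMost_iff diff_le_self if_True)
  finally show "(\<Sum>j\<le>nn S. pd S z i f p * pd S z j f' p * cform S (z i) (z j)) =
     pd S z i f p * pd S z (nn S - i) f' p" .
qed

lemma FY_IW: "f \<in> FY S \<Longrightarrow> f' \<in> FY S \<Longrightarrow> IW S z f f' \<in> FY S"
  unfolding IW_eq[abs_def] by (intro FY_sum FY_mult flat.FY_pd) auto

lemma pd_pull:
  assumes w: "isom w" and f: "f \<in> FY S" and inv: "\<And>p. p \<in> Y S \<Longrightarrow> f (pull w p) = f p"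
    and i: "i \<le> nn S" and p: "p \<in> Y S"
  shows "pd S z i f p = (\<Sum>j\<le>nn S. cpair (cmap w (z j)) (e i) * pd S z j f (pull w p))"
proof -
  have va: "blinfun_apply (pull w (e i)) (va S) = 0"
    using pull_isom_va[OF w] flat.e_va[OF i] by simp
  have pw: "pull w p \<in> Y S" by (rule pull_isom_Y[OF w p])
  have "pd S z i f p = dir_deriv (e i) (\<lambda>p. f (pull w p)) p"
    unfolding flat.pd_eq_dir_deriv[OF i] by (rule dir_deriv_cong[OF f p flat.e_va[OF i]]) (simp add: inv)
  also have "\<dots> = dir_deriv (pull w (e i)) f (pull w p)" by (rule dir_deriv_pull)
  also have "\<dots> = dir_deriv (\<Sum>j\<le>nn S. hsc (cpair (z j) (pull w (e i))) (e j)) f (pull w p)"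
    using flat.expansion[OF va] by simp
  also have "\<dots> = (\<Sum>j\<le>nn S. dir_deriv (hsc (cpair (z j) (pull w (e i))) (e j)) f (pull w p))"
    by (rule dir_deriv_sum_arg[OF f pw]) (use flat.e_va in auto)
  also have "\<dots> = (\<Sum>j\<le>nn S. cpair (cmap w (z j)) (e i) * pd S z j f (pull w p))"
    by (intro sum.cong refl)
       (use dir_deriv_hsc[OF f pw] flat.e_va flat.pd_eq_dir_deriv cpair_pull[OF w] in auto)
  finally show ?thesis .
qed

lemma cform_cmap: "isom w \<Longrightarrow> cform S (cmap w u) (cmap w u') = cform S u u'"
  by (simp add: cform_def cmap_def isom_def)

text \<open>By the chain rule each factor picks up the matrix \<open>?N\<close> of \<open>w\<close>.
  Read backwards, \<open>cform_expand\<close> turns the product of two such matrices into the form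
  on the moved basis, and \<open>w\<close> is an isometry.\<close>

lemma IW_pull:
  assumes w: "isom w" and f: "f \<in> FY S" "\<And>p. p \<in> Y S \<Longrightarrow> f (pull w p) = f p"
    and f': "f' \<in> FY S" "\<And>p. p \<in> Y S \<Longrightarrow> f' (pull w p) = f' p" and p: "p \<in> Y S"
  shows "IW S z f f' (pull w p) = IW S z f f' p"
proof -
  let ?N = "\<lambda>j i. cpair (cmap w (z j)) (e i)"
  let ?f = "\<lambda>j. pd S z j f (pull w p)" and ?f' = "\<lambda>j. pd S z j f' (pull w p)"
  have "IW S z f f' p = (\<Sum>i\<le>nn S. (\<Sum>j\<le>nn S. ?N j i * ?f j) * (\<Sum>k\<le>nn S. ?N k (nn S - i) * ?f' k))"
    unfolding IW_eq by (rule sum.cong) (use pd_pull[OF w f _ p] pd_pull[OF w f' _ p] in auto)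
  also have "\<dots> = (\<Sum>i\<le>nn S. \<Sum>j\<le>nn S. \<Sum>k\<le>nn S. ?f j * ?f' k * (?N j i * ?N k (nn S - i)))"
    by (simp only: sum_product mult_ac)
  also have "\<dots> = (\<Sum>j\<le>nn S. \<Sum>i\<le>nn S. \<Sum>k\<le>nn S. ?f j * ?f' k * (?N j i * ?N k (nn S - i)))"
    by (rule sum.swap)
  also have "\<dots> = (\<Sum>j\<le>nn S. \<Sum>k\<le>nn S. \<Sum>i\<le>nn S. ?f j * ?f' k * (?N j i * ?N k (nn S - i)))"
    by (intro sum.cong refl sum.swap)
  also have "\<dots> = (\<Sum>j\<le>nn S. \<Sum>k\<le>nn S. ?f j * ?f' k * cform S (cmap w (z j)) (cmap w (z k)))"
    by (simp only: cform_expand sum_distrib_left)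
  also have "\<dots> = IW S z f f' (pull w p)"
    by (simp only: IW_def cform_cmap[OF w])
  finally show ?thesis by simp
qed

definition euler_const :: complex where
  "euler_const = - 2 * of_real pi * \<i> * of_real (IRI S * of_nat (dg S (nn S)) / mmax S)"

text \<open>The vector \<open>e (nn S)\<close> is pairing with z^0, a multiple of \<delta>, so it
  vanishes on F and takes the value 1/(-2\<pi>i) at \<Lambda>_0; \<open>euler_const\<close> rescales
  it. Uniqueness holds because \<Lambda>_0 pairs to 1 with \<delta> while F pairs to 0, so F and
  \<Lambda>_0 span the whole space.\<close>

lemma euler_eq: "euler S = dir_deriv (hsc euler_const (e (nn S)))"
proof -
  let ?\<kappa> = "IRI S * of_nat (dg S (nn S)) / mmax S"
  have z0: "z 0 = (0, (1 / (2 * pi)) *\<^sub>R vdelta S)"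
    using csc_z0[of 1] by (simp add: csc_simps)
  have en: "blinfun_apply (e (nn S)) v = \<i> * of_real (form S v (vdelta S) / (2 * pi))" for v
    by (simp add: e_def form_dual_apply z0 cform_def bilinear_rmul[OF bil] bilinear_rzero[OF bil]
        bilinear_lzero[OF bil] complex_eq_iff)
  have Lam: "form S (Lam S) (vdelta S) = 1"
    using hyperbolic by (simp add: hyperbolic_extension_def)
  have "(THE h. (\<forall>v\<in>Fsp S. blinfun_apply h v = 0) \<and> blinfun_apply h (Lam S) = of_real ?\<kappa>) = hsc euler_const (e (nn S))"
  proof (rule the_equality)
    have "euler_const * (\<i> * of_real (1 / (2 * pi))) = of_real ?\<kappa>"
      by (simp add: euler_const_def complex_eq_iff)
    then show *: "(\<forall>v\<in>Fsp S. blinfun_apply (hsc euler_const (e (nn S))) v = 0) \<and>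
        blinfun_apply (hsc euler_const (e (nn S))) (Lam S) = of_real ?\<kappa>"
      using form_vdelta Lam by (simp only: hsc_apply en) simp
    fix h :: "'v \<Rightarrow>\<^sub>L complex"
    assume h: "(\<forall>v\<in>Fsp S. blinfun_apply h v = 0) \<and> blinfun_apply h (Lam S) = of_real ?\<kappa>"
    have "Lam S \<notin> span (Fsp S)"
      using form_vdelta[of "Lam S"] Lam subspace_Fsp by (auto simp: span_eq_iff[THEN iffD2])
    then have "dim (insert (Lam S) (Fsp S)) = DIM('v)"
      using dim_Fsp DIM by (simp add: dim_insert)
    then have sp: "span (insert (Lam S) (Fsp S)) = UNIV" by (simp only: dim_eq_full)
    show "h = hsc euler_const (e (nn S))"
    proof (rule blinfun_eqI)
      fix v
      have "v \<in> span (insert (Lam S) (Fsp S))" using sp by simp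
      then show "blinfun_apply h v = blinfun_apply (hsc euler_const (e (nn S))) v"
        by (rule linear_eq_on_span[OF bounded_linear.linear[OF blinfun.bounded_linear_right]
          bounded_linear.linear[OF blinfun.bounded_linear_right], rotated])
         (use h * in \<open>auto simp del: hsc_apply\<close>)
    qed
  qed
  then show ?thesis by (simp add: euler_def)
qed

lemma euler_pd: "f \<in> FY S \<Longrightarrow> p \<in> Y S \<Longrightarrow> euler S f p = euler_const * pd S z (nn S) f p"
  using dir_deriv_hsc[of f S p "e (nn S)" euler_const] flat.e_va[of "nn S"] flat.pd_eq_dir_deriv[of "nn S"]
  by (simp add: euler_eq)

text \<open>Links the basis that witnesses goodness to the flat one. Both are eigenbases of
  \<open>g\<close> on the complexification of L, so the entries of the transition matrix between
  different weights vanish and \<open>van_base_change\<close> applies.\<close>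

lemma homogeneous_basis_coordinates:
  assumes w: "homogeneous_basis S g \<zeta> L w"
    and pos: "\<And>i. i \<in> {1..nn S} \<Longrightarrow> dg S i > 0"
  shows "\<exists>f. equivariant_coordinates S w f L g \<zeta> \<and>
    (\<forall>m F. van S L w {1..nn S} m F \<longrightarrow> van S L z {1..nn S} m F)"
proof -
  let ?I = "{1..nn S}"
  have w_0: "w 0 = z0 S" and wb: "cbasis ?I w (cspace L)"
    and w_g: "\<And>i. i \<in> ?I \<Longrightarrow> cmap g (w i) = csc (\<zeta> ^ dg S i) (w i)"
    using w unfolding homogeneous_basis_def by blast+
  have w_L: "\<And>i. i \<in> ?I \<Longrightarrow> w i \<in> cspace L"
    and w_indep: "\<And>c i. (\<Sum>i\<in>?I. csc (c i) (w i)) = 0 \<Longrightarrow> i \<in> ?I \<Longrightarrow> c i = 0"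
    and w_span: "\<And>v. v \<in> cspace L \<Longrightarrow> \<exists>c. v = (\<Sum>i\<in>?I. csc (c i) (w i))"
    using wb unfolding cbasis_def by blast+
  have z_indep: "\<And>c i. (\<Sum>i\<in>?I. csc (c i) (z i)) = 0 \<Longrightarrow> i \<in> ?I \<Longrightarrow> c i = 0"
    and z_span: "\<And>v. v \<in> cspace L \<Longrightarrow> \<exists>c. v = (\<Sum>i\<in>?I. csc (c i) (z i))"
    using basis_L unfolding cbasis_def by blast+
  have "\<forall>k\<in>?I. \<exists>a. w k = (\<Sum>j\<in>?I. csc (a j) (z j))"
    using z_span w_L by blast
  then obtain A where A: "\<And>k. k \<in> ?I \<Longrightarrow> w k = (\<Sum>j\<in>?I. csc (A k j) (z j))" by metis
  have "\<forall>j\<in>?I. \<exists>b. z j = (\<Sum>i\<in>?I. csc (b i) (w i))"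
    using w_span z_L by blast
  then obtain B where B: "\<And>j. j \<in> ?I \<Longrightarrow> z j = (\<Sum>i\<in>?I. csc (B j i) (w i))" by metis
  have AB: "(\<Sum>j\<in>?I. A k j * B j i) = (if k = i then 1 else 0)" if k: "k \<in> ?I" and i: "i \<in> ?I" for k i
  proof -
    have "w k = (\<Sum>j\<in>?I. csc (A k j) (\<Sum>i\<in>?I. csc (B j i) (w i)))"
      unfolding A[OF k] by (rule sum.cong) (use B in auto)
    also have "\<dots> = (\<Sum>j\<in>?I. \<Sum>i\<in>?I. csc (A k j * B j i) (w i))"
      by (simp only: csc_sum_right csc_simps)
    also have "\<dots> = (\<Sum>i\<in>?I. \<Sum>j\<in>?I. csc (A k j * B j i) (w i))"
      by (rule sum.swap)
    also have "\<dots> = (\<Sum>i\<in>?I. csc (\<Sum>j\<in>?I. A k j * B j i) (w i))"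
      by (simp only: csc_sum_left)
    finally have 1: "w k = (\<Sum>i\<in>?I. csc (\<Sum>j\<in>?I. A k j * B j i) (w i))" .
    have "(\<Sum>i\<in>?I. csc (if k = i then 1 else 0) (w i)) = (\<Sum>i\<in>?I. if i = k then w i else 0)"
      by (rule sum.cong) (auto simp: csc_simps)
    also have "\<dots> = w k" using k by (simp only: sum.delta finite_atLeastAtMost if_True)
    finally have "(\<Sum>i\<in>?I. csc ((\<Sum>j\<in>?I. A k j * B j i) - (if k = i then 1 else 0)) (w i)) = 0"
      using 1 by (simp only: csc_simps sum_subtractf) simp
    from w_indep[OF this i] show ?thesis by simp
  qed
  have A_deg: "dg S i = dg S k" if k: "k \<in> ?I" and i: "i \<in> ?I" and ne: "A k i \<noteq> 0" for k i
  proof -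
    have "(\<Sum>j\<in>?I. csc (\<zeta> ^ dg S k * A k j) (z j)) = csc (\<zeta> ^ dg S k) (w k)"
      unfolding A[OF k] by (simp only: csc_sum_right csc_simps)
    also have "\<dots> = cmap g (w k)" using w_g[OF k] by simp
    also have "\<dots> = (\<Sum>j\<in>?I. csc (A k j) (cmap g (z j)))"
      unfolding A[OF k] by (simp only: cmap_sum[OF linear_g] cmap_csc[OF linear_g])
    also have "\<dots> = (\<Sum>j\<in>?I. csc (A k j * \<zeta> ^ dg S j) (z j))"
      by (rule sum.cong) (use z_g in \<open>auto simp: csc_simps\<close>)
    finally have "(\<Sum>j\<in>?I. csc (\<zeta> ^ dg S k * A k j - A k j * \<zeta> ^ dg S j) (z j)) = 0"
      by (simp only: csc_simps sum_subtractf) simp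
    from z_indep[OF this i] have eq: "\<zeta> ^ dg S k = \<zeta> ^ dg S i" using ne by (simp add: algebra_simps)
    \<comment> \<open>Both weights lie in an interval of d_n consecutive integers, so congruence
      modulo d_n is equality.\<close>
    have bounds: "0 < dg S k" "dg S k \<le> dg S (nn S)" "0 < dg S i" "dg S i \<le> dg S (nn S)"
      using pos k i dg_le_top by auto
    show ?thesis
    proof (cases "dg S i \<le> dg S k")
      case True
      then have "dg S (nn S) dvd dg S k - dg S i"
        using primitive_root_power_eq[OF prim eq[symmetric]] by simp
      then show ?thesis using bounds True by (cases "dg S k - dg S i = 0") (auto dest: dvd_imp_le)
    next
      case False
      then have "dg S (nn S) dvd dg S i - dg S k"
        using primitive_root_power_eq[OF prim eq] by simp
      then show ?thesis using bounds False by (cases "dg S i - dg S k = 0") (auto dest: dvd_imp_le)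
    qed
  qed
  \<comment> \<open>The vectors dual to \<open>w\<close>, by the inverse matrix of \<open>A\<close>.
    The vector \<open>e 0\<close> is kept, since w^0 = z^0 and it kills L.\<close>
  define f where "f = (\<lambda>i. if i = 0 then e 0 else (\<Sum>j\<in>?I. hsc (B j i) (e j)))"
  have f_0: "f 0 = e 0" by (simp add: f_def)
  have f_i: "f i = (\<Sum>j\<in>?I. hsc (B j i) (e j))" if "i \<in> ?I" for i using that by (simp add: f_def)
  have z_zero: "cpair (z 0) (e j) = 0" if "j \<in> ?I" for j
    using flat.dual[of 0 j] that by auto
  have wz: "cpair (w k) h = (\<Sum>j\<in>?I. A k j * cpair (z j) h)" if "k \<in> ?I" for k h
    by (simp only: A[OF that] cpair_sum_left cpair_csc)
  have zw: "cpair (z k) h = (\<Sum>j\<in>?I. B k j * cpair (w j) h)" if "k \<in> ?I" for k h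
    by (simp only: B[OF that] cpair_sum_left cpair_csc)
  have we: "cpair (w k) (e j) = A k j" if k: "k \<in> ?I" and j: "j \<in> ?I" for k j
  proof -
    have "cpair (w k) (e j) = (\<Sum>i\<in>?I. if i = j then A k i else 0)"
      unfolding wz[OF k] by (rule sum.cong) (use flat.dual j in auto)
    then show ?thesis using j by (simp only: sum.delta finite_atLeastAtMost if_True)
  qed
  interpret w: dual_coordinates S w f
  proof
    show "blinfun_apply (f i) (va S) = 0" if "i \<le> nn S" for i
    proof (cases "i = 0")
      case False
      then have "i \<in> ?I" using that by simp
      moreover have "(\<Sum>j\<in>?I. blinfun_apply (hsc (B j i) (e j)) (va S)) = 0"
        by (rule sum.neutral) (use flat.e_va in auto)
      ultimately show ?thesis by (simp only: f_i blinfun.sum_left)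
    qed (use flat.e_va f_0 in simp)
    show "cpair (w i) (f j) = (if i = j then 1 else 0)" if ij: "i \<le> nn S" "j \<le> nn S" for i j
    proof (cases "j = 0")
      case j: True
      show ?thesis
      proof (cases "i = 0")
        case True
        then show ?thesis using j flat.dual[of 0 0] by (simp add: f_0 w_0 z_0)
      next
        case False
        then have i: "i \<in> ?I" using ij by simp
        have "cpair (w i) (e 0) = 0"
          unfolding wz[OF i] by (rule sum.neutral) (use flat.dual[of _ 0] in auto)
        then show ?thesis using j False by (simp add: f_0)
      qed
    next
      case False
      then have j: "j \<in> ?I" using ij by simp
      have *: "cpair u (f j) = (\<Sum>k\<in>?I. B k j * cpair u (e k))" for u
        by (simp only: f_i[OF j] cpair_sum_right cpair_hsc)
      show ?thesis
      proof (cases "i = 0")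
        case True
        have "cpair (z 0) (f j) = 0"
          unfolding * by (rule sum.neutral) (use z_zero in auto)
        then show ?thesis using True False by (simp add: w_0 z_0)
      next
        case False
        then have i: "i \<in> ?I" using ij by simp
        have "cpair (w i) (f j) = (\<Sum>k\<in>?I. A i k * B k j)"
          unfolding * by (rule sum.cong) (use we[OF i] in auto)
        then show ?thesis using AB[OF i j] by simp
      qed
    qed
    show "h = 0" if h: "blinfun_apply h (va S) = 0" "\<And>i. i \<le> nn S \<Longrightarrow> cpair (w i) h = 0" for h
    proof (rule flat.sep[OF h(1)])
      fix i assume i: "i \<le> nn S"
      show "cpair (z i) h = 0"
      proof (cases "i = 0")
        case True
        then show ?thesis using h(2)[of 0] by (simp add: w_0 z_0)
      next
        case False
        then have "i \<in> ?I" using i by simp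
        then show ?thesis unfolding zw[OF \<open>i \<in> ?I\<close>] by (intro sum.neutral) (use h(2) in auto)
      qed
    qed
  qed
  have tw: "taylor_coordinates S w f L"
  proof
    show "\<exists>c. (v, 0) = (\<Sum>i\<in>?I. csc (c i) (w i))" if "v \<in> L" for v
      by (rule w_span) (use that subspace_0[OF subspace_L] in \<open>simp add: cspace_def\<close>)
  qed (use w_0 w_L radF_eq L_radF_span in auto)
  have ef: "e i = (\<Sum>j\<in>?I. hsc (A j i) (f j))" if i: "i \<in> ?I" for i
  proof -
    have i': "i \<le> nn S" using i by simp
    have "e i = (\<Sum>j\<le>nn S. hsc (cpair (w j) (e i)) (f j))"
      by (rule w.expansion[OF flat.e_va[OF i']])
    also have "\<dots> = hsc (cpair (w 0) (e i)) (f 0) + (\<Sum>j\<in>?I. hsc (cpair (w j) (e i)) (f j))"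
      by (simp only: atMost_atLeast0 sum.atLeast_Suc_atMost[of 0] le0 One_nat_def)
    also have "cpair (w 0) (e i) = 0" using z_zero[OF i] by (simp add: w_0 z_0)
    also have "(\<Sum>j\<in>?I. hsc (cpair (w j) (e i)) (f j)) = (\<Sum>j\<in>?I. hsc (A j i) (f j))"
      by (rule sum.cong) (use we i in auto)
    finally show ?thesis by (simp add: hsc_simps)
  qed
  have "van S L z ?I m F" if "van S L w ?I m F" for m F
    by (rule van_base_change[OF tw flat.taylor_coordinates_axioms, where B = "\<lambda>i j. A j i"])
       (use ef A_deg pos that in auto)
  moreover have "cmap g (w i) = csc (\<zeta> ^ dg S i) (w i)" if "i \<le> nn S" for i
    using that w_g[of i] z_g[of 0] by (cases "i = 0") (auto simp: w_0 z_0)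
  ultimately show ?thesis using equivariant_coordinatesI[OF tw] by blast
qed

end

section \<open>Homogeneous invariants\<close>

lemma FH_const: "(\<lambda>_. k) \<in> FH S"
  unfolding FH_def by (auto intro!: exI[of _ "\<lambda>_. k"])

lemma FH_cmult: "c \<in> FH S \<Longrightarrow> (\<lambda>p. k * c p) \<in> FH S"
proof -
  assume "c \<in> FH S"
  then obtain h where "h holomorphic_on {s. Re s > 0}" "\<And>p. p \<in> Y S \<Longrightarrow> c p = h (blinfun_apply p (vdelta S))"
    by (auto simp: FH_def)
  then show "(\<lambda>p. k * c p) \<in> FH S"
    unfolding FH_def by (auto intro!: exI[of _ "\<lambda>s. k * h s"] holomorphic_on_mult)
qed

lemma mono_fun_unit:
  assumes "i \<in> {1..n}"
  shows "mono_fun n x ((\<lambda>_. 0)(i := 1)) p = x i p"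
  using mono_fun_inc[OF assms, of x "\<lambda>_. 0" p] by simp

lemma midx_unit: "i \<in> {1..n} \<Longrightarrow> (\<lambda>_. 0)(i := 1) \<in> midx n"
  by (simp add: midx_def)

context flat_coordinates
begin

section \<open>Graded pieces of the ring of invariants\<close>

lemma SWm_FY: "f \<in> SWm S m \<Longrightarrow> f \<in> FY S"
  by (simp add: SWm_def)

lemma SWm_Weyl: "f \<in> SWm S m \<Longrightarrow> w \<in> Weyl S \<Longrightarrow> p \<in> Y S \<Longrightarrow> f (pull w p) = f p"
  by (subst act_isom[OF isom_Weyl, symmetric]) (auto simp: SWm_def)

lemma SWm_euler: "f \<in> SWm S m \<Longrightarrow> p \<in> Y S \<Longrightarrow> euler_const * pd S z (nn S) f p = of_nat m * f p"
  by (subst euler_pd[OF SWm_FY, symmetric]) (auto simp: SWm_def)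

lemma SWmI:
  assumes "f \<in> FY S" "\<And>w p. w \<in> Weyl S \<Longrightarrow> p \<in> Y S \<Longrightarrow> f (pull w p) = f p"
    and "\<And>p. p \<in> Y S \<Longrightarrow> euler_const * pd S z (nn S) f p = of_nat m * f p"
  shows "f \<in> SWm S m"
  unfolding SWm_def mem_Collect_eq
proof (intro conjI ballI)
  show "act_fun w f p = f p" if "w \<in> Weyl S" "p \<in> Y S" for w p
    unfolding act_isom[OF isom_Weyl[OF that(1)]] by (rule assms(2)[OF that])
  show "euler S f p = of_nat m * f p" if "p \<in> Y S" for p
    unfolding euler_pd[OF assms(1) that] by (rule assms(3)[OF that])
qed (rule assms(1))

lemma top_index: "nn S \<in> {1..nn S}" "nn S \<le> nn S"
  by auto

lemma SWm_add:
  assumes "f \<in> SWm S m" "f' \<in> SWm S m"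
  shows "(\<lambda>p. f p + f' p) \<in> SWm S m"
proof (rule SWmI)
  fix p assume p: "p \<in> Y S"
  show "euler_const * pd S z (nn S) (\<lambda>p. f p + f' p) p = of_nat m * (f p + f' p)"
    using SWm_euler[OF assms(1) p] SWm_euler[OF assms(2) p]
    by (simp only: flat.pd_add[OF top_index(2) SWm_FY[OF assms(1)] SWm_FY[OF assms(2)] p] distrib_left)
next
  fix w p assume "w \<in> Weyl S" "p \<in> Y S"
  then show "f (pull w p) + f' (pull w p) = f p + f' p"
    using SWm_Weyl[OF assms(1)] SWm_Weyl[OF assms(2)] by simp
qed (use assms SWm_FY in auto)

lemma SWm_mult:
  assumes "f \<in> SWm S m" "f' \<in> SWm S m'"
  shows "(\<lambda>p. f p * f' p) \<in> SWm S (m + m')"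
proof (rule SWmI)
  fix p assume p: "p \<in> Y S"
  have "euler_const * pd S z (nn S) (\<lambda>p. f p * f' p) p =
     (euler_const * pd S z (nn S) f p) * f' p + f p * (euler_const * pd S z (nn S) f' p)"
    by (simp only: flat.pd_mult[OF top_index(2) SWm_FY[OF assms(1)] SWm_FY[OF assms(2)] p]) (simp add: algebra_simps)
  then show "euler_const * pd S z (nn S) (\<lambda>p. f p * f' p) p = of_nat (m + m') * (f p * f' p)"
    by (simp only: SWm_euler[OF assms(1) p] SWm_euler[OF assms(2) p]) (simp add: algebra_simps)
next
  fix w p assume "w \<in> Weyl S" "p \<in> Y S"
  then show "f (pull w p) * f' (pull w p) = f p * f' p"
    using SWm_Weyl[OF assms(1)] SWm_Weyl[OF assms(2)] by simp
qed (use assms SWm_FY in auto)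

lemma SWm_FH:
  assumes "c \<in> FH S"
  shows "c \<in> SWm S 0"
proof (rule SWmI)
  fix p assume p: "p \<in> Y S"
  have "pd S z (nn S) c p = 0"
    using flat.fibre_const_FH[OF assms] p top_index(1) unfolding flat.fibre_const_def by blast
  then show "euler_const * pd S z (nn S) c p = of_nat 0 * c p" by simp
next
  fix w p assume w: "w \<in> Weyl S" and p: "p \<in> Y S"
  show "c (pull w p) = c p"
    by (rule FH_cong_vdelta[OF assms pull_isom_Y[OF isom_Weyl[OF w] p] p pull_isom_vdelta[OF isom_Weyl[OF w]]])
qed (rule flat.FH_FY[OF assms])

lemma SWm_zero: "(\<lambda>_. 0) \<in> SWm S m"
proof (rule SWmI)
  show "euler_const * pd S z (nn S) (\<lambda>_. 0) p = of_nat m * 0" for p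
    using flat.pd_const[OF top_index(2), of 0] by simp
qed auto

lemma SWm_FH_mult:
  assumes "c \<in> FH S" "f \<in> SWm S m"
  shows "(\<lambda>p. c p * f p) \<in> SWm S m"
  using SWm_mult[OF SWm_FH[OF assms(1)] assms(2)] by (simp only: add_0)

lemma SWm_sum: "(\<And>a. a \<in> A \<Longrightarrow> F a \<in> SWm S m) \<Longrightarrow> (\<lambda>p. \<Sum>a\<in>A. F a p) \<in> SWm S m"
  by (induction A rule: infinite_finite_induct) (auto simp: SWm_zero SWm_add)

lemma SWm_mono_fun:
  assumes "\<And>i. i \<in> {1..nn S} \<Longrightarrow> x i \<in> SWm S (dg S i)" "b \<in> midx (nn S)"
  shows "mono_fun (nn S) x b \<in> SWm S (ddot S b)"
  using assms(2)
proof (induction b rule: flat.midx_induct)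
  case zero
  have "(\<lambda>_. 1) \<in> SWm S 0" by (rule SWm_FH[OF FH_const])
  then show ?case by simp
next
  case (inc b i)
  have "(\<lambda>p. x i p * mono_fun (nn S) x b p) \<in> SWm S (dg S i + ddot S b)"
    by (rule SWm_mult[OF assms(1)[OF inc.hyps(2)] inc.IH])
  moreover have "mono_fun (nn S) x (b(i := b i + 1)) = (\<lambda>p. x i p * mono_fun (nn S) x b p)"
    by (rule ext) (rule mono_fun_inc[OF inc.hyps(2)])
  moreover have "ddot S (b(i := b i + 1)) = dg S i + ddot S b"
    using ddot_inc[OF inc.hyps(2)] by simp
  ultimately show ?case by (simp only:)
qed

lemma SWm_SW:
  assumes "f \<in> SWm S m"
  shows "f \<in> SW S"
proof -
  define F where "F = (\<lambda>k. if k = m then f else (\<lambda>_. 0))"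
  have "\<forall>k\<le>m. F k \<in> SWm S k" using assms SWm_zero by (simp add: F_def)
  moreover have "f p = (\<Sum>k\<le>m. F k p)" for p
  proof -
    have "(\<Sum>k\<le>m. F k p) = (\<Sum>k\<le>m. if k = m then f p else 0)"
      by (rule sum.cong) (auto simp: F_def)
    also have "\<dots> = f p" by (simp only: sum.delta finite_atMost atMost_iff order_refl if_True)
    finally show ?thesis by simp
  qed
  ultimately show ?thesis unfolding SW_def by blast
qed

lemma basic_invariantsD:
  assumes "basic_invariants S y"
  shows basic_SWm: "i \<in> {1..nn S} \<Longrightarrow> y i \<in> SWm S (dg S i)"
    and basic_indep: "FH_coeffs S A c \<Longrightarrow> (\<And>p. p \<in> Y S \<Longrightarrow> (\<Sum>a\<in>A. c a p * mono_fun (nn S) y a p) = 0) \<Longrightarrow>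
       a \<in> A \<Longrightarrow> p \<in> Y S \<Longrightarrow> c a p = 0"
    and basic_gen: "SW S \<subseteq> FH_polys S y"
  using assms unfolding basic_invariants_def by blast+

text \<open>The Euler field multiplies the term of index a by \<open>ddot S a\<close> and the whole
  function by \<open>m\<close>. Subtracting yields a polynomial relation with coefficients
  (\<open>ddot S a\<close> - m) c_a, which vanish by algebraic independence, so the terms of other
  degrees may be dropped.\<close>

lemma homogeneous_expansion:
  assumes y: "basic_invariants S y" and f: "f \<in> SWm S m"
  shows "\<exists>A c. FH_coeffs S A c \<and> (\<forall>a\<in>A. ddot S a = m) \<and>
    (\<forall>p\<in>Y S. f p = (\<Sum>a\<in>A. c a p * mono_fun (nn S) y a p))"
proof -
  have "f \<in> FH_polys S y" using SWm_SW[OF f] basic_gen[OF y] by blast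
  then obtain A c where Ac: "FH_coeffs S A c"
    and fe: "\<And>p. p \<in> Y S \<Longrightarrow> f p = (\<Sum>a\<in>A. c a p * mono_fun (nn S) y a p)"
    unfolding FH_polys_def by blast
  have fin: "finite A" and mid: "\<And>a. a \<in> A \<Longrightarrow> a \<in> midx (nn S)" and cH: "\<And>a. a \<in> A \<Longrightarrow> c a \<in> FH S"
    using Ac unfolding FH_coeffs_def by auto
  define k where "k = (\<lambda>a. of_nat (ddot S a) - of_nat m :: complex)"
  have term_SWm: "(\<lambda>p. c a p * mono_fun (nn S) y a p) \<in> SWm S (ddot S a)" if "a \<in> A" for a
    by (rule SWm_FH_mult[OF cH[OF that] SWm_mono_fun[OF basic_SWm[OF y] mid[OF that]]])
  have zero: "k a * c a p = 0" if a: "a \<in> A" and p: "p \<in> Y S" for a p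
  proof (rule basic_indep[OF y, where A = A and c = "\<lambda>a p. k a * c a p" and a = a and p = p])
    show "FH_coeffs S A (\<lambda>a p. k a * c a p)"
      using Ac FH_cmult unfolding FH_coeffs_def by blast
    fix p assume p: "p \<in> Y S"
    have "of_nat m * f p = euler_const * pd S z (nn S) f p" using SWm_euler[OF f p] by simp
    also have "pd S z (nn S) f p = pd S z (nn S) (\<lambda>p. \<Sum>a\<in>A. c a p * mono_fun (nn S) y a p) p"
      by (rule flat.pd_cong[OF SWm_FY[OF f] top_index(2) p fe])
    also have "\<dots> = (\<Sum>a\<in>A. pd S z (nn S) (\<lambda>p. c a p * mono_fun (nn S) y a p) p)"
      by (rule flat.pd_sum[OF top_index(2) SWm_FY[OF term_SWm] p])
    also have "euler_const * \<dots> = (\<Sum>a\<in>A. of_nat (ddot S a) * (c a p * mono_fun (nn S) y a p))"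
      unfolding sum_distrib_left by (rule sum.cong[OF refl]) (rule SWm_euler[OF term_SWm p])
    finally have "(\<Sum>a\<in>A. of_nat (ddot S a) * (c a p * mono_fun (nn S) y a p)) -
        of_nat m * (\<Sum>a\<in>A. c a p * mono_fun (nn S) y a p) = 0"
      using fe[OF p] by simp
    then show "(\<Sum>a\<in>A. k a * c a p * mono_fun (nn S) y a p) = 0"
      by (simp only: k_def sum_distrib_left left_diff_distrib sum_subtractf mult.assoc)
  qed (rule a p)+
  define A' where "A' = {a \<in> A. ddot S a = m}"
  show ?thesis
  proof (intro exI[of _ A'] exI[of _ c] conjI ballI)
    show "FH_coeffs S A' c" using Ac by (auto simp: FH_coeffs_def A'_def)
    show "\<And>a. a \<in> A' \<Longrightarrow> ddot S a = m" by (simp add: A'_def)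
    fix p assume p: "p \<in> Y S"
    have "(\<Sum>a\<in>A'. c a p * mono_fun (nn S) y a p) = (\<Sum>a\<in>A. c a p * mono_fun (nn S) y a p)"
      by (rule sum.mono_neutral_left[OF fin]) (use zero p in \<open>auto simp: A'_def k_def\<close>)
    then show "f p = (\<Sum>a\<in>A'. c a p * mono_fun (nn S) y a p)" using fe[OF p] by simp
  qed
qed

text \<open>The triplet gives the action of \<open>g\<close> only on one set of generators. It
  extends to every homogeneous invariant because \<open>g\<close> fixes the radical and so leaves
  the coefficients in \<open>FH\<close> alone.\<close>

lemma SWm_pull_g:
  assumes f: "f \<in> SWm S m" and p: "p \<in> Y S"
  shows "f (pull g p) = \<zeta> ^ m * f p"
proof -
  have "\<exists>y. basic_invariants S y \<and>
      (\<forall>\<alpha>\<in>{1..nn S}. \<forall>p\<in>Y S. act_fun g (y \<alpha>) p = \<zeta> ^ dg S \<alpha> * y \<alpha> p)"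
    using triplet unfolding admissible_def by (elim conjE)
  then obtain y where y: "basic_invariants S y"
    and yg: "\<forall>\<alpha>\<in>{1..nn S}. \<forall>p\<in>Y S. act_fun g (y \<alpha>) p = \<zeta> ^ dg S \<alpha> * y \<alpha> p"
    by (elim exE conjE)
  have yg': "y i (pull g p) = \<zeta> ^ dg S i * y i p" if "i \<in> {1..nn S}" for i
    using bspec[OF bspec[OF yg that] p] unfolding act_isom[OF isom_g] .
  have mg: "mono_fun (nn S) y b (pull g p) = \<zeta> ^ ddot S b * mono_fun (nn S) y b p" if "b \<in> midx (nn S)" for b
    using that
  proof (induction b rule: flat.midx_induct)
    case (inc b i)
    then show ?case
      by (simp only: mono_fun_inc ddot_inc yg' power_add mult_ac)
  qed simp
  obtain A c where A: "FH_coeffs S A c" "\<forall>a\<in>A. ddot S a = m"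
    "\<forall>p\<in>Y S. f p = (\<Sum>a\<in>A. c a p * mono_fun (nn S) y a p)"
    using homogeneous_expansion[OF y f] by (elim exE conjE)
  note Ac = A(1) bspec[OF A(2)] bspec[OF A(3)]
  have "f (pull g p) = (\<Sum>a\<in>A. c a (pull g p) * mono_fun (nn S) y a (pull g p))"
    by (rule Ac(3)[OF pull_isom_Y[OF isom_g p]])
  also have "\<dots> = (\<Sum>a\<in>A. \<zeta> ^ m * (c a p * mono_fun (nn S) y a p))"
  proof (rule sum.cong[OF refl])
    fix a assume a: "a \<in> A"
    have "c a (pull g p) = c a p"
      by (rule FH_cong_vdelta[OF _ pull_isom_Y[OF isom_g p] p pull_isom_vdelta[OF isom_g]])
         (use Ac(1) a in \<open>auto simp: FH_coeffs_def\<close>)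
    moreover have "a \<in> midx (nn S)" using Ac(1) a by (auto simp: FH_coeffs_def)
    ultimately show "c a (pull g p) * mono_fun (nn S) y a (pull g p) = \<zeta> ^ m * (c a p * mono_fun (nn S) y a p)"
      using mg Ac(2)[OF a] by simp
  qed
  also have "\<dots> = \<zeta> ^ m * f p" using Ac(3)[OF p] by (simp add: sum_distrib_left)
  finally show ?thesis .
qed

text \<open>The Euler field has constant coefficients and so commutes with every coordinate
  derivative. Hence differentiation preserves the degree, and the degrees of the two factors simply
  add.\<close>

lemma IW_SWm:
  assumes f: "f \<in> SWm S m" and f': "f' \<in> SWm S m'"
  shows "IW S z f f' \<in> SWm S (m + m')"
proof (rule SWmI)
  note F = SWm_FY[OF f] SWm_FY[OF f']
  show "IW S z f f' \<in> FY S" by (rule FY_IW[OF F])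
  show "IW S z f f' (pull w p) = IW S z f f' p" if "w \<in> Weyl S" "p \<in> Y S" for w p
    by (rule IW_pull[OF isom_Weyl[OF that(1)] F(1) _ F(2) _ that(2)]) (use SWm_Weyl f f' that in auto)
  have pd_e: "euler_const * pd S z (nn S) (pd S z i h) p = of_nat k * pd S z i h p"
    if h: "h \<in> SWm S k" and i: "i \<le> nn S" and p: "p \<in> Y S" for h k i p
  proof -
    have H: "h \<in> FY S" by (rule SWm_FY[OF h])
    have "euler_const * pd S z (nn S) (pd S z i h) p = euler_const * pd S z i (pd S z (nn S) h) p"
      using flat.pd_commute[OF H top_index(2) i p] by simp
    also have "\<dots> = pd S z i (\<lambda>p. euler_const * pd S z (nn S) h p) p"
      using flat.pd_cmult[OF i flat.FY_pd[OF H top_index(2)] p] by simp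
    also have "\<dots> = pd S z i (\<lambda>p. of_nat k * h p) p"
      by (rule flat.pd_cong[OF _ i p]) (use SWm_euler[OF h] flat.FY_pd[OF H top_index(2)] in auto)
    also have "\<dots> = of_nat k * pd S z i h p"
      by (rule flat.pd_cmult[OF i H p])
    finally show ?thesis .
  qed
  fix p assume p: "p \<in> Y S"
  have iw: "IW S z f f' = (\<lambda>p. \<Sum>i\<le>nn S. pd S z i f p * pd S z (nn S - i) f' p)"
    by (rule ext) (rule IW_eq)
  have FP: "pd S z i f \<in> FY S" "pd S z (nn S - i) f' \<in> FY S" if "i \<in> {..nn S}" for i
    using that by (auto intro: flat.FY_pd F)
  have "euler_const * pd S z (nn S) (IW S z f f') p =
     (\<Sum>i\<le>nn S. euler_const * pd S z (nn S) (\<lambda>p. pd S z i f p * pd S z (nn S - i) f' p) p)"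
    unfolding iw sum_distrib_left[symmetric]
    by (subst flat.pd_sum[OF top_index(2) _ p]) (use FP in auto)
  also have "\<dots> = (\<Sum>i\<le>nn S. of_nat (m + m') * (pd S z i f p * pd S z (nn S - i) f' p))"
  proof (rule sum.cong[OF refl])
    fix i assume i: "i \<in> {..nn S}"
    have "euler_const * pd S z (nn S) (\<lambda>p. pd S z i f p * pd S z (nn S - i) f' p) p =
       (euler_const * pd S z (nn S) (pd S z i f) p) * pd S z (nn S - i) f' p +
       pd S z i f p * (euler_const * pd S z (nn S) (pd S z (nn S - i) f') p)"
      by (simp only: flat.pd_mult[OF top_index(2) FP[OF i] p]) (simp add: algebra_simps)
    also have "euler_const * pd S z (nn S) (pd S z i f) p = of_nat m * pd S z i f p"
      by (rule pd_e[OF f _ p]) (use i in simp)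
    also have "euler_const * pd S z (nn S) (pd S z (nn S - i) f') p = of_nat m' * pd S z (nn S - i) f' p"
      by (rule pd_e[OF f' _ p]) simp
    finally show "euler_const * pd S z (nn S) (\<lambda>p. pd S z i f p * pd S z (nn S - i) f' p) p =
       of_nat (m + m') * (pd S z i f p * pd S z (nn S - i) f' p)"
      by (simp add: algebra_simps)
  qed
  also have "\<dots> = of_nat (m + m') * IW S z f f' p"
    by (simp only: IW_eq sum_distrib_left)
  finally show "euler_const * pd S z (nn S) (IW S z f f') p = of_nat (m + m') * IW S z f f' p" .
qed

text \<open>The map \<open>\<psi>\<close> takes total functions, so its independence of their values outside \<open>Y\<close> has to
  be extracted from linearity over \<^const>\<open>FH\<close>.\<close>

lemma is_psi_zero_off:
  assumes psi: "is_psi S L y w \<psi>" and u: "u \<in> SW S" "\<And>p. p \<in> Y S \<Longrightarrow> u p = 0" and p: "p \<in> Y S"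
  shows "\<psi> u p = 0"
proof -
  define c :: "'v yfun" where "c = (\<lambda>q. if q \<in> Y S then 0 else 1)"
  have "c \<in> FH S" unfolding FH_def by (auto intro!: exI[of _ "\<lambda>_. 0"] simp: c_def)
  then have "\<psi> (\<lambda>q. c q * u q) p = c p * \<psi> u p"
    using psi u(1) p unfolding is_psi_def by blast
  moreover have "(\<lambda>q. c q * u q) = u" using u(2) by (auto simp: c_def fun_eq_iff)
  ultimately show ?thesis using p by (simp add: c_def)
qed

text \<open>The two functions differ by one that vanishes on Y; additivity reduces the claim to
  \<open>is_psi_zero_off\<close>.\<close>

lemma is_psi_cong:
  assumes psi: "is_psi S L y w \<psi>" and f: "f \<in> SWm S m" and f': "f' \<in> SWm S m"
    and eq: "\<And>p. p \<in> Y S \<Longrightarrow> f p = f' p" and p: "p \<in> Y S"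
  shows "\<psi> f p = \<psi> f' p"
proof -
  define u where "u = (\<lambda>q. f' q + (-1) * f q)"
  have u: "u \<in> SW S"
    unfolding u_def by (rule SWm_SW[OF SWm_add[OF f' SWm_FH_mult[OF FH_const f]]])
  have "\<psi> (\<lambda>q. f q + u q) p = \<psi> f p + \<psi> u p"
    using psi SWm_SW[OF f] u p unfolding is_psi_def by blast
  moreover have "(\<lambda>q. f q + u q) = f'" by (simp add: u_def)
  moreover have "\<psi> u p = 0" by (rule is_psi_zero_off[OF psi u _ p]) (simp add: u_def eq)
  ultimately show ?thesis by simp
qed

lemma is_psi_sum:
  assumes psi: "is_psi S L y w \<psi>" and y: "basic_invariants S y" and p: "p \<in> Y S"
    and A: "FH_coeffs S A c" "\<And>a. a \<in> A \<Longrightarrow> ddot S a = m"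
  shows "\<psi> (\<lambda>q. \<Sum>a\<in>A. c a q * mono_fun (nn S) y a q) p = (\<Sum>a\<in>A. c a p * psi_mono S L y w a p)"
proof -
  have fin: "finite A" using A(1) by (simp add: FH_coeffs_def)
  have add: "\<psi> (\<lambda>q. f q + f' q) p = \<psi> f p + \<psi> f' p" if "f \<in> SW S" "f' \<in> SW S" for f f'
    using psi that p unfolding is_psi_def by blast
  have scale: "\<psi> (\<lambda>q. k q * f q) p = k p * \<psi> f p" if "k \<in> FH S" "f \<in> SW S" for k f
    using psi that p unfolding is_psi_def by blast
  have mono: "\<psi> (mono_fun (nn S) y a) p = psi_mono S L y w a p" if "a \<in> midx (nn S)" for a
    using psi that p unfolding is_psi_def by blast
  show ?thesis
    using fin A
  proof (induction A rule: finite_induct)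
    case empty
    have "(\<lambda>_. 0) \<in> SW S" by (rule SWm_SW[OF SWm_zero])
    from add[OF this this] show ?case by simp
  next
    case (insert a A)
    have Ac: "FH_coeffs S A c" "\<And>a. a \<in> A \<Longrightarrow> ddot S a = m" and ma: "a \<in> midx (nn S)" and ca: "c a \<in> FH S"
      using insert.prems by (auto simp: FH_coeffs_def)
    have SWm: "mono_fun (nn S) y b \<in> SWm S m" if "b \<in> insert a A" for b
      using SWm_mono_fun[OF basic_SWm[OF y], of b] insert.prems that by (auto simp: FH_coeffs_def)
    have 1: "(\<lambda>q. c a q * mono_fun (nn S) y a q) \<in> SW S"
      by (rule SWm_SW[OF SWm_FH_mult[OF ca SWm]]) simp
    have 2: "(\<lambda>q. \<Sum>a\<in>A. c a q * mono_fun (nn S) y a q) \<in> SW S"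
      by (rule SWm_SW[OF SWm_sum[OF SWm_FH_mult[OF _ SWm]]]) (use Ac in \<open>auto simp: FH_coeffs_def\<close>)
    have "\<psi> (\<lambda>q. \<Sum>a\<in>insert a A. c a q * mono_fun (nn S) y a q) p =
       \<psi> (\<lambda>q. c a q * mono_fun (nn S) y a q + (\<Sum>a\<in>A. c a q * mono_fun (nn S) y a q)) p"
      using insert.hyps by simp
    also have "\<dots> = \<psi> (\<lambda>q. c a q * mono_fun (nn S) y a q) p + \<psi> (\<lambda>q. \<Sum>a\<in>A. c a q * mono_fun (nn S) y a q) p"
      by (rule add[OF 1 2])
    also have "\<psi> (\<lambda>q. c a q * mono_fun (nn S) y a q) p = c a p * psi_mono S L y w a p"
      using scale[OF ca SWm_SW[OF SWm]] mono[OF ma] by simp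
    also have "\<psi> (\<lambda>q. \<Sum>a\<in>A. c a q * mono_fun (nn S) y a q) p = (\<Sum>a\<in>A. c a p * psi_mono S L y w a p)"
      by (rule insert.IH[OF Ac])
    finally show ?case using insert.hyps by simp
  qed
qed

text \<open>Otherwise the generators would satisfy a polynomial relation with constant term -1;
  \<open>C\<close> lists its coefficients at the zero index and the unit indices.\<close>

lemma basic_not_constant:
  assumes x: "basic_invariants S x" and p: "p \<in> Y S"
  shows "\<exists>p\<in>Y S. (\<Sum>i\<in>{1..nn S}. c i * x i p) \<noteq> 1"
proof (rule ccontr)
  assume "\<not> ?thesis"
  then have one: "(\<Sum>i\<in>{1..nn S}. c i * x i p) = 1" if "p \<in> Y S" for p using that by blast
  define u where "u = (\<lambda>i. (\<lambda>_. 0)(i := 1) :: nat \<Rightarrow> nat)"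
  have u_inj: "u i = u j \<longleftrightarrow> i = j" for i j by (auto simp: u_def fun_eq_iff)
  have u_nz: "u i \<noteq> (\<lambda>_. 0)" for i by (auto simp: u_def fun_eq_iff)
  define C :: "(nat \<Rightarrow> nat) \<Rightarrow> 'v yfun"
    where "C = (\<lambda>a _. if a = (\<lambda>_. 0) then -1 else \<Sum>i\<in>{1..nn S}. if a = u i then c i else 0)"
  let ?A = "insert (\<lambda>_. 0) (u ` {1..nn S})"
  have Cu: "C (u j) q = c j" if "j \<in> {1..nn S}" for j q
    using that by (simp add: C_def u_nz u_inj)
  have "C (\<lambda>_. 0) p = 0"
  proof (rule basic_indep[OF x, where A = ?A and c = C and a = "\<lambda>_. 0" and p = p])
    show "FH_coeffs S ?A C"
      using FH_const midx_unit by (auto simp: FH_coeffs_def C_def u_def midx_def)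
    fix q assume q: "q \<in> Y S"
    have "(\<Sum>a\<in>u ` {1..nn S}. C a q * mono_fun (nn S) x a q) = (\<Sum>i\<in>{1..nn S}. C (u i) q * mono_fun (nn S) x (u i) q)"
      by (subst sum.reindex) (auto simp: inj_on_def u_inj)
    also have "\<dots> = (\<Sum>i\<in>{1..nn S}. c i * x i q)"
      by (rule sum.cong[OF refl]) (simp only: Cu, simp only: u_def mono_fun_unit)
    also have "\<dots> = 1" by (rule one[OF q])
    finally have s: "(\<Sum>a\<in>u ` {1..nn S}. C a q * mono_fun (nn S) x a q) = 1" .
    have "(\<lambda>_. 0) \<notin> u ` {1..nn S}" using u_nz by (metis imageE)
    then have "(\<Sum>a\<in>?A. C a q * mono_fun (nn S) x a q) =
       C (\<lambda>_. 0) q * mono_fun (nn S) x (\<lambda>_. 0) q + (\<Sum>a\<in>u ` {1..nn S}. C a q * mono_fun (nn S) x a q)"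
      by (intro sum.insert) auto
    then show "(\<Sum>a\<in>?A. C a q * mono_fun (nn S) x a q) = 0"
      using s by (simp add: C_def)
  qed (use p in auto)
  then show False by (simp add: C_def)
qed

end

section \<open>Good invariants\<close>

lemma (in flat_coordinates) Y_nonempty: "\<exists>p. p \<in> Y S"
proof -
  have ind: "independent {va S, vdelta S}" "va S \<noteq> vdelta S"
    using marking by (auto simp: marking_def)
  obtain f :: "'v \<Rightarrow> complex" where f: "linear f"
    "\<forall>v\<in>{va S, vdelta S}. f v = (if v = va S then - 2 * of_real pi * \<i> else 1)"
    using linear_independent_extend[OF ind(1), of "\<lambda>v. if v = va S then - 2 * of_real pi * \<i> else (1::complex)"] by blast
  have "Blinfun f \<in> Y S"
    using f ind(2) by (simp add: Y_def bounded_linear_Blinfun_apply linear_conv_bounded_linear)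
  then show ?thesis ..
qed

locale good_coordinates = flat_coordinates S g \<zeta> L z
  for S :: "'v::euclidean_space elliptic" and g \<zeta> L z +
  fixes x :: "nat \<Rightarrow> 'v yfun"
  assumes good: "good_invariants S g \<zeta> L x"
    and compat: "compatible S L z x"
begin

abbreviation "Z \<equiv> \<lambda>i. cpair (z i)"

lemma basic_x: "basic_invariants S x"
  using good by (simp add: good_invariants_def)

lemma x_SWm: "i \<in> {1..nn S} \<Longrightarrow> x i \<in> SWm S (dg S i)"
  by (rule basic_SWm[OF basic_x])

lemma x_FY: "i \<in> {1..nn S} \<Longrightarrow> x i \<in> FY S"
  by (rule SWm_FY[OF x_SWm])

lemma good_psi:
  obtains y w \<psi> where "basic_invariants S y" "homogeneous_basis S g \<zeta> L w" "is_psi S L y w \<psi>"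
    "\<forall>\<alpha>\<in>{1..nn S}. x \<alpha> \<in> psi_preimage S L \<psi>"
    "\<forall>f\<in>psi_preimage S L \<psi>. \<exists>c. \<forall>p\<in>Y S. f p = (\<Sum>\<alpha>=1..nn S. c \<alpha> * x \<alpha> p)"
  using good unfolding good_invariants_def by (elim exE conjE)

text \<open>If some generator had degree 0, every sum in \<^const>\<open>psi_mono\<close> would range over an infinite
  set and hence be 0; then 1 would lie in the preimage of the linear forms.\<close>

lemma dg_pos:
  assumes i: "i \<in> {1..nn S}"
  shows "dg S i > 0"
proof (rule ccontr)
  assume "\<not> dg S i > 0"
  then have d0: "dg S i = 0" by simp
  obtain y w \<psi> where y: "basic_invariants S y" and psi: "is_psi S L y w \<psi>"
    and pre: "\<forall>f\<in>psi_preimage S L \<psi>. \<exists>c. \<forall>p\<in>Y S. f p = (\<Sum>\<alpha>=1..nn S. c \<alpha> * x \<alpha> p)"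
    by (rule good_psi)
  define u :: "nat \<Rightarrow> nat \<Rightarrow> nat" where "u = (\<lambda>k. (\<lambda>_. 0)(i := k))"
  have "u k \<in> {b. b \<in> midx (nn S) \<and> ddot S b = ddot S (\<lambda>_. 0)}" for k
    using i d0 by (auto simp: u_def midx_def ddot_def)
  moreover have "inj u" by (auto simp: inj_def u_def fun_eq_iff)
  ultimately have inf: "infinite {b. b \<in> midx (nn S) \<and> ddot S b = ddot S (\<lambda>_. 0)}"
    using range_inj_infinite[of u] by (meson finite_subset image_subsetI)
  have "\<psi> (mono_fun (nn S) y (\<lambda>_. 0)) p = 0" if p: "p \<in> Y S" for p
  proof -
    have "(\<lambda>_. 0) \<in> midx (nn S)" by (simp add: midx_def)
    then have "\<psi> (mono_fun (nn S) y (\<lambda>_. 0)) p = psi_mono S L y w (\<lambda>_. 0) p"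
      using psi p unfolding is_psi_def by blast
    also have "\<dots> = 0" unfolding psi_mono_def by (rule sum.infinite[OF inf])
    finally show ?thesis .
  qed
  then have psi1: "\<psi> (\<lambda>_. 1) p = cpair 0 p" if "p \<in> Y S" for p
    using that by simp
  have "(\<lambda>_. 1) \<in> SW S" by (rule SWm_SW[OF SWm_FH[OF FH_const]])
  moreover have "0 \<in> cspace L" using subspace_0[OF subspace_L] by (simp add: cspace_def zero_prod_def)
  ultimately have "(\<lambda>_. 1) \<in> psi_preimage S L \<psi>"
    unfolding psi_preimage_def using psi1 by blast
  from bspec[OF pre this] obtain c where c: "\<forall>p\<in>Y S. 1 = (\<Sum>\<alpha>=1..nn S. c \<alpha> * x \<alpha> p)" ..
  obtain p where "p \<in> Y S" using Y_nonempty by blast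
  from basic_not_constant[OF basic_x this, of c] c show False by metis
qed

section \<open>Weights modulo d_n and values on the orthogonal locus\<close>

lemma zeta_power_ne:
  assumes "j < k" "k < j + dg S (nn S)"
  shows "\<zeta> ^ j \<noteq> \<zeta> ^ k"
proof
  assume "\<zeta> ^ j = \<zeta> ^ k"
  then have "dg S (nn S) dvd k - j" using primitive_root_power_eq[OF prim] assms by simp
  then show False using assms by (auto dest: dvd_imp_le)
qed

lemma cform_csc: "cform S (csc c u) u' = c * cform S u u'" "cform S u (csc c u') = c * cform S u u'"
proof -
  show *: "cform S (csc c u) u' = c * cform S u u'" for c u u'
    using cpair_form_dual[of "csc c u" u'] cpair_form_dual[of u u'] by simp
  show "cform S u (csc c u') = c * cform S u u'"
    using *[of c u' u] by (simp only: cform_sym)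
qed

text \<open>The vectors z^\<alpha> and z^(n-\<alpha>) pair to 1 and \<open>g\<close> is an isometry,
  so d_n divides the sum of their weights. In codimension one both weights lie strictly between 0
  and d_n, which leaves only d_n itself.\<close>

lemma duality:
  assumes "\<alpha> \<le> nn S"
  shows "dg S \<alpha> + dg S (nn S - \<alpha>) = dg S (nn S)"
proof (cases "\<alpha> = 0 \<or> \<alpha> = nn S")
  case False
  then have r: "\<alpha> < nn S" "nn S - \<alpha> < nn S" "nn S - \<alpha> \<le> nn S" "\<alpha> \<in> {1..nn S}" using assms by auto
  have "cform S (z \<alpha>) (z (nn S - \<alpha>)) = 1" using z_form[OF assms r(3)] assms by simp
  moreover have "cform S (cmap g (z \<alpha>)) (cmap g (z (nn S - \<alpha>))) = cform S (z \<alpha>) (z (nn S - \<alpha>))"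
    by (rule cform_cmap[OF isom_g])
  ultimately have "\<zeta> ^ (dg S \<alpha> + dg S (nn S - \<alpha>)) = 1"
    unfolding z_g[OF assms] z_g[OF r(3)] by (simp add: cform_csc power_add mult.commute)
  then have "dg S (nn S) dvd dg S \<alpha> + dg S (nn S - \<alpha>)"
    by (rule primitive_root_power_eq_one[OF prim])
  then obtain k where k: "dg S \<alpha> + dg S (nn S - \<alpha>) = dg S (nn S) * k" ..
  have "0 < dg S \<alpha> + dg S (nn S - \<alpha>)" "dg S \<alpha> + dg S (nn S - \<alpha>) < dg S (nn S) * 2"
    using dg_lt_top[OF r(1)] dg_lt_top[OF r(2)] dg_pos[OF r(4)] by linarith+
  then have "0 < k" "k < 2" unfolding k by auto
  then show ?thesis using k by (simp add: less_2_cases_iff)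
qed auto

text \<open>The value of x^n on \<open>Lperp\<close>: by compatibility the derivative in z^n is 1
  there, and the Euler relation reads \<open>euler_const\<close> = d_n x^n.\<close>

definition K :: complex where
  "K = euler_const / of_nat (dg S (nn S))"

lemma pd_x:
  assumes "i \<in> {1..nn S}" "j \<in> {1..nn S}" "p \<in> Lperp S L"
  shows "pd S z j (x i) p = (if i = j then 1 else 0)"
  using compat assms unfolding compatible_def by blast

lemma x_top_Lperp:
  assumes p: "p \<in> Lperp S L"
  shows "x (nn S) p = K"
proof -
  have "euler_const * pd S z (nn S) (x (nn S)) p = of_nat (dg S (nn S)) * x (nn S) p"
    by (rule SWm_euler[OF x_SWm[OF top_index(1)] flat.Lperp_Y[OF p]])
  then show ?thesis
    using pd_x[OF top_index(1) top_index(1) p] dg_top_pos by (simp add: K_def field_simps)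
qed

text \<open>Points of \<open>Lperp\<close> are fixed by the transpose of \<open>g\<close>, so f =
  \<zeta>^m f there, and \<zeta>^m differs from 1.\<close>

lemma basic_Lperp_zero:
  assumes f: "f \<in> SWm S m" and m: "0 < m" "m < dg S (nn S)" and p: "p \<in> Lperp S L"
  shows "f p = 0"
proof -
  have "f p = \<zeta> ^ m * f p"
    using SWm_pull_g[OF f flat.Lperp_Y[OF p]] flat.pull_Lperp[OF p] by simp
  moreover have "\<zeta> ^ 0 \<noteq> \<zeta> ^ m" by (rule zeta_power_ne) (use m in auto)
  ultimately show ?thesis by simp
qed

text \<open>The deviation from the restriction has order at least 1 and transforms under
  \<open>g\<close> like \<open>f\<close>. The weights from 1 to m - 1 have the wrong residue modulo
  d_n.\<close>

lemma van_equivariant_deviation: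
  assumes w: "equivariant_coordinates S w e' L g \<zeta>" and f: "f \<in> SWm S m" and m: "0 < m" "m \<le> dg S (nn S)"
  shows "van S L w {1..nn S} m (\<lambda>q. f q - res S L f q)"
proof -
  interpret w: equivariant_coordinates S w e' L g \<zeta> by (rule w)
  have F: "f \<in> FY S" by (rule SWm_FY[OF f])
  have FD: "(\<lambda>q. f q - f (w.proj q)) \<in> FY S" by (intro FY_diff F w.FY_res)
  have "van S L w {1..nn S} 1 (\<lambda>q. f q - f (w.proj q))"
  proof (rule w.vanI[OF order_refl FD])
    fix i assume i: "i \<in> {1..nn S}"
    then have "1 - dg S i = 0" "i \<le> nn S" using dg_pos[OF i] by auto
    then show "van S L w {1..nn S} (1 - dg S i) (pd S w i (\<lambda>q. f q - f (w.proj q)))"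
      using w.van_0[OF order_refl w.FY_pd[OF FD]] by simp
  qed (simp add: w.proj_id)
  then have "van S L w {1..nn S} m (\<lambda>q. f q - f (w.proj q))"
  proof (rule w.van_improve[OF order_refl])
    fix p assume p: "p \<in> Y S"
    have "w.proj (pull g p) = w.proj p"
      by (rule w.proj_eqI[OF w.pull_Y[OF p] w.proj_Lperp[OF p]]) (simp add: w.pull_vdelta[OF p])
    moreover have "f (w.proj p) = \<zeta> ^ m * f (w.proj p)"
      using SWm_pull_g[OF f w.proj_Y[OF p]] w.pull_Lperp[OF w.proj_Lperp[OF p]] by simp
    ultimately show "f (pull g p) - f (w.proj (pull g p)) = \<zeta> ^ m * (f p - f (w.proj p))"
      using SWm_pull_g[OF f p] by (simp only: right_diff_distrib)
  next
    fix k assume "1 \<le> k" "k < m"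
    then show "\<zeta> ^ k \<noteq> \<zeta> ^ m" using zeta_power_ne[of k m] m by simp
  qed
  then show ?thesis
    by (rule w.van_cong[OF order_refl]) (simp only: w.res_eq)
qed

text \<open>A monomial of degree at most d_n either avoids the top generator, and then its factors
  have degree below d_n and vanish on \<open>Lperp\<close>, or is the top generator itself. In both
  cases the monomial in the deviations, which enters \<psi>, is the deviation of the
  monomial.\<close>

lemma mono_fun_deviation:
  assumes y: "basic_invariants S y" and a: "a \<in> midx (nn S)" and m: "0 < ddot S a" "ddot S a \<le> dg S (nn S)"
    and p: "p \<in> Y S"
  shows "mono_fun (nn S) (\<lambda>\<gamma> q. y \<gamma> q - res S L (y \<gamma>) q) a p =
    mono_fun (nn S) y a p - mono_fun (nn S) y a (flat.proj p)"
proof (cases "a (nn S) = 0")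
  case True
  note q = flat.proj_Lperp[OF p]
  have y0: "y i (flat.proj p) = 0" if i: "i \<in> {1..nn S}" "a i > 0" for i
  proof -
    have "i < nn S" using i True by (cases "i = nn S") auto
    then show ?thesis
      by (intro basic_Lperp_zero[OF basic_SWm[OF y i(1)] dg_pos[OF i(1)] dg_lt_top q])
  qed
  have "(\<Prod>i=1..nn S. (y i p - res S L (y i) p) ^ a i) = (\<Prod>i=1..nn S. y i p ^ a i)"
  proof (rule prod.cong[OF refl])
    fix i assume i: "i \<in> {1..nn S}"
    show "(y i p - res S L (y i) p) ^ a i = y i p ^ a i"
      using y0[OF i] flat.res_eq[OF p, of "y i"] by (cases "a i = 0") auto
  qed
  moreover have "\<exists>i\<in>{1..nn S}. a i > 0"
  proof (rule ccontr)
    assume "\<not> ?thesis"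
    then have "ddot S a = 0" unfolding ddot_def by (intro sum.neutral) auto
    then show False using m(1) by simp
  qed
  then obtain i where i: "i \<in> {1..nn S}" "a i > 0" by blast
  have "(\<Prod>i=1..nn S. y i (flat.proj p) ^ a i) = 0"
  proof (rule prod_zero)
    show "\<exists>i\<in>{1..nn S}. y i (flat.proj p) ^ a i = 0" using i y0[OF i] by (intro bexI[of _ i]) auto
  qed simp
  ultimately show ?thesis by (simp add: mono_fun_def)
next
  case False
  have "ddot S a = dg S (nn S) * a (nn S) + (\<Sum>i\<in>{1..nn S} - {nn S}. dg S i * a i)"
    unfolding ddot_def by (rule sum.remove) auto
  moreover have "dg S (nn S) \<le> dg S (nn S) * a (nn S)" using False by simp
  ultimately have eq: "dg S (nn S) * a (nn S) = dg S (nn S)" "(\<Sum>i\<in>{1..nn S} - {nn S}. dg S i * a i) = 0"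
    using m(2) by linarith+
  have a1: "a (nn S) = 1" using eq(1) dg_top_pos by simp
  have a0: "a i = 0" if "i \<in> {1..nn S}" "i \<noteq> nn S" for i
  proof -
    have "\<forall>i\<in>{1..nn S} - {nn S}. dg S i * a i = 0"
      using eq(2) by (simp add: sum_eq_0_iff)
    then have "dg S i * a i = 0" by (rule bspec) (use that in blast)
    then show ?thesis using dg_pos[OF that(1)] by simp
  qed
  have "a = (\<lambda>_. 0)(nn S := 1)"
  proof
    fix i
    show "a i = ((\<lambda>_. 0)(nn S := 1)) i"
      using a a0[of i] a1 by (cases "i \<in> {1..nn S}") (auto simp: midx_def)
  qed
  then show ?thesis
    by (simp only: mono_fun_unit[OF top_index(1)] flat.res_eq[OF p])
qed

text \<open>By \<open>mono_fun_deviation\<close> the deviation of x^\<alpha> has \<psi>(x^\<alpha>)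
  as its part of weight d_\<alpha>, and goodness makes this a linear form. Compatibility identifies
  it with z^\<alpha> at this order, and \<open>g\<close> then rules out the intermediate
  weights.\<close>

lemma van_x:
  assumes \<alpha>: "\<alpha> \<in> {1..nn S}"
  shows "van S L z {1..nn S} (dg S \<alpha> + dg S (nn S)) (\<lambda>p. x \<alpha> p - (if \<alpha> = nn S then K else 0) - Z \<alpha> p)"
proof -
  let ?I = "{1..nn S}" and ?d = "dg S \<alpha>"
  obtain y w \<psi> where y: "basic_invariants S y" and hw: "homogeneous_basis S g \<zeta> L w"
    and psi: "is_psi S L y w \<psi>" and pre: "\<forall>\<alpha>\<in>?I. x \<alpha> \<in> psi_preimage S L \<psi>"
    by (rule good_psi)
  obtain e' where we: "equivariant_coordinates S w e' L g \<zeta>"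
    and wz: "\<And>m F. van S L w ?I m F \<Longrightarrow> van S L z ?I m F"
    using homogeneous_basis_coordinates[OF hw dg_pos] by blast
  interpret w: equivariant_coordinates S w e' L g \<zeta> by (rule we)
  have d: "0 < ?d" "?d \<le> dg S (nn S)" using dg_pos[OF \<alpha>] dg_le_top[of \<alpha>] \<alpha> by auto
  obtain A c where A: "FH_coeffs S A c" "\<forall>a\<in>A. ddot S a = ?d"
    "\<forall>p\<in>Y S. x \<alpha> p = (\<Sum>a\<in>A. c a p * mono_fun (nn S) y a p)"
    using homogeneous_expansion[OF y x_SWm[OF \<alpha>]] by (elim exE conjE)
  note Ad = bspec[OF A(2)] and Ax = bspec[OF A(3)]
  have Am: "a \<in> midx (nn S)" "c a \<in> FH S" if "a \<in> A" for a using A(1) that by (auto simp: FH_coeffs_def)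
  let ?F = "mono_fun (nn S) (\<lambda>\<gamma> q. y \<gamma> q - res S L (y \<gamma>) q)"
  have vF: "van S L w ?I (ddot S a) (?F a)" if "a \<in> A" for a
  proof (rule w.van_mono_fun[OF order_refl dg_pos])
    fix i assume i: "i \<in> ?I"
    show "van S L w ?I (dg S i) (\<lambda>q. y i q - res S L (y i) q)"
      by (rule van_equivariant_deviation[OF we basic_SWm[OF y i] dg_pos[OF i] dg_le_top]) (use i in simp)
  qed
  \<comment> \<open>By \<open>van_taylor\<close>, \<open>psi_mono\<close> is the part of weight
    d_\<alpha> of the monomial in the deviations.\<close>
  have "van S L w ?I (?d + 1) (\<lambda>p. c a p * (?F a p - psi_mono S L y w a p))" if a: "a \<in> A" for a
  proof (rule w.van_mult_left[OF order_refl w.fibre_const_FH[OF Am(2)[OF a]]])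
    show "van S L w ?I (?d + 1) (\<lambda>p. ?F a p - psi_mono S L y w a p)"
      using w.van_taylor[OF dg_pos vF[OF a]] unfolding psi_mono_def Ad[OF a] .
  qed
  then have "van S L w ?I (?d + 1) (\<lambda>p. \<Sum>a\<in>A. c a p * (?F a p - psi_mono S L y w a p))"
    by (rule w.van_sum[OF order_refl])
  then have 1: "van S L z ?I (?d + 1) (\<lambda>p. \<Sum>a\<in>A. c a p * (?F a p - psi_mono S L y w a p))"
    by (rule wz)
  obtain v where v: "v \<in> cspace L" "\<And>p. p \<in> Y S \<Longrightarrow> \<psi> (x \<alpha>) p = cpair v p"
    using pre \<alpha> unfolding psi_preimage_def by blast
  have "\<exists>k. v = (\<Sum>i\<in>?I. csc (k i) (z i))"
    using basis_L v(1) unfolding cbasis_def by blast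
  then obtain k where k: "v = (\<Sum>i\<in>?I. csc (k i) (z i))" ..
  have psi_x: "(\<Sum>a\<in>A. c a p * psi_mono S L y w a p) = (\<Sum>i\<in>?I. k i * Z i p)" if p: "p \<in> Y S" for p
  proof -
    have "(\<Sum>a\<in>A. c a p * psi_mono S L y w a p) = \<psi> (\<lambda>q. \<Sum>a\<in>A. c a q * mono_fun (nn S) y a q) p"
      by (rule is_psi_sum[OF psi y p A(1) Ad, symmetric])
    \<comment> \<open>The expansion equals x^\<alpha> only on Y, whereas \<psi> takes total
      functions.\<close>
    also have "\<dots> = \<psi> (x \<alpha>) p"
    proof (rule is_psi_cong[OF psi _ x_SWm[OF \<alpha>] _ p])
      show "(\<lambda>q. \<Sum>a\<in>A. c a q * mono_fun (nn S) y a q) \<in> SWm S ?d"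
      proof (rule SWm_sum)
        fix a assume a: "a \<in> A"
        show "(\<lambda>q. c a q * mono_fun (nn S) y a q) \<in> SWm S ?d"
          using SWm_FH_mult[OF Am(2)[OF a] SWm_mono_fun[OF basic_SWm[OF y] Am(1)[OF a]]] by (simp only: Ad[OF a])
      qed
    qed (simp add: Ax)
    also have "\<dots> = cpair v p" by (rule v(2)[OF p])
    also have "\<dots> = (\<Sum>i\<in>?I. k i * Z i p)" unfolding k by (simp only: cpair_sum_left cpair_csc)
    finally show ?thesis .
  qed
  have x_dev: "(\<Sum>a\<in>A. c a p * ?F a p) = x \<alpha> p - x \<alpha> (flat.proj p)" if p: "p \<in> Y S" for p
  proof -
    have "(\<Sum>a\<in>A. c a p * ?F a p) =
      (\<Sum>a\<in>A. c a p * mono_fun (nn S) y a p - c a (flat.proj p) * mono_fun (nn S) y a (flat.proj p))"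
    proof (rule sum.cong[OF refl])
      fix a assume a: "a \<in> A"
      have "?F a p = mono_fun (nn S) y a p - mono_fun (nn S) y a (flat.proj p)"
        by (rule mono_fun_deviation[OF y Am(1)[OF a] _ _ p]) (use d Ad[OF a] in auto)
      then show "c a p * ?F a p = c a p * mono_fun (nn S) y a p - c a (flat.proj p) * mono_fun (nn S) y a (flat.proj p)"
        by (simp only: flat.FH_proj[OF Am(2)[OF a] p] right_diff_distrib)
    qed
    then show ?thesis
      using Ax[OF p] Ax[OF flat.proj_Y[OF p]] by (simp only: sum_subtractf)
  qed
  define H where "H = (\<lambda>p. x \<alpha> p - (if \<alpha> = nn S then K else 0) - (\<Sum>i\<in>?I. k i * Z i p))"
  have x_proj: "x \<alpha> (flat.proj p) = (if \<alpha> = nn S then K else 0)" if p: "p \<in> Y S" for p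
  proof (cases "\<alpha> = nn S")
    case True
    then show ?thesis using x_top_Lperp[OF flat.proj_Lperp[OF p]] by simp
  next
    case False
    then have "\<alpha> < nn S" using \<alpha> by simp
    then show ?thesis
      using basic_Lperp_zero[OF x_SWm[OF \<alpha>] d(1) dg_lt_top flat.proj_Lperp[OF p]] False by simp
  qed
  have vH: "van S L z ?I (?d + 1) H"
    by (rule flat.van_cong[OF order_refl 1])
       (simp only: H_def right_diff_distrib sum_subtractf psi_x x_dev x_proj)
  have pdH: "pd S z j H p = (if \<alpha> = j then 1 else 0) - k j" if j: "j \<in> ?I" and p: "p \<in> Lperp S L" for j p
  proof -
    have j': "j \<le> nn S" using j by simp
    note pY = flat.Lperp_Y[OF p]
    have zY: "(\<lambda>p. k i * Z i p) \<in> FY S" for i by auto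
    have "pd S z j H p = pd S z j (\<lambda>p. x \<alpha> p - (if \<alpha> = nn S then K else 0)) p - pd S z j (\<lambda>p. \<Sum>i\<in>?I. k i * Z i p) p"
      unfolding H_def by (rule flat.pd_diff[OF j' FY_diff[OF x_FY[OF \<alpha>] FY_const] FY_sum[OF zY] pY])
    also have "pd S z j (\<lambda>p. x \<alpha> p - (if \<alpha> = nn S then K else 0)) p = pd S z j (x \<alpha>) p"
      using flat.pd_diff[OF j' x_FY[OF \<alpha>] FY_const pY] flat.pd_const[OF j'] by simp
    also have "\<dots> = (if \<alpha> = j then 1 else 0)" by (rule pd_x[OF \<alpha> j p])
    also have "pd S z j (\<lambda>p. \<Sum>i\<in>?I. k i * Z i p) p = (\<Sum>i\<in>?I. pd S z j (\<lambda>p. k i * Z i p) p)"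
      by (rule flat.pd_sum[OF j' zY pY])
    also have "\<dots> = (\<Sum>i\<in>?I. if i = j then k i else 0)"
    proof (rule sum.cong[OF refl])
      fix i assume "i \<in> ?I"
      then have i': "i \<le> nn S" by simp
      show "pd S z j (\<lambda>p. k i * Z i p) p = (if i = j then k i else 0)"
        unfolding flat.pd_cmult[OF j' FY_cpair pY] flat.pd_coord[OF j' i'] by simp
    qed
    also have "\<dots> = k j" using j by (simp only: sum.delta finite_atLeastAtMost if_True)
    finally show ?thesis .
  qed
  \<comment> \<open>Coordinates of weight above d_\<alpha> do not matter at this order. For the
    others the derivative of \<open>H\<close> in z^i still has positive order, so it vanishes on
    \<open>Lperp\<close> and determines k_i.\<close>
  have corr: "van S L z ?I (?d + 1) (\<lambda>p. (k i - (if \<alpha> = i then 1 else 0)) * Z i p)" if i: "i \<in> ?I" for i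
  proof (cases "dg S i \<le> ?d")
    case False
    then have "van S L z ?I (?d + 1) (Z i)"
      using flat.van_antimono[OF order_refl flat.van_coord(1)[OF order_refl i]] by simp
    then show ?thesis by (rule flat.van_mult_left[OF order_refl flat.fibre_const_const])
  next
    case True
    have cY: "(\<lambda>p. (k i - (if \<alpha> = i then 1 else 0)) * Z i p) \<in> FY S" by auto
    show ?thesis
    proof (cases "\<exists>p. p \<in> Lperp S L")
      case False
      then show ?thesis using cY by (auto simp: van_def)
    next
      case ex: True
      then obtain p where p: "p \<in> Lperp S L" ..
      have "pd S z i H p = 0"
        by (rule flat.van_Lperp[OF flat.van_pd[OF order_refl vH i] _ p]) (use True in simp)
      then have "k i - (if \<alpha> = i then 1 else 0) = 0" using pdH[OF i p] by simp
      then show ?thesis using flat.van_zero[OF order_refl] by simp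
    qed
  qed
  have "van S L z ?I (?d + 1) (\<lambda>p. H p + (\<Sum>i\<in>?I. (k i - (if \<alpha> = i then 1 else 0)) * Z i p))"
    by (rule flat.van_add[OF order_refl vH flat.van_sum[OF order_refl corr]])
  then have "van S L z ?I (?d + 1) (\<lambda>p. x \<alpha> p - (if \<alpha> = nn S then K else 0) - Z \<alpha> p)"
  proof (rule flat.van_cong[OF order_refl])
    fix p assume "p \<in> Y S"
    have "(\<Sum>i\<in>?I. (if \<alpha> = i then 1 else 0) * Z i p) = (\<Sum>i\<in>?I. if \<alpha> = i then Z i p else 0)"
      by (rule sum.cong) auto
    also have "\<dots> = Z \<alpha> p" using \<alpha> by (simp only: sum.delta' finite_atLeastAtMost if_True)
    finally have "(\<Sum>i\<in>?I. (k i - (if \<alpha> = i then 1 else 0)) * Z i p) = (\<Sum>i\<in>?I. k i * Z i p) - Z \<alpha> p"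
      by (simp only: left_diff_distrib sum_subtractf)
    then show "H p + (\<Sum>i\<in>?I. (k i - (if \<alpha> = i then 1 else 0)) * Z i p) =
        x \<alpha> p - (if \<alpha> = nn S then K else 0) - Z \<alpha> p"
      by (simp only: H_def) simp
  qed
  \<comment> \<open>The next weight after d_\<alpha> with the same residue modulo d_n is d_\<alpha>
    + d_n.\<close>
  then show ?thesis
  proof (rule flat.van_improve[OF order_refl, where m = ?d])
    fix p assume p: "p \<in> Y S"
    have "\<alpha> \<le> nn S" using \<alpha> by simp
    have "Z \<alpha> (pull g p) = \<zeta> ^ ?d * Z \<alpha> p"
      unfolding cpair_pull[OF isom_g] z_g[OF \<open>\<alpha> \<le> nn S\<close>] by simp
    \<comment> \<open>The constant K is compatible with the action because \<zeta>^d_n = 1.\<close>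
    moreover have "(if \<alpha> = nn S then K else 0) = \<zeta> ^ ?d * (if \<alpha> = nn S then K else 0)"
      using prim by (simp add: primitive_root_def)
    ultimately show "x \<alpha> (pull g p) - (if \<alpha> = nn S then K else 0) - Z \<alpha> (pull g p) =
       \<zeta> ^ ?d * (x \<alpha> p - (if \<alpha> = nn S then K else 0) - Z \<alpha> p)"
      using SWm_pull_g[OF x_SWm[OF \<alpha>] p] by (simp only: right_diff_distrib)
  next
    fix j assume "?d + 1 \<le> j" "j < ?d + dg S (nn S)"
    then show "\<zeta> ^ j \<noteq> \<zeta> ^ ?d" using zeta_power_ne[of ?d j] by auto
  qed
qed

end

section \<open>The bilinear form on invariants\<close>

context taylor_coordinates
begin

lemma mpd_const_Lperp:
  assumes "b \<in> midx (nn S)" "b \<noteq> (\<lambda>_. 0)" "p \<in> Lperp S L"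
  shows "mpd S z b (\<lambda>_. k) p = 0"
proof -
  have "mpd S z b (\<lambda>p. k * mono_fun (nn S) Z (\<lambda>_. 0) p) p = k * mpd S z b (mono_fun (nn S) Z (\<lambda>_. 0)) p"
    by (rule mpd_mult_left[OF assms(1) fibre_const_const FY_mono_fun[OF FY_cpair] Lperp_Y[OF assms(3)]])
  also have "mpd S z b (mono_fun (nn S) Z (\<lambda>_. 0)) p = 0"
  proof -
    have "(\<lambda>_. 0) \<in> midx (nn S)" by (simp add: midx_def)
    from mpd_mono_fun[OF assms(1) this assms(3)] show ?thesis
      unfolding if_not_P[OF assms(2)[symmetric]] .
  qed
  finally show ?thesis by (simp only: mono_fun_zero mult_1_right mult_zero_right)
qed

lemma van_mpd: "van S L z J w f \<Longrightarrow> supp_in J b \<Longrightarrow> ddot S b < w \<Longrightarrow> p \<in> Lperp S L \<Longrightarrow> mpd S z b f p = 0"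
  unfolding van_def by blast

text \<open>Functions with leading parts z^i have monomials with the corresponding leading
  monomials; the difference of the products is telescoped one factor at a time.\<close>

lemma van_mono_fun_diff:
  assumes J: "J \<subseteq> {1..nn S}" and pos: "\<And>i. i \<in> J \<Longrightarrow> dg S i > 0"
    and F: "\<And>i. i \<in> J \<Longrightarrow> van S L z J (dg S i + 1) (\<lambda>p. F i p - Z i p)"
    and b: "supp_in J b"
  shows "van S L z J (ddot S b + 1) (\<lambda>p. mono_fun (nn S) F b p - mono_fun (nn S) Z b p)"
    and "van S L z J (ddot S b) (mono_fun (nn S) F b)"
proof -
  have fJ: "finite J" using J finite_subset by blast
  have vZ: "van S L z J (dg S i) (Z i)" if "i \<in> J" for i
    by (rule van_coord(1)[OF J]) (use that J in blast)
  have vF: "van S L z J (dg S i) (F i)" if i: "i \<in> J" for i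
  proof -
    have "van S L z J (dg S i) (\<lambda>p. F i p - Z i p)"
      by (rule van_antimono[OF J F[OF i]]) simp
    from van_add[OF J this vZ[OF i]] show ?thesis by simp
  qed
  have "van S L z J (ddot S b + 1) (\<lambda>p. mono_fun (nn S) F b p - mono_fun (nn S) Z b p) \<and>
    van S L z J (ddot S b) (mono_fun (nn S) F b)"
    using fJ b
  proof (induction b rule: supp_in_induct)
    case zero
    then show ?case using van_zero[OF J] van_0[OF J FY_const] by simp
  next
    case (inc b i)
    have i: "i \<in> {1..nn S}" using inc.hyps(2) J by blast
    have 1: "van S L z J (ddot S b + dg S i + 1) (\<lambda>p. (F i p - Z i p) * mono_fun (nn S) F b p)"
      by (rule van_mult[OF J pos F[OF inc.hyps(2)] inc.IH[THEN conjunct2]]) auto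
    have 2: "van S L z J (ddot S b + dg S i + 1) (\<lambda>p. Z i p * (mono_fun (nn S) F b p - mono_fun (nn S) Z b p))"
      by (rule van_mult[OF J pos vZ[OF inc.hyps(2)] inc.IH[THEN conjunct1]]) auto
    have 3: "van S L z J (ddot S b + dg S i) (\<lambda>p. F i p * mono_fun (nn S) F b p)"
      by (rule van_mult[OF J pos vF[OF inc.hyps(2)] inc.IH[THEN conjunct2]]) auto
    have "van S L z J (ddot S b + dg S i + 1)
        (\<lambda>p. mono_fun (nn S) F (b(i := b i + 1)) p - mono_fun (nn S) Z (b(i := b i + 1)) p)"
      by (rule van_cong[OF J van_add[OF J 1 2]]) (simp only: mono_fun_inc[OF i], simp add: algebra_simps)
    moreover have "van S L z J (ddot S b + dg S i) (mono_fun (nn S) F (b(i := b i + 1)))"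
      by (rule van_cong[OF J 3]) (simp only: mono_fun_inc[OF i])
    ultimately show ?case unfolding ddot_inc[OF i] by blast
  qed
  then show "van S L z J (ddot S b + 1) (\<lambda>p. mono_fun (nn S) F b p - mono_fun (nn S) Z b p)"
    and "van S L z J (ddot S b) (mono_fun (nn S) F b)" by blast+
qed

end

lemma mono_fun_split:
  assumes "n \<ge> 1"
  shows "mono_fun n F b p = mono_fun n F (b(n := 0)) p * F n p ^ b n"
proof -
  have n: "n \<in> {1..n}" using assms by simp
  have "(\<Prod>i\<in>{1..n} - {n}. F i p ^ (b(n := 0)) i) = (\<Prod>i\<in>{1..n} - {n}. F i p ^ b i)"
    by (rule prod.cong) auto
  then show ?thesis
    unfolding mono_fun_def prod.remove[OF finite_atLeastAtMost n] by simp
qed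

lemma ddot_split: "ddot S b = ddot S (b(nn S := 0)) + dg S (nn S) * b (nn S)"
proof -
  have n: "nn S \<in> {1..nn S}" by simp
  have "(\<Sum>i\<in>{1..nn S} - {nn S}. dg S i * (b(nn S := 0)) i) = (\<Sum>i\<in>{1..nn S} - {nn S}. dg S i * b i)"
    by (rule sum.cong) auto
  then show ?thesis
    unfolding ddot_def sum.remove[OF finite_atLeastAtMost n] by simp
qed

context good_coordinates
begin

text \<open>If K were 0, so would be the Euler constant, and the Euler relation would make x^n
  vanish on Y, although its derivative in z^n is 1 on \<open>Lperp\<close>.\<close>

lemma K_nz: "K \<noteq> 0"
proof
  assume "K = 0"
  then have ec: "euler_const = 0" using dg_top_pos by (simp add: K_def)
  have "of_nat (dg S (nn S)) * x (nn S) p = 0" if "p \<in> Y S" for p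
    using SWm_euler[OF x_SWm[OF top_index(1)] that] ec by simp
  then have xz: "x (nn S) p = 0" if "p \<in> Y S" for p using that dg_top_pos by simp
  obtain p where p: "p \<in> Y S" using Y_nonempty by blast
  have q: "flat.proj p \<in> Lperp S L" by (rule flat.proj_Lperp[OF p])
  have "pd S z (nn S) (x (nn S)) (flat.proj p) = pd S z (nn S) (\<lambda>_. 0) (flat.proj p)"
    by (rule flat.pd_cong[OF x_FY[OF top_index(1)] top_index(2) flat.Lperp_Y[OF q]]) (rule xz)
  then show False
    using pd_x[OF top_index(1) top_index(1) q] flat.pd_const[OF top_index(2), of 0] by simp
qed

text \<open>The weight is d_\<alpha> + d_n - d_\<gamma>, rewritten by duality. For \<gamma> = 0
  differentiation costs no weight, and the formula remains right since n - \<gamma> = n.\<close>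

lemma van_pd_x:
  assumes \<alpha>: "\<alpha> \<in> {1..nn S}" and \<gamma>: "\<gamma> \<le> nn S"
  shows "van S L z {1..nn S} (dg S \<alpha> + dg S (nn S - \<gamma>)) (\<lambda>p. pd S z \<gamma> (x \<alpha>) p - (if \<alpha> = \<gamma> then 1 else 0))"
proof -
  let ?H = "\<lambda>p. x \<alpha> p - (if \<alpha> = nn S then K else 0) - Z \<alpha> p"
  have \<alpha>': "\<alpha> \<le> nn S" using \<alpha> by simp
  have eq: "pd S z \<gamma> ?H p = pd S z \<gamma> (x \<alpha>) p - (if \<alpha> = \<gamma> then 1 else 0)" if p: "p \<in> Y S" for p
  proof -
    have "pd S z \<gamma> ?H p = pd S z \<gamma> (\<lambda>p. x \<alpha> p - (if \<alpha> = nn S then K else 0)) p - pd S z \<gamma> (Z \<alpha>) p"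
      by (rule flat.pd_diff[OF \<gamma> FY_diff[OF x_FY[OF \<alpha>] FY_const] FY_cpair p])
    also have "pd S z \<gamma> (\<lambda>p. x \<alpha> p - (if \<alpha> = nn S then K else 0)) p = pd S z \<gamma> (x \<alpha>) p"
      unfolding flat.pd_diff[OF \<gamma> x_FY[OF \<alpha>] FY_const p] flat.pd_const[OF \<gamma>] by simp
    also have "pd S z \<gamma> (Z \<alpha>) p = (if \<alpha> = \<gamma> then 1 else 0)"
      unfolding flat.pd_coord[OF \<gamma> \<alpha>'] by auto
    finally show ?thesis .
  qed
  have "van S L z {1..nn S} (dg S \<alpha> + dg S (nn S - \<gamma>)) (pd S z \<gamma> ?H)"
  proof (cases "\<gamma> = 0")
    case True
    then show ?thesis using flat.van_pd0[OF order_refl van_x[OF \<alpha>]] by simp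
  next
    case False
    then have "\<gamma> \<in> {1..nn S}" using \<gamma> by simp
    from flat.van_pd[OF order_refl van_x[OF \<alpha>] this] duality[OF \<gamma>]
    show ?thesis by (elim flat.van_antimono[OF order_refl]) linarith
  qed
  then show ?thesis by (rule flat.van_cong[OF order_refl]) (rule eq)
qed

abbreviation "J0 \<equiv> {1..nn S} - {nn S}"

lemma J0: "J0 \<subseteq> {1..nn S}" and J0_pos: "i \<in> J0 \<Longrightarrow> dg S i > 0"
  using dg_pos by auto

text \<open>The linear term z^n of x^n is invisible to the directions in \<open>J0\<close>, leaving
  only the constant K below weight 2 d_n.\<close>

lemma van_x_top: "van S L z J0 (2 * dg S (nn S)) (\<lambda>p. x (nn S) p - K)"
proof -
  have "van S L z J0 (2 * dg S (nn S)) (\<lambda>p. x (nn S) p - K - Z (nn S) p)"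
    using flat.van_subset[OF van_x[OF top_index(1)] J0] by (simp add: mult_2)
  moreover have "van S L z J0 (2 * dg S (nn S)) (Z (nn S))"
    by (rule flat.van_coord(2)[OF J0 top_index(1)]) simp
  ultimately have "van S L z J0 (2 * dg S (nn S)) (\<lambda>p. x (nn S) p - K - Z (nn S) p + Z (nn S) p)"
    by (rule flat.van_add[OF J0])
  then show ?thesis by simp
qed

lemma van_x_top_power: "van S L z J0 1 (\<lambda>p. x (nn S) p ^ k - K ^ k)"
proof (induction k)
  case 0
  then show ?case using flat.van_zero[OF J0] by simp
next
  case (Suc k)
  have 1: "van S L z J0 1 (\<lambda>p. x (nn S) p - K)"
    by (rule flat.van_antimono[OF J0 van_x_top]) (use dg_top_pos in simp)
  have "van S L z J0 1 (\<lambda>p. (x (nn S) p - K) * x (nn S) p ^ k)"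
    by (rule flat.van_mult[OF J0 J0_pos 1 flat.van_0[OF J0 FY_power[OF x_FY[OF top_index(1)]]]]) auto
  moreover have "van S L z J0 1 (\<lambda>p. K * (x (nn S) p ^ k - K ^ k))"
    by (rule flat.van_mult_left[OF J0 flat.fibre_const_const Suc])
  ultimately have "van S L z J0 1 (\<lambda>p. (x (nn S) p - K) * x (nn S) p ^ k + K * (x (nn S) p ^ k - K ^ k))"
    by (rule flat.van_add[OF J0])
  then show ?case by (simp add: algebra_simps)
qed

text \<open>On the slice the leading part of x^b is K^(b_n) z^b', where b' drops the n-th entry of
  b, and its weight is m - b_n d_n. As b_n \<le> k, a derivative of weight m - k d_n does not go
  beyond this part and can detect it only if b_n = k and b' = c.\<close>

lemma mpd_mono_x:
  assumes b: "b \<in> midx (nn S)" "ddot S b = m" "b (nn S) \<le> k"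
    and c: "supp_in J0 c" "ddot S c + k * dg S (nn S) = m" and p: "p \<in> Lperp S L"
  shows "mpd S z c (mono_fun (nn S) x b) p = (if b = c(nn S := k) then K ^ k * of_nat (mfact (nn S) c) else 0)"
proof -
  let ?n = "nn S"
  define b' where "b' = b(?n := 0)"
  have b': "supp_in J0 b'" using b(1) by (auto simp: supp_in_def b'_def midx_def)
  have b'm: "b' \<in> midx ?n" and cm: "c \<in> midx ?n"
    using flat.supp_midx[OF J0] b' c(1) by auto
  have mb: "ddot S b' + dg S ?n * b ?n = m" using ddot_split[of S b] b(2) by (simp add: b'_def)
  have le: "ddot S c \<le> ddot S b'"
  proof -
    have "b ?n * dg S ?n \<le> k * dg S ?n" by (rule mult_le_mono1[OF b(3)])
    moreover have "ddot S b' + b ?n * dg S ?n = m" using mb by (simp only: mult.commute)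
    ultimately show ?thesis using c(2) by linarith
  qed
  have pY: "p \<in> Y S" by (rule flat.Lperp_Y[OF p])
  have vx: "van S L z J0 (dg S i + 1) (\<lambda>p. x i p - Z i p)" if i: "i \<in> J0" for i
  proof -
    have "i \<in> {1..?n}" "i \<noteq> ?n" using i by auto
    from flat.van_subset[OF van_x[OF this(1)] J0] this(2)
    have "van S L z J0 (dg S i + dg S ?n) (\<lambda>p. x i p - Z i p)" by simp
    then show ?thesis by (rule flat.van_antimono[OF J0]) (use dg_top_pos in linarith)
  qed
  have split: "mono_fun ?n x b p = mono_fun ?n x b' p * x ?n p ^ b ?n" for p
    unfolding b'_def by (rule mono_fun_split) simp
  note vd = flat.van_mono_fun_diff[OF J0 J0_pos vx b']
  have "van S L z J0 (ddot S b' + 1) (\<lambda>p. mono_fun ?n x b' p * (x ?n p ^ b ?n - K ^ b ?n))"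
    by (rule flat.van_mult[OF J0 J0_pos vd(2) van_x_top_power order_refl])
  moreover have "van S L z J0 (ddot S b' + 1) (\<lambda>p. K ^ b ?n * (mono_fun ?n x b' p - mono_fun ?n Z b' p))"
    by (rule flat.van_mult_left[OF J0 flat.fibre_const_const vd(1)])
  ultimately have "van S L z J0 (ddot S b' + 1) (\<lambda>p. mono_fun ?n x b' p * (x ?n p ^ b ?n - K ^ b ?n) +
      K ^ b ?n * (mono_fun ?n x b' p - mono_fun ?n Z b' p))"
    by (rule flat.van_add[OF J0])
  then have v: "van S L z J0 (ddot S b' + 1) (\<lambda>p. mono_fun ?n x b p - K ^ b ?n * mono_fun ?n Z b' p)"
    by (rule flat.van_cong[OF J0]) (simp only: split, simp add: algebra_simps)
  have FYx: "mono_fun ?n x b \<in> FY S" by (rule FY_mono_fun) (rule x_FY)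
  have FYZ: "mono_fun ?n Z b' \<in> FY S" by (rule FY_mono_fun) (rule FY_cpair)
  have "mpd S z c (\<lambda>p. mono_fun ?n x b p - K ^ b ?n * mono_fun ?n Z b' p) p = 0"
    by (rule flat.van_mpd[OF v c(1) _ p]) (use le in simp)
  then have "mpd S z c (mono_fun ?n x b) p = mpd S z c (\<lambda>p. K ^ b ?n * mono_fun ?n Z b' p) p"
    unfolding flat.mpd_diff[OF cm FYx FY_mult[OF FY_const FYZ] pY] by simp
  also have "\<dots> = K ^ b ?n * mpd S z c (mono_fun ?n Z b') p"
    by (rule flat.mpd_mult_left[OF cm flat.fibre_const_const FYZ pY])
  also have "mpd S z c (mono_fun ?n Z b') p = (if b' = c then of_nat (mfact ?n b') else 0)"
    by (rule flat.mpd_mono_fun[OF cm b'm p])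
  also have "K ^ b ?n * (if b' = c then of_nat (mfact ?n b') else 0) =
      (if b = c(?n := k) then K ^ k * of_nat (mfact ?n c) else 0)"
  proof (cases "b = c(?n := k)")
    case True
    have "c ?n = 0" using c(1) by (simp add: supp_in_def)
    then have "b' = c" "b ?n = k" using True by (auto simp: b'_def fun_eq_iff)
    then show ?thesis using True by simp
  next
    case False
    have "b' \<noteq> c"
    proof
      assume eq: "b' = c"
      have "dg S ?n * b ?n = dg S ?n * k"
        using mb c(2) unfolding eq mult.commute[of k "dg S ?n"] by linarith
      then have "b ?n = k" by (simp only: nat_mult_eq_cancel1[OF dg_top_pos])
      then have "b = c(?n := k)" unfolding eq[symmetric] b'_def by (simp only: fun_upd_upd fun_upd_idem)
      then show False using False by blast
    qed
    then show ?thesis using False by simp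
  qed
  finally show ?thesis .
qed

text \<open>Comparing the derivatives of lowest weight forces the coefficient of every monomial
  containing the top generator to vanish, starting with its highest power.\<close>

lemma coefficient_identification:
  assumes A: "FH_coeffs S A c" "\<forall>a\<in>A. ddot S a = m"
    and \<phi>: "van S L z J0 m \<phi>" "\<forall>p\<in>Y S. \<phi> p = (\<Sum>a\<in>A. c a p * mono_fun (nn S) x a p)"
    and p: "p \<in> Lperp S L"
  shows "\<And>a. a \<in> A \<Longrightarrow> a (nn S) \<noteq> 0 \<Longrightarrow> c a p = 0"
    and "\<And>b. b \<in> midx (nn S) \<Longrightarrow> b (nn S) = 0 \<Longrightarrow> ddot S b = m \<Longrightarrow>
      mpd S z b \<phi> p = of_nat (mfact (nn S) b) * (if b \<in> A then c b p else 0)"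
proof -
  let ?n = "nn S"
  have fin: "finite A" and Am: "\<And>a. a \<in> A \<Longrightarrow> a \<in> midx ?n" and cH: "\<And>a. a \<in> A \<Longrightarrow> c a \<in> FH S"
    using A(1) unfolding FH_coeffs_def by auto
  have pY: "p \<in> Y S" by (rule flat.Lperp_Y[OF p])
  have FYx: "mono_fun ?n x b \<in> FY S" for b by (rule FY_mono_fun) (rule x_FY)
  \<comment> \<open>If all coefficients nonzero at \<open>p\<close> have exponent at most
    \<open>k\<close> in the top generator, the derivative with index \<open>d\<close> isolates the
    coefficient at \<open>d(nn S := k)\<close>. This is used for the largest such exponent and then
    for k = 0.\<close>
  have key: "mpd S z d \<phi> p = (if d(?n := k) \<in> A then c (d(?n := k)) p * (K ^ k * of_nat (mfact ?n d)) else 0)"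
    if k: "\<And>a. a \<in> A \<Longrightarrow> c a p \<noteq> 0 \<Longrightarrow> a ?n \<le> k" and d: "supp_in J0 d" "ddot S d + k * dg S ?n = m" for k d
  proof -
    have dm: "d \<in> midx ?n" using flat.supp_midx[OF J0 d(1)] .
    have "mpd S z d \<phi> p = mpd S z d (\<lambda>p. \<Sum>a\<in>A. c a p * mono_fun ?n x a p) p"
      by (rule flat.mpd_cong[OF flat.van_FY[OF J0 \<phi>(1)] bspec[OF \<phi>(2)] pY])
    also have "\<dots> = (\<Sum>a\<in>A. mpd S z d (\<lambda>p. c a p * mono_fun ?n x a p) p)"
      by (rule flat.mpd_sum[OF fin dm FY_mult[OF flat.FH_FY[OF cH] FYx] pY])
    also have "\<dots> = (\<Sum>a\<in>A. if a = d(?n := k) then c a p * (K ^ k * of_nat (mfact ?n d)) else 0)"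
    proof (rule sum.cong[OF refl])
      fix a assume a: "a \<in> A"
      have *: "mpd S z d (\<lambda>p. c a p * mono_fun ?n x a p) p = c a p * mpd S z d (mono_fun ?n x a) p"
        by (rule flat.mpd_mult_left[OF dm flat.fibre_const_FH[OF cH[OF a]] FYx pY])
      show "mpd S z d (\<lambda>p. c a p * mono_fun ?n x a p) p =
         (if a = d(?n := k) then c a p * (K ^ k * of_nat (mfact ?n d)) else 0)"
      proof (cases "c a p = 0")
        case True
        show ?thesis unfolding * True by simp
      next
        case False
        show ?thesis
          unfolding * mpd_mono_x[OF Am[OF a] bspec[OF A(2) a] k[OF a False] d p] by simp
      qed
    qed
    also have "\<dots> = (if d(?n := k) \<in> A then c (d(?n := k)) p * (K ^ k * of_nat (mfact ?n d)) else 0)"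
      by (rule sum.delta[OF fin])
    finally show ?thesis .
  qed
  define T where "T = {a \<in> A. c a p \<noteq> 0}"
  have top0: "\<forall>a\<in>T. a ?n = 0"
  proof (rule ccontr)
    assume ne: "\<not> (\<forall>a\<in>T. a ?n = 0)"
    have finT: "finite ((\<lambda>a. a ?n) ` T)" using fin by (simp add: T_def)
    have neT: "(\<lambda>a. a ?n) ` T \<noteq> {}" using ne by auto
    \<comment> \<open>For the largest exponent the isolating derivative has weight m - k d_n < m,
      where \<phi> vanishes, while K^k is nonzero.\<close>
    define k where "k = Max ((\<lambda>a. a ?n) ` T)"
    have kmax: "a ?n \<le> k" if "a \<in> A" "c a p \<noteq> 0" for a
      unfolding k_def by (rule Max_ge[OF finT]) (use that in \<open>auto simp: T_def\<close>)
    obtain a where aT: "a \<in> T" and ak: "k = a ?n"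
      using Max_in[OF finT neT] unfolding k_def by blast
    have aA: "a \<in> A" "c a p \<noteq> 0" using aT by (simp_all add: T_def)
    obtain a' where "a' \<in> A" "c a' p \<noteq> 0" "a' ?n \<noteq> 0" using ne by (auto simp: T_def)
    then have k0: "k > 0" using kmax[of a'] by simp
    let ?d = "a(?n := 0)"
    have d: "supp_in J0 ?d" using Am[OF aA(1)] by (auto simp: supp_in_def midx_def)
    have deg: "ddot S ?d + k * dg S ?n = m"
      using ddot_split[of S a] bspec[OF A(2) aA(1)] by (simp add: ak mult.commute)
    have "?d(?n := k) = a" using ak by simp
    moreover have "mpd S z ?d \<phi> p =
        (if ?d(?n := k) \<in> A then c (?d(?n := k)) p * (K ^ k * of_nat (mfact ?n ?d)) else 0)"
      by (rule key[OF _ d deg]) (rule kmax)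
    ultimately have "mpd S z ?d \<phi> p = c a p * (K ^ k * of_nat (mfact ?n ?d))"
      using aA(1) by (simp only: if_True)
    moreover have "ddot S ?d < m" using deg k0 dg_top_pos by (metis less_add_same_cancel1 nat_0_less_mult_iff)
    then have "mpd S z ?d \<phi> p = 0" by (rule flat.van_mpd[OF \<phi>(1) d _ p])
    moreover have "mfact ?n ?d \<noteq> 0" by (simp add: mfact_def)
    ultimately show False using aA(2) K_nz by simp
  qed
  show "c a p = 0" if "a \<in> A" "a ?n \<noteq> 0" for a
    using top0 that by (auto simp: T_def)
  show "mpd S z b \<phi> p = of_nat (mfact ?n b) * (if b \<in> A then c b p else 0)"
    if b: "b \<in> midx ?n" "b ?n = 0" "ddot S b = m" for b
  proof -
    have bJ: "supp_in J0 b" using b by (auto simp: supp_in_def midx_def)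
    have "b(?n := 0) = b" using b(2) by (metis fun_upd_triv)
    have "mpd S z b \<phi> p = (if b(?n := 0) \<in> A then c (b(?n := 0)) p * (K ^ 0 * of_nat (mfact ?n b)) else 0)"
      by (rule key[OF _ bJ]) (use top0 b(3) in \<open>auto simp: T_def\<close>)
    then show ?thesis unfolding \<open>b(?n := 0) = b\<close> by simp
  qed
qed

text \<open>After the multiple of x^n is split off, the form agrees on the slice with the two linear
  error terms up to weight m + 1. Its coefficients are thus the derivatives of these error terms at
  weight m.\<close>

lemma IW_expansion:
  assumes \<alpha>: "\<alpha> \<in> {1..nn S}" and \<beta>: "\<beta> \<in> {1..nn S}" and p: "p \<in> Y S"
  shows "IW S z (x \<alpha>) (x \<beta>) p = (if \<alpha> + \<beta> = nn S then 1 / res S L (x (nn S)) p * x (nn S) p else 0)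
    + (\<Sum>b | b \<in> midx (nn S) \<and> b (nn S) = 0 \<and> ddot S b = dg S \<alpha> + dg S \<beta>.
         1 / of_nat (mfact (nn S) b)
         * res S L (mpd S z b (\<lambda>q. pd S z (nn S - \<beta>) (x \<alpha>) q + pd S z (nn S - \<alpha>) (x \<beta>) q)) p
         * mono_fun (nn S) x b p)"
proof -
  let ?n = "nn S" and ?I = "{1..nn S}"
  define m where "m = dg S \<alpha> + dg S \<beta>"
  define \<epsilon> :: complex where "\<epsilon> = (if \<alpha> + \<beta> = ?n then 1 else 0)"
  define P where "P = (\<lambda>\<gamma> p. pd S z \<gamma> (x \<alpha>) p - (if \<alpha> = \<gamma> then 1 else 0))"
  define Q where "Q = (\<lambda>\<gamma> p. pd S z \<gamma> (x \<beta>) p - (if \<beta> = \<gamma> then 1 else 0))"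
  \<comment> \<open>When \<alpha> + \<beta> = n the form has constant term 1 on
    \<open>Lperp\<close>, which prevents order m. Since x^n equals K there, subtracting x^n / K
    removes it.\<close>
  define \<phi> where "\<phi> = (\<lambda>p. IW S z (x \<alpha>) (x \<beta>) p - \<epsilon> / K * x ?n p)"
  note Knz = K_nz
  have a: "\<alpha> \<le> ?n" "?n - \<alpha> \<le> ?n" and b: "\<beta> \<le> ?n" "?n - \<beta> \<le> ?n" using \<alpha> \<beta> by auto
  have m_pos: "m > 0" using dg_pos[OF \<alpha>] by (simp add: m_def)
  have vP: "van S L z ?I (dg S \<alpha> + dg S (?n - \<gamma>)) (P \<gamma>)" if "\<gamma> \<le> ?n" for \<gamma>
    unfolding P_def by (rule van_pd_x[OF \<alpha> that])
  have vQ: "van S L z ?I (dg S \<beta> + dg S (?n - \<gamma>)) (Q \<gamma>)" if "\<gamma> \<le> ?n" for \<gamma>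
    unfolding Q_def by (rule van_pd_x[OF \<beta> that])
  \<comment> \<open>Multiplying out, the two Kronecker deltas select i = \<alpha> and i = n -
    \<beta>; they coincide exactly when \<alpha> + \<beta> = n, which leaves \<epsilon>.\<close>
  have IW: "IW S z (x \<alpha>) (x \<beta>) p = (\<Sum>i\<le>?n. P i p * Q (?n - i) p) + P (?n - \<beta>) p + Q (?n - \<alpha>) p + \<epsilon>" for p
  proof -
    have "IW S z (x \<alpha>) (x \<beta>) p = (\<Sum>i\<le>?n. (P i p + (if \<alpha> = i then 1 else 0)) * (Q (?n - i) p + (if \<beta> = ?n - i then 1 else 0)))"
      unfolding IW_eq P_def Q_def by simp
    also have "\<dots> = (\<Sum>i\<le>?n. P i p * Q (?n - i) p + (if i = ?n - \<beta> then P i p else 0) +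
        (if i = \<alpha> then Q (?n - i) p else 0) + (if i = \<alpha> then \<epsilon> else 0))"
      by (rule sum.cong[OF refl]) (use a b in \<open>auto simp: \<epsilon>_def algebra_simps\<close>)
    also have "\<dots> = (\<Sum>i\<le>?n. P i p * Q (?n - i) p) + P (?n - \<beta>) p + Q (?n - \<alpha>) p + \<epsilon>"
      using a b by (simp only: sum.distrib sum.delta finite_atMost atMost_iff if_True)
    finally show ?thesis .
  qed
  have "van S L z ?I (m + 1) (\<lambda>p. P i p * Q (?n - i) p)" if i: "i \<in> {..?n}" for i
  proof (rule flat.van_mult[OF order_refl dg_pos vP vQ])
    have "?n - (?n - i) = i" "dg S i + dg S (?n - i) = dg S ?n" using i duality by auto
    then show "m + 1 \<le> dg S \<alpha> + dg S (?n - i) + (dg S \<beta> + dg S (?n - (?n - i)))"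
      using dg_top_pos by (simp only: m_def)
  qed (use i in auto)
  then have "van S L z ?I (m + 1) (\<lambda>p. \<Sum>i\<le>?n. P i p * Q (?n - i) p)"
    by (rule flat.van_sum[OF order_refl])
  then have 1: "van S L z J0 (m + 1) (\<lambda>p. \<Sum>i\<le>?n. P i p * Q (?n - i) p)"
    by (rule flat.van_subset[OF _ J0])
  \<comment> \<open>If \<epsilon> is nonzero then m = d_n, which is below the order 2 d_n of x^n - K
    on the slice.\<close>
  have 2: "van S L z J0 (m + 1) (\<lambda>p. \<epsilon> / K * (x ?n p - K))"
  proof (cases "\<alpha> + \<beta> = ?n")
    case True
    then have "\<beta> = ?n - \<alpha>" by simp
    then have "m = dg S ?n" using duality[OF a(1)] by (simp add: m_def)
    then have "van S L z J0 (m + 1) (\<lambda>p. x ?n p - K)"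
      using flat.van_antimono[OF J0 van_x_top, of "m + 1"] dg_top_pos by simp
    then show ?thesis by (rule flat.van_mult_left[OF J0 flat.fibre_const_const])
  next
    case False
    then show ?thesis using flat.van_zero[OF J0] by (simp add: \<epsilon>_def)
  qed
  have 3: "van S L z J0 (m + 1) (\<lambda>p. \<phi> p - (P (?n - \<beta>) p + Q (?n - \<alpha>) p))"
    by (rule flat.van_cong[OF J0 flat.van_diff[OF J0 1 2]])
       (use Knz in \<open>simp add: \<phi>_def IW right_diff_distrib\<close>)
  have vP': "van S L z J0 m (P (?n - \<beta>))" and vQ': "van S L z J0 m (Q (?n - \<alpha>))"
    using flat.van_subset[OF vP[OF b(2)] J0] flat.van_subset[OF vQ[OF a(2)] J0] a(1) b(1)
    by (simp_all add: m_def add.commute)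
  have PQ: "van S L z J0 m (\<lambda>p. P (?n - \<beta>) p + Q (?n - \<alpha>) p)"
    by (rule flat.van_add[OF J0 vP' vQ'])
  have "van S L z J0 m (\<lambda>p. \<phi> p - (P (?n - \<beta>) p + Q (?n - \<alpha>) p))"
    by (rule flat.van_antimono[OF J0 3]) simp
  from flat.van_add[OF J0 this PQ] have v\<phi>: "van S L z J0 m \<phi>"
    by (simp only: diff_add_cancel)
  have \<phi>Y: "\<phi> \<in> FY S" by (rule flat.van_FY[OF J0 v\<phi>])
  let ?D = "\<lambda>q. pd S z (?n - \<beta>) (x \<alpha>) q + pd S z (?n - \<alpha>) (x \<beta>) q"
  have DY: "?D \<in> FY S"
    by (intro FY_add flat.FY_pd x_FY \<alpha> \<beta> a b)
  \<comment> \<open>\<open>P\<close> and \<open>Q\<close> differ from the partial derivatives by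
    constants. As m > 0, the index \<open>d\<close> is not zero, and its derivative kills
    them.\<close>
  have mpd_\<phi>: "mpd S z d \<phi> q = mpd S z d ?D q"
    if d: "d \<in> midx ?n" "d ?n = 0" "ddot S d = m" and q: "q \<in> Lperp S L" for d q
  proof -
    have dJ: "supp_in J0 d" using d by (auto simp: supp_in_def midx_def)
    have dnz: "d \<noteq> (\<lambda>_. 0)" using d(3) m_pos by auto
    note qY = flat.Lperp_Y[OF q]
    define k :: complex where "k = (if \<alpha> = ?n - \<beta> then 1 else 0) + (if \<beta> = ?n - \<alpha> then 1 else 0)"
    have PQk: "(\<lambda>p. P (?n - \<beta>) p + Q (?n - \<alpha>) p) = (\<lambda>p. ?D p - k)"
      by (rule ext) (simp add: P_def Q_def k_def)
    have "mpd S z d (\<lambda>p. \<phi> p - (?D p - k)) q = 0"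
      using flat.van_mpd[OF 3 dJ _ q] d(3) PQk by (simp add: fun_eq_iff)
    then have "mpd S z d \<phi> q = mpd S z d (\<lambda>p. ?D p - k) q"
      unfolding flat.mpd_diff[OF d(1) \<phi>Y FY_diff[OF DY FY_const] qY] by simp
    also have "\<dots> = mpd S z d ?D q - mpd S z d (\<lambda>_. k) q"
      by (rule flat.mpd_diff[OF d(1) DY FY_const qY])
    also have "mpd S z d (\<lambda>_. k) q = 0" by (rule flat.mpd_const_Lperp[OF d(1) dnz q])
    finally show ?thesis by simp
  qed
  have \<phi>_SWm: "\<phi> \<in> SWm S m"
  proof -
    have "IW S z (x \<alpha>) (x \<beta>) \<in> SWm S m"
      unfolding m_def by (rule IW_SWm[OF x_SWm[OF \<alpha>] x_SWm[OF \<beta>]])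
    moreover have "(\<lambda>p. - (\<epsilon> / K) * x ?n p) \<in> SWm S m"
    proof (cases "\<alpha> + \<beta> = ?n")
      case True
      then have "\<beta> = ?n - \<alpha>" by simp
      then have "m = dg S ?n" using duality[OF a(1)] by (simp add: m_def)
      then show ?thesis by (simp only:) (rule SWm_FH_mult[OF FH_const x_SWm[OF top_index(1)]])
    qed (simp add: \<epsilon>_def SWm_zero)
    ultimately have "(\<lambda>p. IW S z (x \<alpha>) (x \<beta>) p + - (\<epsilon> / K) * x ?n p) \<in> SWm S m"
      by (rule SWm_add)
    moreover have "(\<lambda>p. IW S z (x \<alpha>) (x \<beta>) p + - (\<epsilon> / K) * x ?n p) = \<phi>"
      by (rule ext) (simp add: \<phi>_def)
    ultimately show ?thesis by (simp only:)
  qed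
  obtain A c where A: "FH_coeffs S A c" "\<forall>a\<in>A. ddot S a = m"
    "\<forall>p\<in>Y S. \<phi> p = (\<Sum>a\<in>A. c a p * mono_fun ?n x a p)"
    using homogeneous_expansion[OF basic_x \<phi>_SWm] by (elim exE conjE)
  have fin: "finite A" and Am: "\<And>a. a \<in> A \<Longrightarrow> a \<in> midx ?n" and cH: "\<And>a. a \<in> A \<Longrightarrow> c a \<in> FH S"
    using A(1) unfolding FH_coeffs_def by auto
  let ?q = "flat.proj p"
  have q: "?q \<in> Lperp S L" by (rule flat.proj_Lperp[OF p])
  note ident = coefficient_identification[OF A(1,2) v\<phi> A(3) q]
  have cq: "c a ?q = c a p" if "a \<in> A" for a by (rule flat.FH_proj[OF cH[OF that] p])
  let ?B = "{b. b \<in> midx ?n \<and> b ?n = 0 \<and> ddot S b = dg S \<alpha> + dg S \<beta>}"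
  have finB: "finite ?B"
    by (rule finite_subset[OF _ finite_ddot_eq[OF dg_pos, of "dg S \<alpha> + dg S \<beta>"]]) auto
  have "\<phi> p = (\<Sum>a\<in>A. c a p * mono_fun ?n x a p)" by (rule bspec[OF A(3) p])
  also have "\<dots> = (\<Sum>a\<in>A \<inter> ?B. c a p * mono_fun ?n x a p)"
  proof (rule sum.mono_neutral_right[OF fin])
    show "\<forall>a\<in>A - A \<inter> ?B. c a p * mono_fun ?n x a p = 0"
    proof
      fix a assume a: "a \<in> A - A \<inter> ?B"
      then have aA: "a \<in> A" by blast
      have "a ?n \<noteq> 0"
      proof
        assume "a ?n = 0"
        then have "a \<in> ?B"
          using Am[OF aA] bspec[OF A(2) aA] unfolding m_def mem_Collect_eq by (intro conjI)
        then show False using a by (simp only: Diff_iff Int_iff simp_thms)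
      qed
      then have "c a p = 0" using ident(1)[OF aA] cq[OF aA] by simp
      then show "c a p * mono_fun ?n x a p = 0" by simp
    qed
  qed blast
  also have "\<dots> = (\<Sum>b\<in>?B. if b \<in> A then c b p * mono_fun ?n x b p else 0)"
    by (simp only: sum.inter_restrict[OF finB, symmetric] Int_commute)
  also have "\<dots> = (\<Sum>b\<in>?B. 1 / of_nat (mfact ?n b) * res S L (mpd S z b ?D) p * mono_fun ?n x b p)"
  proof (rule sum.cong[OF refl])
    fix d assume d: "d \<in> ?B"
    then have dB: "d \<in> midx ?n" "d ?n = 0" "ddot S d = m" by (simp_all add: m_def)
    have "res S L (mpd S z d ?D) p = mpd S z d \<phi> ?q"
      unfolding flat.res_eq[OF p] by (rule mpd_\<phi>[OF dB q, symmetric])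
    also have "\<dots> = of_nat (mfact ?n d) * (if d \<in> A then c d ?q else 0)"
      by (rule ident(2)[OF dB])
    also have "(if d \<in> A then c d ?q else 0) = (if d \<in> A then c d p else 0)"
      using cq by simp
    finally have r: "res S L (mpd S z d ?D) p = of_nat (mfact ?n d) * (if d \<in> A then c d p else 0)" .
    have "mfact ?n d \<noteq> 0" by (simp add: mfact_def)
    then show "(if d \<in> A then c d p * mono_fun ?n x d p else 0) =
       1 / of_nat (mfact ?n d) * res S L (mpd S z d ?D) p * mono_fun ?n x d p"
      unfolding r by simp
  qed
  finally have main: "IW S z (x \<alpha>) (x \<beta>) p - \<epsilon> / K * x ?n p =
     (\<Sum>b\<in>?B. 1 / of_nat (mfact ?n b) * res S L (mpd S z b ?D) p * mono_fun ?n x b p)"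
    by (simp only: \<phi>_def)
  have "res S L (x ?n) p = K"
    unfolding flat.res_eq[OF p] by (rule x_top_Lperp[OF q])
  then have top: "\<epsilon> / K * x ?n p = (if \<alpha> + \<beta> = ?n then 1 / res S L (x ?n) p * x ?n p else 0)"
    by (simp add: \<epsilon>_def)
  have "u = v + w" if "u - v = w" for u v w :: complex using that[symmetric] by simp
  from this[OF main] show ?thesis unfolding top .
qed

text \<open>By duality one more derivative in z^(n-\<beta>) completes weight d_\<alpha> + d_\<beta>
  to d_\<alpha> + d_n, so the coefficients in (iii) are among the listed Taylor coefficients. For
  \<beta> = n the additional variable is z^0, of weight 0.\<close>

lemma taylor_coefficients:
  assumes \<alpha>: "\<alpha> \<in> {1..nn S}" and \<beta>: "\<beta> \<in> {1..nn S}" and b: "ddot S b = dg S \<alpha> + dg S \<beta>"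
  shows "if \<beta> = nn S
     then ddot S b = dg S \<alpha> + dg S (nn S) \<and>
       (\<forall>p\<in>Lperp S L. mpd S z b (pd S z (nn S - \<beta>) (x \<alpha>)) p = pd S z 0 (mpd S z b (x \<alpha>)) p)
     else ddot S (b(nn S - \<beta> := b (nn S - \<beta>) + 1)) = dg S \<alpha> + dg S (nn S) \<and>
       (\<forall>p\<in>Lperp S L. mpd S z b (pd S z (nn S - \<beta>) (x \<alpha>)) p
           = mpd S z (b(nn S - \<beta> := b (nn S - \<beta>) + 1)) (x \<alpha>) p)"
proof (cases "\<beta> = nn S")
  case True
  have "mpd S z b (pd S z 0 (x \<alpha>)) p = pd S z 0 (mpd S z b (x \<alpha>)) p" if "p \<in> Lperp S L" for p
    by (rule flat.mpd_pd[OF x_FY[OF \<alpha>] _ flat.Lperp_Y[OF that]]) simp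
  then show ?thesis using True b by simp
next
  case False
  then have i: "nn S - \<beta> \<in> {1..nn S}" "\<beta> \<le> nn S" using \<beta> by auto
  have "ddot S (b(nn S - \<beta> := b (nn S - \<beta>) + 1)) = dg S \<alpha> + dg S (nn S)"
    unfolding ddot_inc[OF i(1)] b using duality[OF i(2)] by simp
  moreover have "mpd S z b (pd S z (nn S - \<beta>) (x \<alpha>)) p = mpd S z (b(nn S - \<beta> := b (nn S - \<beta>) + 1)) (x \<alpha>) p"
    if "p \<in> Lperp S L" for p
    by (rule flat.mpd_inc[OF x_FY[OF \<alpha>] i(1) flat.Lperp_Y[OF that], symmetric])
  ultimately show ?thesis using False by (simp only: if_False) blast
qed

lemma IW_z0:
  assumes x0: "\<forall>p\<in>Y S. f p = cpair (z0 S) p" and p: "p \<in> Y S"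
  shows "IW S z f h p = pd S z (nn S) h p"
proof -
  have "pd S z i f p = (if i = 0 then 1 else 0)" if i: "i \<le> nn S" for i
  proof -
    have "pd S z i (cpair (z 0)) p = pd S z i f p"
      by (rule flat.pd_cong[OF FY_cpair i p]) (simp add: x0 z_0)
    then show ?thesis using flat.pd_coord[OF i, of 0 p] by simp
  qed
  then have "IW S z f h p = (\<Sum>i\<le>nn S. if i = 0 then pd S z (nn S - i) h p else 0)"
    unfolding IW_eq by (intro sum.cong) auto
  also have "\<dots> = pd S z (nn S) h p"
    by (simp only: sum.delta finite_atMost atMost_iff le0 if_True diff_zero)
  finally show ?thesis .
qed

lemma euler_const_nz: "euler_const \<noteq> 0"
  using K_nz by (auto simp: K_def)

lemma pd_top_x:
  assumes "\<beta> \<in> {1..nn S}" "p \<in> Y S"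
  shows "pd S z (nn S) (x \<beta>) p = of_real (mmax S) * of_nat (dg S \<beta>)
     / ((- 2 * of_real pi * \<i>) * of_real (IRI S) * of_nat (dg S (nn S))) * x \<beta> p"
proof -
  have e: "euler_const = (- 2 * of_real pi * \<i>) * of_real (IRI S) * of_nat (dg S (nn S)) / of_real (mmax S)"
    by (simp add: euler_const_def)
  have "pd S z (nn S) (x \<beta>) p = of_nat (dg S \<beta>) / euler_const * x \<beta> p"
    using SWm_euler[OF x_SWm[OF assms(1)] assms(2)] euler_const_nz by (simp add: field_simps)
  also have "of_nat (dg S \<beta>) / euler_const = of_real (mmax S) * of_nat (dg S \<beta>)
     / ((- 2 * of_real pi * \<i>) * of_real (IRI S) * of_nat (dg S (nn S)))"
    unfolding e by (simp add: mult.commute)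
  finally show ?thesis .
qed

end

theorem theorem8p4:
  fixes S :: "'v::euclidean_space elliptic"
    and g :: "'v \<Rightarrow> 'v" and \<zeta> :: complex and L :: "'v set"
    and z :: "nat \<Rightarrow> 'v \<times> 'v" and x :: "nat \<Rightarrow> ('v \<Rightarrow>\<^sub>L complex) \<Rightarrow> complex" and n :: nat
  assumes setting: "elliptic_setting S"
    and n_def: "n = rk S + 1"
    and codim: "codim_one S"
    and triplet: "admissible S g \<zeta> L"
    and zt: "zero_type S L"
    and z: "flat_basis S g \<zeta> L z"
    and x0: "\<forall>p\<in>Y S. x 0 p = cpair (z0 S) p"
    and good: "good_invariants S g \<zeta> L x"
    and compat: "compatible S L z x"
  shows
    "(\<forall>p\<in>Lperp S L. x n p = (- 2 * of_real pi * \<i>) * of_real (IRI S) / of_real (mmax S))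
   \<and> (\<forall>\<beta>\<le>n. \<forall>p\<in>Y S. IW S z (x 0) (x \<beta>) p =
        of_real (mmax S) * of_nat (dg S \<beta>)
          / ((- 2 * of_real pi * \<i>) * of_real (IRI S) * of_nat (dg S n)) * x \<beta> p)
   \<and> (\<forall>\<beta>\<in>{1..n}. \<forall>p\<in>Y S. IW S z (x 0) (x \<beta>) p =
        of_real (expo S (\<beta> - 1)) / ((- 2 * of_real pi * \<i>) * of_real (IRI S)) * x \<beta> p)
   \<and> (\<forall>p\<in>Y S. IW S z (x 0) (x 0) p = 0)
   \<and> (\<forall>\<alpha>\<in>{1..n}. \<forall>\<beta>\<in>{1..n}. \<forall>p\<in>Y S. IW S z (x \<alpha>) (x \<beta>) p =
        (if \<alpha> + \<beta> = n then 1 / res S L (x n) p * x n p else 0)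
        + (\<Sum>b | b \<in> midx n \<and> b n = 0 \<and> ddot S b = dg S \<alpha> + dg S \<beta>.
             1 / of_nat (mfact n b)
             * res S L (mpd S z b (\<lambda>q. pd S z (n - \<beta>) (x \<alpha>) q + pd S z (n - \<alpha>) (x \<beta>) q)) p
             * mono_fun n x b p))
   \<and> (\<forall>\<alpha>\<in>{1..n}. \<forall>\<beta>\<in>{1..n}. \<forall>b\<in>midx n. b n = 0 \<and> ddot S b = dg S \<alpha> + dg S \<beta> \<longrightarrow>
        (if \<beta> = n
         then ddot S b = dg S \<alpha> + dg S n \<and>
              (\<forall>p\<in>Lperp S L. mpd S z b (pd S z (n - \<beta>) (x \<alpha>)) p = pd S z 0 (mpd S z b (x \<alpha>)) p)
         else ddot S (b(n - \<beta> := b (n - \<beta>) + 1)) = dg S \<alpha> + dg S n \<and>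
              (\<forall>p\<in>Lperp S L. mpd S z b (pd S z (n - \<beta>) (x \<alpha>)) p
                            = mpd S z (b(n - \<beta> := b (n - \<beta>) + 1)) (x \<alpha>) p)))"
proof -
  \<comment> \<open>A primitive root of unity has positive order by definition.\<close>
  have "dg S (nn S) > 0"
    using triplet by (auto simp: admissible_def primitive_root_def)
  then interpret good_coordinates S g \<zeta> L z x
    by unfold_locales (use setting codim triplet z good compat in auto)
  have i: "x n p = (- 2 * of_real pi * \<i>) * of_real (IRI S) / of_real (mmax S)" if "p \<in> Lperp S L" for p
    using x_top_Lperp[OF that] dg_top_pos by (simp add: n_def K_def euler_const_def)
  have pd0: "pd S z n (x 0) p = 0" if p: "p \<in> Y S" for p
  proof -
    have "pd S z n (cpair (z 0)) p = pd S z n (x 0) p"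
      unfolding n_def by (rule flat.pd_cong[OF FY_cpair top_index(2) p]) (simp add: x0 z_0)
    then show ?thesis using flat.pd_coord[OF top_index(2), of 0 p] by (simp add: n_def)
  qed
  have ii: "IW S z (x 0) (x \<beta>) p = of_real (mmax S) * of_nat (dg S \<beta>)
          / ((- 2 * of_real pi * \<i>) * of_real (IRI S) * of_nat (dg S n)) * x \<beta> p"
    if "\<beta> \<le> n" and p: "p \<in> Y S" for \<beta> p
  proof (cases "\<beta> = 0")
    case True
    then show ?thesis using IW_z0[OF x0 p, of "x \<beta>"] pd0[OF p] by (simp add: n_def)
  next
    case False
    then have "\<beta> \<in> {1..nn S}" using that by (simp add: n_def)
    then show ?thesis unfolding IW_z0[OF x0 p] n_def by (rule pd_top_x[OF _ p])
  qed
  have ii': "IW S z (x 0) (x \<beta>) p = of_real (expo S (\<beta> - 1)) / ((- 2 * of_real pi * \<i>) * of_real (IRI S)) * x \<beta> p"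
    if "\<beta> \<in> {1..n}" "p \<in> Y S" for \<beta> p
  proof -
    have "\<beta> \<in> {1..nn S}" using that by (simp add: n_def)
    from expo_eq_dg[OF this] show ?thesis
      using ii[of \<beta> p] that by (simp add: n_def)
  qed
  have ii0: "IW S z (x 0) (x 0) p = 0" if "p \<in> Y S" for p
    using IW_z0[OF x0 that, of "x 0"] pd0[OF that] by (simp add: n_def)
  note iii = IW_expansion[folded n_def]
  have coeffs: "if \<beta> = n
         then ddot S b = dg S \<alpha> + dg S n \<and>
              (\<forall>p\<in>Lperp S L. mpd S z b (pd S z (n - \<beta>) (x \<alpha>)) p = pd S z 0 (mpd S z b (x \<alpha>)) p)
         else ddot S (b(n - \<beta> := b (n - \<beta>) + 1)) = dg S \<alpha> + dg S n \<and>
              (\<forall>p\<in>Lperp S L. mpd S z b (pd S z (n - \<beta>) (x \<alpha>)) p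
                            = mpd S z (b(n - \<beta> := b (n - \<beta>) + 1)) (x \<alpha>) p)"
    if "\<alpha> \<in> {1..n}" "\<beta> \<in> {1..n}" "b n = 0 \<and> ddot S b = dg S \<alpha> + dg S \<beta>" for \<alpha> \<beta> b
    using that unfolding n_def by (intro taylor_coefficients) (erule conjunct2 | assumption)+
  show ?thesis
    by (intro conjI ballI allI impI) (rule i ii ii' ii0 iii coeffs; assumption)+
qed

end
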